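(* Let $(F|K,v)$ be a valued function field (i.e. $F|K$ is a finitely generated field extension) such that $F|K$ is separable and $(F|K,v)$ is without transcendence defect, with $r=\dim_{\mathbb Q}\mathbb Q\otimes(vF/vK)$ and $s=\operatorname{trdeg}Fv|Kv$. Then there is a transcendence basis $\mathcal T=\{x_1,\dots,x_r,y_1,\dots,y_s\}$ of $F|K$ such that $F|K(\mathcal T)$ is separable, with $vK(\mathcal T)=vK\oplus\bigoplus_{1\le i\le r}\mathbb Z\,vx_i$ and $K(\mathcal T)v=Kv(y_1v,\dots,y_sv)$. If, in addition, $vF/vK$ is torsion free and $Fv|Kv$ is separable, then $\mathcal T$ can be chosen to additionally satisfy $vK(\mathcal T)=vF$ and $Fv|K(\mathcal T)v$ separable.
   Context: For a valued field $(K,v)$, $vK$ is the value group, $Kv$ the residue field and $av$ the residue of $a$. A field extension $L|K$ is separable if (in characteristic $p>0$) $L$ and $K^{1/p}$ are linearly disjoint over $K$; in characteristic $0$ every extension is separable. For $(F|K,v)$ with $F|K$ of finite transcendence degree, $\operatorname{trdeg}F|K\ge\operatorname{trdeg}Fv|Kv+\dim_{\mathbb Q}\mathbb Q\otimes(vF/vK)$; the extension is without transcendence defect if equality holds. *)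

theory Defs
  imports "HOL-Computational_Algebra.Polynomial" "HOL-Computational_Algebra.Primes"
begin

definition alg_closed_ty :: "'a::field itself \<Rightarrow> bool" where
  "alg_closed_ty _ \<longleftrightarrow> (\<forall>p::'a poly. 0 < degree p \<longrightarrow> (\<exists>z. poly p z = 0))"

definition is_subfield :: "'a::field set \<Rightarrow> bool" where
  "is_subfield E \<longleftrightarrow> 0 \<in> E \<and> 1 \<in> E \<and>
     (\<forall>x\<in>E. \<forall>y\<in>E. x + y \<in> E \<and> x * y \<in> E) \<and>
     (\<forall>x\<in>E. - x \<in> E) \<and> (\<forall>x\<in>E. x \<noteq> 0 \<longrightarrow> inverse x \<in> E)"

definition gen_field :: "'a::field set \<Rightarrow> 'a set" where
  "gen_field S = \<Inter>{E. is_subfield E \<and> S \<subseteq> E}"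

definition fin_gen_ext :: "'a::field set \<Rightarrow> 'a set \<Rightarrow> bool" where
  "fin_gen_ext K F \<longleftrightarrow> (\<exists>S. finite S \<and> F = gen_field (K \<union> S))"

definition algebraic_over :: "'a::field set \<Rightarrow> 'a \<Rightarrow> bool" where
  "algebraic_over K z \<longleftrightarrow> (\<exists>p. p \<noteq> 0 \<and> (\<forall>i. coeff p i \<in> K) \<and> poly p z = 0)"

text \<open>T is algebraically independent over K: no nontrivial polynomial relation
  (in finitely many elements of T, coefficients in K) holds. Monomials are
  exponent functions supported on a finite S \<subseteq> T.\<close>
definition alg_indep :: "'a::field set \<Rightarrow> 'a set \<Rightarrow> bool" where
  "alg_indep K T \<longleftrightarrow> (\<forall>S (M :: ('a \<Rightarrow> nat) set) c.
     finite S \<and> S \<subseteq> T \<and> finite M \<and> (\<forall>m\<in>M. \<forall>t. t \<notin> S \<longrightarrow> m t = 0) \<and>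
     (\<forall>m\<in>M. c m \<in> K) \<and> (\<Sum>m\<in>M. c m * (\<Prod>t\<in>S. t ^ m t)) = 0
     \<longrightarrow> (\<forall>m\<in>M. c m = 0))"

definition transc_basis :: "'a::field set \<Rightarrow> 'a set \<Rightarrow> 'a set \<Rightarrow> bool" where
  "transc_basis K F T \<longleftrightarrow> T \<subseteq> F \<and> alg_indep K T \<and>
     (\<forall>z\<in>F. algebraic_over (gen_field (K \<union> T)) z)"

definition has_trdeg :: "'a::field set \<Rightarrow> 'a set \<Rightarrow> nat \<Rightarrow> bool" where
  "has_trdeg K F n \<longleftrightarrow> (\<exists>T. transc_basis K F T \<and> finite T \<and> card T = n)"

definition lin_indep_over :: "'a::field set \<Rightarrow> 'a set \<Rightarrow> bool" where
  "lin_indep_over K A \<longleftrightarrow> (\<forall>c. (\<forall>a\<in>A. c a \<in> K) \<and> (\<Sum>a\<in>A. c a * a) = 0 \<longrightarrow> (\<forall>a\<in>A. c a = 0))"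

definition lin_disjoint :: "'a::field set \<Rightarrow> 'a set \<Rightarrow> 'a set \<Rightarrow> bool" where
  "lin_disjoint K L M \<longleftrightarrow> (\<forall>A. finite A \<and> A \<subseteq> L \<and> lin_indep_over K A \<longrightarrow> lin_indep_over M A)"

definition proot_field :: "nat \<Rightarrow> 'a::field set \<Rightarrow> 'a set" where
  "proot_field p K = {x. x ^ p \<in> K}"

text \<open>L|K separable: in characteristic p>0, L and K^(1/p) linearly disjoint over K
  (K^(1/p) taken inside the algebraically closed ambient field);
  in characteristic 0 the condition is vacuous.\<close>
definition separable_ext :: "'a::field set \<Rightarrow> 'a set \<Rightarrow> bool" where
  "separable_ext K L \<longleftrightarrow> (\<forall>p::nat. prime p \<and> (of_nat p :: 'a) = 0 \<longrightarrow>
      lin_disjoint K L (proot_field p K))"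

fun nsmul :: "nat \<Rightarrow> 'g::ab_group_add \<Rightarrow> 'g" where
  "nsmul 0 g = 0"
| "nsmul (Suc n) g = g + nsmul n g"

definition zsmul :: "int \<Rightarrow> 'g::ab_group_add \<Rightarrow> 'g" where
  "zsmul n g = (if 0 \<le> n then nsmul (nat n) g else - nsmul (nat (- n)) g)"

text \<open>v is a (Krull) valuation on the field F (values of nonzero elements; v 0 = \<infinity> implicit).\<close>
definition valuation :: "'a::field set \<Rightarrow> ('a \<Rightarrow> 'g::linordered_ab_group_add) \<Rightarrow> bool" where
  "valuation F v \<longleftrightarrow> (\<forall>x\<in>F. \<forall>y\<in>F. x \<noteq> 0 \<and> y \<noteq> 0 \<longrightarrow>
      v (x * y) = v x + v y \<and> (x + y \<noteq> 0 \<longrightarrow> min (v x) (v y) \<le> v (x + y)))"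

definition val_ring :: "'a::field set \<Rightarrow> ('a \<Rightarrow> 'g::linordered_ab_group_add) \<Rightarrow> 'a set" where
  "val_ring E v = {x\<in>E. x = 0 \<or> 0 \<le> v x}"

text \<open>res is a residue map (place) of (F,v): a ring homomorphism on the valuation ring
  whose kernel is exactly the maximal ideal; its image is (a copy of) the residue field.\<close>
definition residue_map :: "'a::field set \<Rightarrow> ('a \<Rightarrow> 'g::linordered_ab_group_add) \<Rightarrow> ('a \<Rightarrow> 'b::field) \<Rightarrow> bool" where
  "residue_map F v res \<longleftrightarrow> res 1 = 1 \<and>
     (\<forall>x\<in>val_ring F v. \<forall>y\<in>val_ring F v. res (x + y) = res x + res y \<and> res (x * y) = res x * res y) \<and>
     (\<forall>x\<in>val_ring F v. res x = 0 \<longleftrightarrow> (x = 0 \<or> 0 < v x))"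

definition vgroup :: "('a::field \<Rightarrow> 'g::linordered_ab_group_add) \<Rightarrow> 'a set \<Rightarrow> 'g set" where
  "vgroup v E = v ` (E - {0})"

definition resfield :: "('a::field \<Rightarrow> 'g::linordered_ab_group_add) \<Rightarrow> ('a \<Rightarrow> 'b::field) \<Rightarrow> 'a set \<Rightarrow> 'b set" where
  "resfield v res E = res ` val_ring E v"

text \<open>Independence of g_0..g_(n-1) in Q \<otimes> (G/H).\<close>
definition rat_indep_mod :: "'g::ab_group_add set \<Rightarrow> (nat \<Rightarrow> 'g) \<Rightarrow> nat \<Rightarrow> bool" where
  "rat_indep_mod H g n \<longleftrightarrow> (\<forall>c::nat \<Rightarrow> int. (\<Sum>i<n. zsmul (c i) (g i)) \<in> H \<longrightarrow> (\<forall>i<n. c i = 0))"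

definition ratrank :: "'g::ab_group_add set \<Rightarrow> 'g set \<Rightarrow> nat \<Rightarrow> bool" where
  "ratrank H G r \<longleftrightarrow> (\<exists>g. (\<forall>i<r. g i \<in> G) \<and> rat_indep_mod H g r) \<and>
      (\<forall>g. (\<forall>i<Suc r. g i \<in> G) \<longrightarrow> \<not> rat_indep_mod H g (Suc r))"

definition torsion_free_mod :: "'g::ab_group_add set \<Rightarrow> 'g set \<Rightarrow> bool" where
  "torsion_free_mod H G \<longleftrightarrow> (\<forall>g\<in>G. \<forall>n::nat. 0 < n \<and> nsmul n g \<in> H \<longrightarrow> g \<in> H)"

end

theory Submission
  imports Defs
begin

text \<open>
  Elements whose values are rationally independent modulo \<open>vK\<close> together with elements whose residues
  are algebraically independent over \<open>Kv\<close> always generate the expected value group and residue field,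
  and they form a transcendence basis when there is no transcendence defect.  What has to be arranged
  is separability.  In characteristic \<open>p\<close>, a finite extension \<open>F|E\<close> is separable as soon as \<open>F\<close> is
  generated over \<open>E\<close> by \<open>F\<^sup>p\<close>, and by Mac Lane's argument a separable function field of transcendence
  degree \<open>n\<close> is generated by \<open>n\<close> elements over \<open>K F\<^sup>p\<close>.  These generators are exchanged one by one
  for the prescribed elements \<open>t\<close>: adjoining \<open>t + b\<^sup>p z\<close> instead of \<open>t\<close> brings in the generator \<open>z\<close>, and
  if \<open>b\<^sup>p z\<close> has larger value than \<open>t\<close>, neither the value nor the residue of \<open>t\<close> changes.  This needs a
  nontrivial valuation; for a trivial one \<open>F\<close> and \<open>Fv\<close> are isomorphic and any separating
  transcendence basis works.  For the second part, \<open>F\<close> is finite over \<open>K(\<T>)\<close>, hence \<open>vF/vK\<close> and \<open>Fv|Kv\<close>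
  are finitely generated, so \<open>vF/vK\<close> is free and \<open>Fv|Kv\<close> has a separating transcendence basis, which
  are the values and residues to lift.
\<close>

section \<open>Subfields and generated subfields\<close>

text \<open>Separability over K(T) is always obtained from the single identity F = K F^p (T). Over a
  field E containing F^p every adjoined element has degree 1 or p, so membership in E(Z) obeys an
  exchange law, and generators can be traded against prescribed elements much as in a matroid. The
  obstacle is that a prescribed t may already lie in E, for instance as a p-th power; it then
  contributes no generator. The factor b^p is what makes the correction flexible: it lies in E, so
  E(t + b^p z) contains z whatever b is, and b remains free to control the value. The absence of
  transcendence defect enters as \<open>has_trdeg K F (r + s)\<close>. It bounds the number of Mac
  Lane generators by the number r + s of prescribed elements, so no generator is left over, and it
  turns r + s independent elements into a transcendence basis. Separability of Fv over K(T)v costs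
  nothing further: K(T)v is generated over Kv by the residues of the y_i, these are chosen as a
  separating basis of Fv|Kv, and the correction preserves them. The same exchange, with
  transcendence over the earlier elements in place of prescribed values, produces the separating
  bases themselves.\<close>

definition is_subring :: "'a::field set \<Rightarrow> bool" where
  "is_subring R \<longleftrightarrow> 1 \<in> R \<and> (\<forall>x\<in>R. \<forall>y\<in>R. x + y \<in> R \<and> x * y \<in> R) \<and> (\<forall>x\<in>R. - x \<in> R)"

lemma subfield_subring: "is_subfield E \<Longrightarrow> is_subring E"
  unfolding is_subfield_def is_subring_def by blast

lemma sr_1: "is_subring R \<Longrightarrow> 1 \<in> R"
  and sr_add: "is_subring R \<Longrightarrow> x \<in> R \<Longrightarrow> y \<in> R \<Longrightarrow> x + y \<in> R"
  and sr_mult: "is_subring R \<Longrightarrow> x \<in> R \<Longrightarrow> y \<in> R \<Longrightarrow> x * y \<in> R"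
  and sr_uminus: "is_subring R \<Longrightarrow> x \<in> R \<Longrightarrow> - x \<in> R"
  unfolding is_subring_def by blast+

lemma sr_0: "is_subring R \<Longrightarrow> 0 \<in> R"
  using sr_add[of R 1 "- 1"] sr_1 sr_uminus by fastforce

lemma sr_diff: "is_subring R \<Longrightarrow> x \<in> R \<Longrightarrow> y \<in> R \<Longrightarrow> x - y \<in> R"
  using sr_add[of R x "- y"] sr_uminus by fastforce

lemma sr_sum: "is_subring R \<Longrightarrow> (\<And>i. i \<in> I \<Longrightarrow> f i \<in> R) \<Longrightarrow> sum f I \<in> R"
  by (induction I rule: infinite_finite_induct) (auto intro: sr_add sr_0)

lemma sr_prod: "is_subring R \<Longrightarrow> (\<And>i. i \<in> I \<Longrightarrow> f i \<in> R) \<Longrightarrow> prod f I \<in> R"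
  by (induction I rule: infinite_finite_induct) (auto intro: sr_mult sr_1)

lemma sr_power: "is_subring R \<Longrightarrow> x \<in> R \<Longrightarrow> x ^ n \<in> R"
  by (induction n) (auto intro: sr_mult sr_1)

lemma sr_of_nat: "is_subring R \<Longrightarrow> of_nat n \<in> R"
  by (induction n) (auto intro: sr_add sr_1 sr_0)

lemmas sf_0 = sr_0[OF subfield_subring]
  and sf_1 = sr_1[OF subfield_subring]
  and sf_add = sr_add[OF subfield_subring]
  and sf_mult = sr_mult[OF subfield_subring]
  and sf_uminus = sr_uminus[OF subfield_subring]
  and sf_diff = sr_diff[OF subfield_subring]
  and sf_sum = sr_sum[OF subfield_subring]
  and sf_prod = sr_prod[OF subfield_subring]
  and sf_power = sr_power[OF subfield_subring]
  and sf_of_nat = sr_of_nat[OF subfield_subring]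

lemma sf_inverse: "is_subfield E \<Longrightarrow> x \<in> E \<Longrightarrow> inverse x \<in> E"
  by (cases "x = 0") (auto simp: is_subfield_def)

lemma sf_divide: "is_subfield E \<Longrightarrow> x \<in> E \<Longrightarrow> y \<in> E \<Longrightarrow> x / y \<in> E"
  by (simp add: divide_inverse sf_mult sf_inverse)

lemma subfieldI:
  assumes "is_subring R" "\<And>x. x \<in> R \<Longrightarrow> x \<noteq> 0 \<Longrightarrow> inverse x \<in> R"
  shows "is_subfield R"
  using assms sr_0[OF assms(1)] unfolding is_subfield_def is_subring_def by blast

lemma subring_Inter: "(\<And>R. R \<in> \<R> \<Longrightarrow> is_subring R) \<Longrightarrow> is_subring (\<Inter>\<R>)"
  unfolding is_subring_def by blast

lemma gen_field_superset: "S \<subseteq> gen_field S"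
  unfolding gen_field_def by blast

lemma gen_field_least: "is_subfield E \<Longrightarrow> S \<subseteq> E \<Longrightarrow> gen_field S \<subseteq> E"
  unfolding gen_field_def by blast

lemma gen_field_subfield: "is_subfield (gen_field S)"
proof (rule subfieldI)
  show "is_subring (gen_field S)"
    unfolding gen_field_def by (rule subring_Inter) (auto intro: subfield_subring)
  show "inverse x \<in> gen_field S" if "x \<in> gen_field S" for x
    using that unfolding gen_field_def by (auto intro: sf_inverse)
qed

lemma gen_field_mono: "S \<subseteq> T \<Longrightarrow> gen_field S \<subseteq> gen_field T"
  by (meson gen_field_least gen_field_subfield gen_field_superset order_trans)

lemma gen_field_self: "is_subfield E \<Longrightarrow> gen_field E = E"
  using gen_field_least[of E E] gen_field_superset[of E] by blast

lemma gen_field_eqI: "S \<subseteq> gen_field T \<Longrightarrow> T \<subseteq> gen_field S \<Longrightarrow> gen_field S = gen_field T"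
  by (meson gen_field_least gen_field_subfield subset_antisym)

lemma gen_field_Un_gen_field: "gen_field (gen_field A \<union> B) = gen_field (A \<union> B)"
proof (rule gen_field_eqI)
  show "gen_field A \<union> B \<subseteq> gen_field (A \<union> B)"
    using gen_field_mono[of A "A \<union> B"] gen_field_superset[of "A \<union> B"] by auto
  show "A \<union> B \<subseteq> gen_field (gen_field A \<union> B)"
    using gen_field_superset[of A] gen_field_superset[of "gen_field A \<union> B"] by auto
qed

lemma gen_field_insert_gen: "gen_field (gen_field A \<union> {b}) = gen_field (insert b A)"
  using gen_field_Un_gen_field[of A "{b}"] by simp

lemma gen_field_adjoin: "gen_field (gen_field (K \<union> A) \<union> {b}) = gen_field (K \<union> insert b A)"
  using gen_field_insert_gen[of "K \<union> A" b] by simp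

section \<open>Fields of fractions of subrings\<close>

definition fractions :: "'a::field set \<Rightarrow> 'a set" where
  "fractions R = {a / b | a b. a \<in> R \<and> b \<in> R \<and> b \<noteq> 0}"

lemma fractionsI: "a \<in> R \<Longrightarrow> b \<in> R \<Longrightarrow> b \<noteq> 0 \<Longrightarrow> a / b \<in> fractions R"
  unfolding fractions_def by blast

lemma fractions_subfield:
  assumes R: "is_subring R"
  shows "is_subfield (fractions R)"
proof (rule subfieldI)
  have "1 \<in> fractions R"
    using fractionsI[of 1 R 1] sr_1[OF R] by simp
  moreover have "x + y \<in> fractions R \<and> x * y \<in> fractions R"
    if "x \<in> fractions R" "y \<in> fractions R" for x y
  proof -
    from that obtain a b c d where ab: "a \<in> R" "b \<in> R" "b \<noteq> 0" "x = a / b"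
      and cd: "c \<in> R" "d \<in> R" "d \<noteq> 0" "y = c / d"
      unfolding fractions_def by blast
    have "x + y = (a * d + c * b) / (b * d)" "x * y = (a * c) / (b * d)"
      using ab cd by (simp_all add: field_simps)
    then show ?thesis
      using ab cd R by (auto intro!: fractionsI sr_add sr_mult)
  qed
  moreover have "- x \<in> fractions R" if x: "x \<in> fractions R" for x
  proof -
    from x obtain a b where ab: "a \<in> R" "b \<in> R" "b \<noteq> 0" "x = a / b"
      unfolding fractions_def by blast
    then have "- x = (- a) / b" by simp
    then show ?thesis using ab R by (metis fractionsI sr_uminus)
  qed
  ultimately show "is_subring (fractions R)"
    unfolding is_subring_def by blast
  show "inverse x \<in> fractions R" if x: "x \<in> fractions R" "x \<noteq> 0" for x
  proof -
    from x obtain a b where ab: "a \<in> R" "b \<in> R" "b \<noteq> 0" "x = a / b" "a \<noteq> 0"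
      unfolding fractions_def by auto
    then have "inverse x = b / a" by simp
    then show ?thesis using ab by (metis fractionsI)
  qed
qed

text \<open>Gives elements of a generated field a normal form. It is applied with R the values of
  polynomials in one element and with R the polynomials in a finite set.\<close>

lemma gen_field_fractions:
  assumes R: "is_subring R" and "S \<subseteq> R" "R \<subseteq> gen_field S"
  shows "gen_field S = fractions R"
proof
  show "gen_field S \<subseteq> fractions R"
  proof (rule gen_field_least[OF fractions_subfield[OF R]])
    show "S \<subseteq> fractions R"
      using assms fractionsI[of _ R 1] sr_1[OF R] by fastforce
  qed
  show "fractions R \<subseteq> gen_field S"
    using assms(3) sf_divide[OF gen_field_subfield] unfolding fractions_def by blast
qed

section \<open>Polynomials with coefficients in a subring\<close>

definition poly_over :: "'a::field set \<Rightarrow> 'a poly \<Rightarrow> bool" where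
  "poly_over E p \<longleftrightarrow> (\<forall>i. coeff p i \<in> E)"

lemma algebraic_over_iff: "algebraic_over E z \<longleftrightarrow> (\<exists>p. p \<noteq> 0 \<and> poly_over E p \<and> poly p z = 0)"
  unfolding algebraic_over_def poly_over_def by simp

lemma poly_over_0: "is_subring R \<Longrightarrow> poly_over R 0"
  and poly_over_add: "is_subring R \<Longrightarrow> poly_over R p \<Longrightarrow> poly_over R q \<Longrightarrow> poly_over R (p + q)"
  and poly_over_diff: "is_subring R \<Longrightarrow> poly_over R p \<Longrightarrow> poly_over R q \<Longrightarrow> poly_over R (p - q)"
  and poly_over_uminus: "is_subring R \<Longrightarrow> poly_over R p \<Longrightarrow> poly_over R (- p)"
  and poly_over_monom: "is_subring R \<Longrightarrow> c \<in> R \<Longrightarrow> poly_over R (monom c n)"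
  by (auto simp: poly_over_def intro: sr_0 sr_add sr_diff sr_uminus sr_mult)

lemma poly_over_mult: "is_subring R \<Longrightarrow> poly_over R p \<Longrightarrow> poly_over R q \<Longrightarrow> poly_over R (p * q)"
  by (auto simp: poly_over_def coeff_mult intro!: sr_sum sr_mult)

lemma poly_over_pCons: "is_subring R \<Longrightarrow> poly_over R (pCons c p) \<longleftrightarrow> c \<in> R \<and> poly_over R p"
  by (force simp: poly_over_def coeff_pCons split: nat.splits)

lemma poly_over_mono: "R \<subseteq> R' \<Longrightarrow> poly_over R p \<Longrightarrow> poly_over R' p"
  unfolding poly_over_def by blast

lemma poly_in_subring:
  assumes "is_subring R" "poly_over R p" "z \<in> R"
  shows "poly p z \<in> R"
  using assms unfolding poly_altdef poly_over_def
  by (auto intro!: sr_sum sr_mult sr_power)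

lemma algebraic_over_mono: "E \<subseteq> E' \<Longrightarrow> algebraic_over E z \<Longrightarrow> algebraic_over E' z"
  unfolding algebraic_over_def by blast

lemma algebraic_over_base:
  assumes "is_subfield E" "z \<in> E"
  shows "algebraic_over E z"
  unfolding algebraic_over_iff
  using assms
  by (intro exI[of _ "[:- z, 1:]"])
    (simp add: poly_over_pCons subfield_subring poly_over_0 sf_uminus sf_1)

lemma poly_values_subring:
  assumes E: "is_subring E"
  shows "is_subring {poly f b | f. poly_over E f}" (is "is_subring ?R")
  unfolding is_subring_def
proof (intro conjI ballI)
  show "1 \<in> ?R"
    using E by (auto intro!: exI[of _ "[:1:]"] simp: poly_over_pCons poly_over_0 sr_1)
  fix x assume x: "x \<in> ?R"
  then obtain f where f: "poly_over E f" "x = poly f b" by blast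
  then show "- x \<in> ?R"
    using poly_over_uminus[OF E] by (auto intro!: exI[of _ "- f"])
  fix y assume "y \<in> ?R"
  then obtain g where "poly_over E g" "y = poly g b" by blast
  then have "x + y = poly (f + g) b" "x * y = poly (f * g) b" "poly_over E (f + g)" "poly_over E (f * g)"
    using f poly_over_add[OF E] poly_over_mult[OF E] by auto
  then show "x + y \<in> ?R" "x * y \<in> ?R" by blast+
qed

lemma gen_field_simple:
  assumes E: "is_subfield E"
  shows "gen_field (E \<union> {b}) = fractions {poly f b | f. poly_over E f}"
proof (rule gen_field_fractions)
  let ?R = "{poly f b | f. poly_over E f}"
  note sr = subfield_subring[OF E]
  show "is_subring ?R" by (rule poly_values_subring[OF sr])
  show "E \<union> {b} \<subseteq> ?R"
  proof
    fix x assume "x \<in> E \<union> {b}"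
    then consider "x \<in> E" | "x = b" by blast
    then show "x \<in> ?R"
    proof cases
      case 1
      then show ?thesis
        using sr by (auto intro!: exI[of _ "[:x:]"] simp: poly_over_pCons poly_over_0)
    next
      case 2
      then show ?thesis
        using sr by (auto intro!: exI[of _ "[:0,1:]"] simp: poly_over_pCons poly_over_0 sr_0 sr_1)
    qed
  qed
  show "?R \<subseteq> gen_field (E \<union> {b})"
  proof clarify
    fix f assume "poly_over E f"
    then show "poly f b \<in> gen_field (E \<union> {b})"
      using gen_field_superset[of "E \<union> {b}"] poly_over_mono[of E "gen_field (E \<union> {b})"]
      by (intro poly_in_subring subfield_subring gen_field_subfield) auto
  qed
qed

section \<open>Linear algebra over a subfield\<close>

text \<open>Elimination without division, so that the same statement serves coefficients in a
  subfield and, in \<open>ratrank_basis\<close>, integer coefficients.\<close>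

lemma homogeneous_system:
  fixes c :: "'i \<Rightarrow> 'j \<Rightarrow> 'r::idom"
  assumes R: "0 \<in> R" "1 \<in> R" "\<And>x y. x \<in> R \<Longrightarrow> y \<in> R \<Longrightarrow> x - y \<in> R" "\<And>x y. x \<in> R \<Longrightarrow> y \<in> R \<Longrightarrow> x * y \<in> R"
    and J: "finite J" and I: "finite I" "card J < card I"
    and c: "\<And>i j. i \<in> I \<Longrightarrow> j \<in> J \<Longrightarrow> c i j \<in> R"
  shows "\<exists>d. (\<forall>i\<in>I. d i \<in> R) \<and> (\<exists>i\<in>I. d i \<noteq> 0) \<and> (\<forall>j\<in>J. (\<Sum>i\<in>I. d i * c i j) = 0)"
  using J I c
proof (induction J arbitrary: I c rule: finite_induct)
  case empty
  have "I \<noteq> {}" using empty(2) by auto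
  then show ?case
    using R(2) by (intro exI[of _ "\<lambda>_. 1"]) auto
next
  case (insert j J)
  show ?case
  proof (cases "\<forall>i\<in>I. c i j = 0")
    case True
    obtain d where "(\<forall>i\<in>I. d i \<in> R)" "(\<exists>i\<in>I. d i \<noteq> 0)" "(\<forall>j\<in>J. (\<Sum>i\<in>I. d i * c i j) = 0)"
      using insert.IH[of I c] insert.prems insert.hyps by (metis Suc_lessD card_insert_disjoint insertCI)
    then show ?thesis
      using True by (intro exI[of _ d]) auto
  next
    case False
    then obtain k where k: "k \<in> I" "c k j \<noteq> 0" by blast
    define I' where "I' = I - {k}"
    have I: "finite I'" "I = insert k I'" "k \<notin> I'"
      using k insert.prems by (auto simp: I'_def)
    \<comment> \<open>Cross-multiplication with the pivot \<open>c k j\<close>: the entries in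
      column j would all become zero, so that equation can be set aside.\<close>
    define c' where "c' = (\<lambda>i l. c k j * c i l - c i j * c k l)"
    have "card J < card I'"
      using insert.prems(2) insert.hyps I by simp
    moreover have "c' i l \<in> R" if "i \<in> I'" "l \<in> J" for i l
      unfolding c'_def using that insert.prems(3) I k by (intro R(3,4)) auto
    ultimately obtain d where d: "\<forall>i\<in>I'. d i \<in> R" "\<exists>i\<in>I'. d i \<noteq> 0"
      "\<forall>l\<in>J. (\<Sum>i\<in>I'. d i * c' i l) = 0"
      using insert.IH[of I' c'] I by blast
    \<comment> \<open>The coefficient at the pivot index is chosen to satisfy equation j; the others
      are scaled by the nonzero pivot, so a nonzero one survives.\<close>
    define e where "e = (\<lambda>i. if i = k then - (\<Sum>i\<in>I'. d i * c i j) else c k j * d i)"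
    have sumR: "sum f A \<in> R" if "\<And>i. i \<in> A \<Longrightarrow> f i \<in> R" for f :: "'i \<Rightarrow> 'r" and A
      using that
    proof (induction A rule: infinite_finite_induct)
      case (insert x A)
      have "sum f A \<in> R" "f x \<in> R" using insert by auto
      then have "f x - (0 - sum f A) \<in> R" by (intro R(1,3))
      then show ?case using insert by simp
    qed (use R(1) in auto)
    have "e i \<in> R" if "i \<in> I" for i
    proof -
      have "(\<Sum>i\<in>I'. d i * c i j) \<in> R"
        using insert.prems(3) I d by (intro sumR R(4)) auto
      then have "0 - (\<Sum>i\<in>I'. d i * c i j) \<in> R" by (intro R(1,3))
      moreover have "c k j * d i \<in> R" if "i \<in> I'" using that d k insert.prems(3) by (intro R(4)) auto
      ultimately show ?thesis using that I by (auto simp: e_def)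
    qed
    moreover have "\<exists>i\<in>I. e i \<noteq> 0"
    proof -
      obtain i where "i \<in> I'" "d i \<noteq> 0" using d by blast
      then show ?thesis using k I by (intro bexI[of _ i]) (auto simp: e_def)
    qed
    moreover have "(\<Sum>i\<in>I. e i * c i l) = 0" if "l \<in> insert j J" for l
    proof -
      have "(\<Sum>i\<in>I. e i * c i l) = e k * c k l + (\<Sum>i\<in>I'. e i * c i l)"
        using I by simp
      also have "(\<Sum>i\<in>I'. e i * c i l) = (\<Sum>i\<in>I'. c k j * d i * c i l)"
        using I by (intro sum.cong) (auto simp: e_def)
      also have "e k * c k l = - (\<Sum>i\<in>I'. d i * c i j * c k l)"
        by (simp add: e_def sum_distrib_right)
      finally have eq: "(\<Sum>i\<in>I. e i * c i l) = (\<Sum>i\<in>I'. d i * c' i l)"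
        by (simp add: c'_def sum_subtractf[symmetric] algebra_simps)
      show ?thesis
      proof (cases "l = j")
        case True
        then show ?thesis using eq by (simp add: c'_def mult.commute)
      next
        case False
        then show ?thesis using eq d that by simp
      qed
    qed
    ultimately show ?thesis by blast
  qed
qed

text \<open>The inductive form covers infinite B and spares choosing coefficients in closure
  arguments; \<open>lspan_finite\<close> recovers coefficients when B is finite.\<close>

inductive_set lspan :: "'a::field set \<Rightarrow> 'a set \<Rightarrow> 'a set" for E B where
  zero: "0 \<in> lspan E B"
| step: "c \<in> E \<Longrightarrow> b \<in> B \<Longrightarrow> x \<in> lspan E B \<Longrightarrow> c * b + x \<in> lspan E B"

lemma lspan_add: "x \<in> lspan E B \<Longrightarrow> y \<in> lspan E B \<Longrightarrow> x + y \<in> lspan E B"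
  by (induction rule: lspan.induct) (auto simp: add.assoc intro: lspan.intros)

lemma lspan_sum: "(\<And>i. i \<in> I \<Longrightarrow> f i \<in> lspan E B) \<Longrightarrow> sum f I \<in> lspan E B"
  by (induction I rule: infinite_finite_induct) (auto intro: lspan.zero lspan_add)

lemma lspan_scaled: "c \<in> E \<Longrightarrow> b \<in> B \<Longrightarrow> c * b \<in> lspan E B"
  using lspan.step[OF _ _ lspan.zero, of c E b B] by simp

lemma lspan_base: "is_subring E \<Longrightarrow> b \<in> B \<Longrightarrow> b \<in> lspan E B"
  using lspan_scaled[of 1 E b B] sr_1[of E] by simp

lemma lspan_scale:
  assumes "is_subring E" "c \<in> E" "x \<in> lspan E B"
  shows "c * x \<in> lspan E B"
  using assms(3)
proof induction
  case (step d b x)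
  then have "(c * d) * b + c * x \<in> lspan E B"
    using assms sr_mult[OF assms(1)] by (intro lspan.step) auto
  then show ?case by (simp add: algebra_simps)
qed (auto intro: lspan.zero)

lemma lspan_mono: "E \<subseteq> E' \<Longrightarrow> B \<subseteq> B' \<Longrightarrow> lspan E B \<subseteq> lspan E' B'"
proof
  fix x assume *: "E \<subseteq> E'" "B \<subseteq> B'" "x \<in> lspan E B"
  from *(3,1,2) show "x \<in> lspan E' B'"
    by (induction rule: lspan.induct) (auto intro: lspan.intros)
qed

lemma lspan_least: 
  assumes "\<And>x y. x \<in> V \<Longrightarrow> y \<in> V \<Longrightarrow> x + y \<in> V" "0 \<in> V" "\<And>c b. c \<in> E \<Longrightarrow> b \<in> B \<Longrightarrow> c * b \<in> V"
  shows "lspan E B \<subseteq> V"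
proof
  fix x assume "x \<in> lspan E B"
  then show "x \<in> V" by induction (auto intro: assms)
qed

lemma lspan_trans:
  assumes "is_subring E" "B \<subseteq> lspan E B'" shows "lspan E B \<subseteq> lspan E B'"
  using assms by (intro lspan_least) (auto intro: lspan_add lspan.zero lspan_scale)

lemma lspan_subset: "is_subring R \<Longrightarrow> E \<subseteq> R \<Longrightarrow> B \<subseteq> R \<Longrightarrow> lspan E B \<subseteq> R"
  by (intro lspan_least) (auto intro: sr_add sr_0 sr_mult)

lemma lspan_finite:
  assumes "finite B" "is_subring E"
  shows "x \<in> lspan E B \<longleftrightarrow> (\<exists>c. (\<forall>b\<in>B. c b \<in> E) \<and> x = (\<Sum>b\<in>B. c b * b))"
proof
  assume "x \<in> lspan E B"
  then show "\<exists>c. (\<forall>b\<in>B. c b \<in> E) \<and> x = (\<Sum>b\<in>B. c b * b)"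
  proof induction
    case zero
    then show ?case using assms sr_0 by (intro exI[of _ "\<lambda>_. 0"]) auto
  next
    case (step d b x)
    then obtain c where c: "\<forall>b\<in>B. c b \<in> E" "x = (\<Sum>b\<in>B. c b * b)" by blast
    have "(\<Sum>b'\<in>B. (c(b := c b + d)) b' * b') = (\<Sum>b'\<in>B. c b' * b' + (if b' = b then d * b else 0))"
      by (intro sum.cong) (auto simp: algebra_simps)
    also have "\<dots> = d * b + x"
      using step assms c by (simp add: sum.distrib)
    finally show ?case
      using c step assms sr_add by (intro exI[of _ "c(b := c b + d)"]) auto
  qed
next
  assume "\<exists>c. (\<forall>b\<in>B. c b \<in> E) \<and> x = (\<Sum>b\<in>B. c b * b)"
  then show "x \<in> lspan E B" by (auto intro!: lspan_sum lspan_scaled)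
qed

lemma lspan_finite_subset:
  assumes "x \<in> lspan E B"
  shows "\<exists>A. finite A \<and> A \<subseteq> B \<and> x \<in> lspan E A"
  using assms
proof induction
  case zero
  then show ?case by (intro exI[of _ "{}"]) (auto intro: lspan.zero)
next
  case (step c b x)
  then obtain A where "finite A" "A \<subseteq> B" "x \<in> lspan E A" by blast
  then show ?case
    using step lspan_mono[of E E A "insert b A"]
    by (intro exI[of _ "insert b A"]) (auto intro!: lspan.step)
qed

lemma lspan_mult:
  assumes "is_subring E" "\<And>b b'. b \<in> B \<Longrightarrow> b' \<in> B \<Longrightarrow> b * b' \<in> lspan E B"
    and x: "x \<in> lspan E B" and y: "y \<in> lspan E B"
  shows "x * y \<in> lspan E B"
proof -
  have *: "b * y \<in> lspan E B" if "b \<in> B" for b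
    using y
  proof induction
    case (step c b' y)
    then have "c * (b * b') + b * y \<in> lspan E B"
      using lspan_add lspan_scale[OF assms(1)] assms(2) that by metis
    then show ?case by (simp add: algebra_simps)
  qed (auto intro: lspan.zero)
  show ?thesis using x
  proof induction
    case (step c b x)
    then have "c * (b * y) + x * y \<in> lspan E B"
      using lspan_add lspan_scale[OF assms(1)] * by metis
    then show ?case by (simp add: algebra_simps)
  qed (auto intro: lspan.zero)
qed

lemma lspan_subring:
  assumes E: "is_subring E" and "1 \<in> lspan E B" "\<And>b b'. b \<in> B \<Longrightarrow> b' \<in> B \<Longrightarrow> b * b' \<in> lspan E B"
  shows "is_subring (lspan E B)"
  unfolding is_subring_def
  using assms lspan_scale[OF E sr_uminus[OF E sr_1[OF E]]] by (auto intro: lspan_add lspan_mult)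

lemma lspan_contains_scalars: "is_subring E \<Longrightarrow> 1 \<in> lspan E B \<Longrightarrow> E \<subseteq> lspan E B"
  using lspan_scale[of E _ 1 B] by auto

text \<open>Indexed by I rather than stated for a set of vectors, so that coinciding vectors count
  separately. The powers of a root of unity need this in \<open>algebraic_if_finite\<close>.\<close>

lemma lin_dep_family:
  assumes E: "is_subring E" and fin: "finite B" "finite I" "card B < card I"
    and w: "\<And>i. i \<in> I \<Longrightarrow> w i \<in> lspan E B"
  shows "\<exists>d. (\<forall>i\<in>I. d i \<in> E) \<and> (\<exists>i\<in>I. d i \<noteq> 0) \<and> (\<Sum>i\<in>I. d i * w i) = 0"
proof -
  have "\<forall>i\<in>I. \<exists>c. (\<forall>b\<in>B. c b \<in> E) \<and> w i = (\<Sum>b\<in>B. c b * b)"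
    using w lspan_finite[OF fin(1) E] by blast
  then obtain c where c: "\<And>i b. i \<in> I \<Longrightarrow> b \<in> B \<Longrightarrow> c i b \<in> E"
      "\<And>i. i \<in> I \<Longrightarrow> w i = (\<Sum>b\<in>B. c i b * b)"
    by metis
  obtain d where d: "\<forall>i\<in>I. d i \<in> E" "\<exists>i\<in>I. d i \<noteq> 0" "\<forall>b\<in>B. (\<Sum>i\<in>I. d i * c i b) = 0"
    using homogeneous_system[of E B I c] fin c E by (auto intro: sr_0 sr_1 sr_diff sr_mult)
  have "(\<Sum>i\<in>I. d i * w i) = (\<Sum>i\<in>I. \<Sum>b\<in>B. d i * c i b * b)"
    using c by (simp add: sum_distrib_left mult.assoc)
  also have "\<dots> = (\<Sum>b\<in>B. (\<Sum>i\<in>I. d i * c i b) * b)"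
    by (subst sum.swap) (simp add: sum_distrib_right)
  also have "\<dots> = 0" using d by simp
  finally show ?thesis using d by blast
qed

lemma lin_indep_card_le:
  assumes "is_subring E" "finite B" "finite A" "A \<subseteq> lspan E B" "lin_indep_over E A"
  shows "card A \<le> card B"
proof (rule ccontr)
  assume "\<not> ?thesis"
  then obtain d where "\<forall>i\<in>A. d i \<in> E" "\<exists>i\<in>A. d i \<noteq> 0" "(\<Sum>i\<in>A. d i * i) = 0"
    using lin_dep_family[of E B A "\<lambda>i. i"] assms by auto
  then show False using assms(5) unfolding lin_indep_over_def by blast
qed

lemma lin_indep_insert:
  assumes E: "is_subfield E" and A: "finite A" "lin_indep_over E A" and x: "x \<notin> lspan E A"
  shows "lin_indep_over E (insert x A)"
  unfolding lin_indep_over_def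
proof (intro allI impI, elim conjE)
  fix c assume c: "\<forall>a\<in>insert x A. c a \<in> E" "(\<Sum>a\<in>insert x A. c a * a) = 0"
  have sr: "is_subring E" using E subfield_subring by blast
  have xA: "x \<notin> A" using x lspan_base[OF sr] by blast
  then have eq: "c x * x + (\<Sum>a\<in>A. c a * a) = 0" using c A by simp
  have "c x = 0"
  proof (rule ccontr)
    assume "c x \<noteq> 0"
    then have "x = (- inverse (c x)) * (\<Sum>a\<in>A. c a * a)"
      using eq by (metis add_eq_0_iff divide_inverse mult.commute minus_mult_left minus_mult_right minus_minus nonzero_mult_div_cancel_left)
    moreover have "(\<Sum>a\<in>A. c a * a) \<in> lspan E A"
      using c by (auto intro!: lspan_sum lspan_scaled)
    ultimately show False
      using x c lspan_scale[OF sr] sf_inverse[OF E] sf_uminus[OF E] by (metis insertI1)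
  qed
  then show "\<forall>a\<in>insert x A. c a = 0"
    using eq A c unfolding lin_indep_over_def by simp
qed

text \<open>Every independent subset of L has at most \<open>card B\<close> elements, so adjoining
  elements of L outside the current span must stop.\<close>

lemma lin_indep_extend:
  assumes E: "is_subfield E" and B: "finite B" and A: "finite A" "A \<subseteq> L" "lin_indep_over E A"
    and L: "L \<subseteq> lspan E B"
  shows "\<exists>A'. finite A' \<and> A \<subseteq> A' \<and> A' \<subseteq> L \<and> lin_indep_over E A' \<and> L \<subseteq> lspan E A'"
  using A
proof (induction "card B - card A" arbitrary: A rule: less_induct)
  case less
  show ?case
  proof (cases "L \<subseteq> lspan E A")
    case True
    then show ?thesis using less.prems by blast
  next
    case False
    then obtain x where x: "x \<in> L" "x \<notin> lspan E A" by blast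
    have ind: "lin_indep_over E (insert x A)"
      using lin_indep_insert[OF E] less.prems x by blast
    have xA: "x \<notin> A" using x lspan_base[OF subfield_subring[OF E]] by blast
    have "card (insert x A) \<le> card B"
      using lin_indep_card_le[OF subfield_subring[OF E] B _ _ ind] less.prems x L by blast
    then have "card B - card (insert x A) < card B - card A"
      using less.prems xA by simp
    then show ?thesis
      using less.hyps[of "insert x A"] less.prems x ind by auto
  qed
qed

section \<open>Algebraic extensions\<close>

definition sum_poly :: "(nat \<Rightarrow> 'a::comm_ring_1) \<Rightarrow> nat \<Rightarrow> 'a poly" where
  "sum_poly d n = (\<Sum>i<n. monom (d i) i)"

lemma coeff_sum_poly: "coeff (sum_poly d n) k = (if k < n then d k else 0)"
  by (simp add: sum_poly_def coeff_sum coeff_monom)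

lemma poly_sum_poly: "poly (sum_poly d n) z = (\<Sum>i<n. d i * z ^ i)"
  by (simp add: sum_poly_def poly_sum poly_monom)

lemma poly_over_sum_poly: "is_subring R \<Longrightarrow> (\<And>i. i < n \<Longrightarrow> d i \<in> R) \<Longrightarrow> poly_over R (sum_poly d n)"
  by (auto simp: poly_over_def coeff_sum_poly intro: sr_0)

lemma algebraic_if_finite:
  assumes E: "is_subfield E" and B: "finite B" and z: "\<And>n. z ^ n \<in> lspan E B"
  shows "algebraic_over E z"
proof -
  let ?n = "Suc (card B)"
  obtain d where d: "\<forall>i\<in>{..<?n}. d i \<in> E" "\<exists>i\<in>{..<?n}. d i \<noteq> 0" "(\<Sum>i<?n. d i * z ^ i) = 0"
    using lin_dep_family[of E B "{..<?n}" "\<lambda>i. z ^ i"] z B subfield_subring[OF E] by auto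
  show ?thesis
    unfolding algebraic_over_iff
  proof (intro exI conjI)
    obtain i where "i < ?n" "d i \<noteq> 0" using d by auto
    then have "coeff (sum_poly d ?n) i \<noteq> 0" by (simp add: coeff_sum_poly)
    then show "sum_poly d ?n \<noteq> 0" by auto
    show "poly_over E (sum_poly d ?n)"
      using d subfield_subring[OF E] by (intro poly_over_sum_poly) auto
    show "poly (sum_poly d ?n) z = 0" using d by (simp only: poly_sum_poly)
  qed
qed

text \<open>Factors X are cancelled from p; since a is nonzero, it stays a root.\<close>

lemma algebraic_poly_nonzero_const:
  assumes E: "is_subring E" and "a \<noteq> 0"
  shows "p \<noteq> 0 \<Longrightarrow> poly_over E p \<Longrightarrow> poly p a = 0 \<Longrightarrow>
    \<exists>q. poly_over E q \<and> poly q a = 0 \<and> coeff q 0 \<noteq> 0"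
proof (induction p)
  case (pCons c p)
  show ?case
  proof (cases "c = 0")
    case True
    then show ?thesis using pCons assms by (auto simp: poly_over_pCons)
  next
    case False
    then show ?thesis using pCons by (intro exI[of _ "pCons c p"]) auto
  qed
qed auto

text \<open>From c + a q'(a) = 0 with c nonzero in E, the inverse of a is -q'(a)/c, a polynomial in
  a. Hence rings algebraic over E are fields, which later turns spans into generated fields.\<close>

lemma inverse_in_subring:
  assumes E: "is_subfield E" and R: "is_subring R" "E \<subseteq> R"
    and a: "a \<in> R" "algebraic_over E a"
  shows "inverse a \<in> R"
proof (cases "a = 0")
  case False
  then obtain q where q: "poly_over E q" "poly q a = 0" "coeff q 0 \<noteq> 0"
    using a(2) algebraic_poly_nonzero_const[OF subfield_subring[OF E] False]
    unfolding algebraic_over_iff by blast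
  obtain c q' where q': "q = pCons c q'" by (cases q) auto
  have c: "c \<noteq> 0" "c \<in> E" "poly_over E q'" "c + a * poly q' a = 0"
    using q q' poly_over_pCons[OF subfield_subring[OF E]] by auto
  have "a * poly q' a = - c"
    using c(4) by (metis add_eq_0_iff)
  then have "inverse a = (- inverse c) * poly q' a"
    using c(1) False by (simp add: field_simps)
  moreover have "poly q' a \<in> R"
    using c R a poly_over_mono by (blast intro: poly_in_subring)
  moreover have "- inverse c \<in> R"
    using c sf_inverse[OF E] sr_uminus[OF R(1)] R(2) by blast
  ultimately show ?thesis using sr_mult[OF R(1)] by metis
qed (use sr_0[OF R(1)] in simp)

text \<open>The span of the powers below d is stable under multiplication by z, hence a ring; being
  finite-dimensional it is algebraic over E, hence a field.\<close>

lemma gen_field_power_basis: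
  assumes E: "is_subfield E" and d: "0 < d" and z: "z ^ d \<in> lspan E ((\<lambda>i. z ^ i) ` {..<d})"
  shows "gen_field (E \<union> {z}) = lspan E ((\<lambda>i. z ^ i) ` {..<d})"
proof -
  define V where "V = lspan E ((\<lambda>i. z ^ i) ` {..<d})"
  note sr = subfield_subring[OF E]
  have base: "z ^ i \<in> V" if "i < d" for i
    unfolding V_def using that by (intro lspan_base[OF sr]) auto
  have zV: "z * x \<in> V" if "x \<in> V" for x
    using that unfolding V_def
  proof induction
    case (step c b x)
    then obtain i where i: "i < d" "b = z ^ i" by auto
    have "z ^ Suc i \<in> V"
      using base[of "Suc i"] z i V_def by (cases "Suc i = d") auto
    then have "c * z ^ Suc i + z * x \<in> V"
      using step lspan_add lspan_scale[OF sr] unfolding V_def by blast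
    then show ?case using i by (simp add: algebra_simps V_def)
  qed (auto intro: lspan.zero)
  have pow: "z ^ n \<in> V" for n
    by (induction n) (use base[of 0] d zV in auto)
  have ring: "is_subring V"
    unfolding V_def
  proof (rule lspan_subring[OF sr])
    show "1 \<in> lspan E ((\<lambda>i. z ^ i) ` {..<d})" using pow[of 0] V_def by simp
    show "b * b' \<in> lspan E ((\<lambda>i. z ^ i) ` {..<d})"
      if "b \<in> (\<lambda>i. z ^ i) ` {..<d}" "b' \<in> (\<lambda>i. z ^ i) ` {..<d}" for b b'
      using that pow by (auto simp: V_def simp flip: power_add)
  qed
  have EV: "E \<subseteq> V"
    using lspan_contains_scalars[OF sr] sr_1[OF ring] unfolding V_def by blast
  have "inverse a \<in> V" if "a \<in> V" for a
  proof (rule inverse_in_subring[OF E ring EV that])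
    show "algebraic_over E a"
      using sr_power[OF ring that] unfolding V_def
      by (intro algebraic_if_finite[OF E, of "(\<lambda>i. z ^ i) ` {..<d}"]) auto
  qed
  then have "is_subfield V" using ring by (intro subfieldI)
  moreover have "z \<in> V" using pow[of 1] by simp
  ultimately have "gen_field (E \<union> {z}) \<subseteq> V" using EV by (intro gen_field_least) auto
  moreover have "V \<subseteq> gen_field (E \<union> {z})"
    unfolding V_def
    using gen_field_superset[of "E \<union> {z}"] sf_power[OF gen_field_subfield, of z "E \<union> {z}"]
    by (intro lspan_subset subfield_subring gen_field_subfield) auto
  ultimately show ?thesis unfolding V_def by blast
qed

lemma algebraic_power_in_lspan:
  assumes E: "is_subfield E" and p: "p \<noteq> 0" "poly_over E p" "poly p z = 0"
  shows "0 < degree p \<and> z ^ degree p \<in> lspan E ((\<lambda>i. z ^ i) ` {..<degree p})"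
proof -
  let ?n = "degree p" and ?l = "lead_coeff p"
  have l: "?l \<noteq> 0" using p by simp
  have n: "0 < ?n"
  proof (rule ccontr)
    assume "\<not> ?thesis"
    then obtain c where "p = [:c:]" by (auto elim: degree_eq_zeroE)
    then show False using p by simp
  qed
  have "poly p z = (\<Sum>i<?n. coeff p i * z ^ i) + ?l * z ^ ?n"
    by (simp add: poly_altdef lessThan_Suc_atMost[symmetric])
  then have "?l * z ^ ?n = - (\<Sum>i<?n. coeff p i * z ^ i)"
    using p(3) by (simp add: eq_neg_iff_add_eq_0 add.commute)
  then have "z ^ ?n = (- inverse ?l) * (\<Sum>i<?n. coeff p i * z ^ i)"
    using l by (simp add: field_simps)
  moreover have "(\<Sum>i<?n. coeff p i * z ^ i) \<in> lspan E ((\<lambda>i. z ^ i) ` {..<?n})"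
    using p(2) by (auto simp: poly_over_def intro!: lspan_sum lspan_scaled)
  moreover have "- inverse ?l \<in> E"
    using p(2) E by (auto simp: poly_over_def intro: sf_inverse sf_uminus)
  ultimately show ?thesis using n lspan_scale[OF subfield_subring[OF E]] by metis
qed

definition fin_ext :: "'a::field set \<Rightarrow> 'a set \<Rightarrow> bool" where
  "fin_ext E L \<longleftrightarrow> E \<subseteq> L \<and> (\<exists>B. finite B \<and> B \<subseteq> L \<and> L \<subseteq> lspan E B)"

lemma fin_ext_refl: 
  assumes "is_subfield E" shows "fin_ext E E"
  unfolding fin_ext_def
  using lspan_scaled[of _ E 1 "{1}"] sf_1[OF assms] by (intro conjI exI[of _ "{1}"]) auto

lemma fin_ext_trans:
  assumes E: "is_subfield E" and L: "is_subfield L" and M: "is_subfield M"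
    and "fin_ext E L" "fin_ext L M"
  shows "fin_ext E M"
proof -
  obtain B where B: "finite B" "B \<subseteq> L" "L \<subseteq> lspan E B" using assms unfolding fin_ext_def by blast
  obtain C where C: "finite C" "C \<subseteq> M" "M \<subseteq> lspan L C" using assms unfolding fin_ext_def by blast
  define D where "D = (\<lambda>(b, c). b * c) ` (B \<times> C)"
  note sr = subfield_subring[OF E]
  have LM: "E \<subseteq> L" "L \<subseteq> M" using assms unfolding fin_ext_def by auto
  have *: "x * c \<in> lspan E D" if "x \<in> lspan E B" "c \<in> C" for x c
    using that(1)
  proof induction
    case (step d b x)
    have "b * c \<in> D" using step that by (auto simp: D_def)
    then have "d * (b * c) + x * c \<in> lspan E D" using step by (intro lspan.step) auto
    then show ?case by (simp add: algebra_simps)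
  qed (auto intro: lspan.zero)
  have "lspan L C \<subseteq> lspan E D"
    using * B by (intro lspan_least) (auto intro: lspan_add lspan.zero)
  then show ?thesis
    unfolding fin_ext_def using B C LM
    by (intro conjI exI[of _ D]) (auto simp: D_def intro!: sf_mult[OF M])
qed

lemma fin_ext_algebraic:
  assumes E: "is_subfield E" and L: "is_subfield L" and "fin_ext E L" "z \<in> L"
  shows "algebraic_over E z"
proof -
  obtain B where B: "finite B" "L \<subseteq> lspan E B" using assms unfolding fin_ext_def by blast
  show ?thesis using B sf_power[OF L \<open>z \<in> L\<close>] by (intro algebraic_if_finite[OF E B(1)]) auto
qed

lemma fin_ext_simple:
  assumes E: "is_subfield E" and "algebraic_over E z"
  shows "fin_ext E (gen_field (E \<union> {z}))"
proof -
  obtain p where p: "p \<noteq> 0" "poly_over E p" "poly p z = 0"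
    using assms unfolding algebraic_over_iff by blast
  show ?thesis
    using gen_field_power_basis[OF E, of "degree p" z] algebraic_power_in_lspan[OF E p]
      gen_field_superset[of "E \<union> {z}"]
      lspan_base[OF subfield_subring[OF E], of _ "(\<lambda>i. z ^ i) ` {..<degree p}"]
    unfolding fin_ext_def
    by (intro conjI exI[of _ "(\<lambda>i. z ^ i) ` {..<degree p}"]) auto
qed

lemma fin_ext_gen_field:
  assumes E: "is_subfield E" and "finite S" "\<And>z. z \<in> S \<Longrightarrow> algebraic_over E z"
  shows "fin_ext E (gen_field (E \<union> S))"
  using assms(2,3)
proof (induction S rule: finite_induct)
  case empty
  then show ?case using fin_ext_refl[OF E] gen_field_self[OF E] by simp
next
  case (insert z S)
  let ?L = "gen_field (E \<union> S)"
  have "algebraic_over ?L z"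
    using insert.prems[of z] gen_field_superset[of "E \<union> S"] algebraic_over_mono[of E ?L z] by auto
  then have "fin_ext ?L (gen_field (?L \<union> {z}))" by (rule fin_ext_simple[OF gen_field_subfield])
  moreover have "fin_ext E ?L" using insert by auto
  moreover have "gen_field (?L \<union> {z}) = gen_field (E \<union> insert z S)"
    by (rule gen_field_adjoin)
  ultimately show ?case
    using fin_ext_trans[OF E gen_field_subfield gen_field_subfield] by metis
qed

lemma algebraic_gen_field:
  assumes E: "is_subfield E" and "finite S" "\<And>z. z \<in> S \<Longrightarrow> algebraic_over E z"
    and "x \<in> gen_field (E \<union> S)"
  shows "algebraic_over E x"
  using fin_ext_algebraic[OF E gen_field_subfield] fin_ext_gen_field assms by blast

lemma algebraic_elements_subfield:
  assumes E: "is_subfield E"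
  shows "is_subfield {z. algebraic_over E z}"
proof -
  have *: "f x y \<in> {z. algebraic_over E z}" if "algebraic_over E x" "algebraic_over E y"
      "f x y \<in> gen_field (E \<union> {x, y})" for f x y
    using algebraic_gen_field[OF E, of "{x, y}" "f x y"] that by auto
  have mem: "x \<in> gen_field (E \<union> {x, y})" "y \<in> gen_field (E \<union> {x, y})" for x y
    using gen_field_superset[of "E \<union> {x, y}"] by auto
  note gf = gen_field_subfield[of "E \<union> {_, _}"]
  show ?thesis
    unfolding is_subfield_def
  proof (intro conjI ballI impI)
    show "0 \<in> {z. algebraic_over E z}" "1 \<in> {z. algebraic_over E z}"
      using algebraic_over_base[OF E] sf_0[OF E] sf_1[OF E] by auto
    fix x y assume "x \<in> {z. algebraic_over E z}" "y \<in> {z. algebraic_over E z}"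
    then show "x + y \<in> {z. algebraic_over E z}" "x * y \<in> {z. algebraic_over E z}"
      using *[of x y "(+)"] *[of x y "(*)"] sf_add[OF gf mem] sf_mult[OF gf mem] by auto
  next
    fix x assume "x \<in> {z. algebraic_over E z}"
    then show "- x \<in> {z. algebraic_over E z}" "inverse x \<in> {z. algebraic_over E z}"
      using *[of x x "\<lambda>x _. - x"] *[of x x "\<lambda>x _. inverse x"] sf_uminus[OF gf mem(1), of x x]
        sf_inverse[OF gf mem(1), of x x] by auto
  qed
qed

text \<open>Only the finitely many coefficients of one annihilating polynomial matter; they generate
  a finite extension of E, over which z is finite.\<close>

lemma algebraic_over_trans:
  assumes E: "is_subfield E" and "A \<subseteq> {z. algebraic_over E z}" "algebraic_over A z"
  shows "algebraic_over E z"
proof -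
  obtain p where p: "p \<noteq> 0" "poly_over A p" "poly p z = 0"
    using assms unfolding algebraic_over_iff by blast
  define S where "S = coeff p ` {..degree p}"
  let ?L = "gen_field (E \<union> S)"
  have "S \<subseteq> A" using p by (auto simp: S_def poly_over_def)
  then have "fin_ext E ?L"
    using assms(2) by (intro fin_ext_gen_field[OF E]) (auto simp: S_def)
  moreover have "coeff p i \<in> ?L" for i
  proof (cases "i \<le> degree p")
    case True
    then show ?thesis using gen_field_superset[of "E \<union> S"] by (auto simp: S_def)
  next
    case False
    then show ?thesis using sf_0[OF gen_field_subfield] by (simp add: coeff_eq_0)
  qed
  then have "algebraic_over ?L z"
    using p unfolding algebraic_over_def by blast
  then have "fin_ext ?L (gen_field (?L \<union> {z}))" by (rule fin_ext_simple[OF gen_field_subfield])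
  ultimately have "fin_ext E (gen_field (?L \<union> {z}))"
    using fin_ext_trans[OF E gen_field_subfield gen_field_subfield] by blast
  then show ?thesis
    using fin_ext_algebraic[OF E gen_field_subfield] gen_field_superset[of "?L \<union> {z}"] by blast
qed

section \<open>Algebraic dependence\<close>

text \<open>The closure operator of algebraic dependence over K. With \<open>acl_trans\<close> and
  \<open>acl_exchange\<close> it behaves like the closure of a matroid, and all counting of
  transcendence degrees goes through it.\<close>

definition acl :: "'a::field set \<Rightarrow> 'a set \<Rightarrow> 'a set" where
  "acl K A = {z. algebraic_over (gen_field (K \<union> A)) z}"

lemma acl_subfield: "is_subfield (acl K A)"
  unfolding acl_def by (rule algebraic_elements_subfield[OF gen_field_subfield])

lemma acl_superset: "A \<subseteq> acl K A" and acl_base: "K \<subseteq> acl K A"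
  using algebraic_over_base[OF gen_field_subfield] gen_field_superset[of "K \<union> A"]
  unfolding acl_def by blast+

lemma acl_mono: "A \<subseteq> B \<Longrightarrow> acl K A \<subseteq> acl K B"
  using algebraic_over_mono[OF gen_field_mono[of "K \<union> A" "K \<union> B"]] unfolding acl_def by blast

lemma acl_trans: 
  assumes "B \<subseteq> acl K A"
  shows "acl K B \<subseteq> acl K A"
proof
  fix z assume "z \<in> acl K B"
  moreover have "gen_field (K \<union> B) \<subseteq> acl K A"
    using assms acl_base by (intro gen_field_least acl_subfield) auto
  ultimately show "z \<in> acl K A"
    unfolding acl_def using algebraic_over_trans[OF gen_field_subfield] by blast
qed

lemma clear_denominators:
  assumes R: "is_subring R" and "finite I" "\<And>i. i \<in> I \<Longrightarrow> c i \<in> fractions R"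
  shows "\<exists>D\<in>R. D \<noteq> 0 \<and> (\<forall>i\<in>I. D * c i \<in> R)"
  using assms(2,3)
proof (induction I rule: finite_induct)
  case empty
  then show ?case using sr_1[OF R] by (intro bexI[of _ 1]) auto
next
  case (insert i I)
  then obtain D where D: "D \<in> R" "D \<noteq> 0" "\<forall>i\<in>I. D * c i \<in> R" by auto
  obtain a b where ab: "a \<in> R" "b \<in> R" "b \<noteq> 0" "c i = a / b"
    using insert.prems[of i] unfolding fractions_def by auto
  have "(D * b) * c i = D * a" using ab by simp
  moreover have "(D * b) * c k \<in> R" if "k \<in> I" for k
    using that D ab sr_mult[OF R, of b "D * c k"] by (simp add: mult_ac)
  ultimately show ?case
    using D ab sr_mult[OF R] by (intro bexI[of _ "D * b"]) auto
qed

lemma clear_denominators_poly: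
  assumes R: "is_subring R" and p: "p \<noteq> 0" "poly_over (fractions R) p" "poly p z = 0"
  shows "\<exists>q. q \<noteq> 0 \<and> poly_over R q \<and> poly q z = 0"
proof -
  obtain D where D: "D \<in> R" "D \<noteq> 0" "\<forall>i\<in>{..degree p}. D * coeff p i \<in> R"
    using clear_denominators[OF R, of "{..degree p}" "coeff p"] p unfolding poly_over_def by auto
  have "D * coeff p i \<in> R" for i
    using D sr_0[OF R] by (cases "i \<le> degree p") (auto simp: coeff_eq_0)
  then show ?thesis
    using p D by (intro exI[of _ "smult D p"]) (auto simp: poly_over_def)
qed

text \<open>A polynomial relation between a and b, cleared of denominators, can be read as a
  polynomial in a or as one in b. Only the nonvanishing in the second reading needs the
  transcendence of a.\<close>

lemma algebraic_exchange:
  assumes E: "is_subfield E" and ab: "algebraic_over (gen_field (E \<union> {b})) a"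
    and a: "\<not> algebraic_over E a"
  shows "algebraic_over (gen_field (E \<union> {a})) b"
proof -
  let ?R = "{poly f b | f. poly_over E f}" and ?L = "gen_field (E \<union> {a})"
  have R: "is_subring ?R" by (rule poly_values_subring[OF subfield_subring[OF E]])
  obtain p where p: "p \<noteq> 0" "poly_over (fractions ?R) p" "poly p a = 0"
    using ab unfolding algebraic_over_iff gen_field_simple[OF E] by blast
  obtain q where q: "q \<noteq> 0" "poly_over ?R q" "poly q a = 0"
    using clear_denominators_poly[OF R p] by blast
  have "\<forall>k. \<exists>f. coeff q k = poly f b \<and> poly_over E f" using q(2) unfolding poly_over_def by blast
  then obtain f where f: "\<And>k. coeff q k = poly (f k) b" "\<And>k. poly_over E (f k)" by metis
  let ?n = "degree q"
  \<comment> \<open>The relation \<open>q\<close> rearranged by powers of b, with coefficients in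
    E(a).\<close>
  define h where "h = (\<Sum>k\<le>?n. smult (a ^ k) (f k))"
  have "poly h b = poly q a"
    by (simp add: h_def poly_sum poly_altdef[of q] f mult.commute)
  moreover have "coeff h i \<in> ?L" for i
  proof -
    have "a \<in> ?L" "E \<subseteq> ?L" using gen_field_superset[of "E \<union> {a}"] by auto
    then show ?thesis
      using f(2) unfolding h_def coeff_sum coeff_smult poly_over_def
      by (intro sf_sum sf_mult sf_power gen_field_subfield) auto
  qed
  moreover have "h \<noteq> 0"
  proof -
    have "poly (f ?n) b \<noteq> 0" using q(1) f(1)[of ?n] by (metis leading_coeff_0_iff)
    then have "f ?n \<noteq> 0" by auto
    \<comment> \<open>The coefficient of b^i in the rearranged relation is a polynomial in a over E
      whose top coefficient \<open>coeff (f ?n) i\<close> is nonzero; a is transcendental, so it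
      does not vanish.\<close>
    then obtain i where i: "coeff (f ?n) i \<noteq> 0" by (metis leading_coeff_0_iff)
    let ?g = "sum_poly (\<lambda>k. coeff (f k) i) (Suc ?n)"
    have "coeff h i = poly ?g a"
      by (simp add: h_def coeff_sum poly_sum_poly lessThan_Suc_atMost mult.commute)
    moreover have "poly_over E ?g"
      using f(2) by (intro poly_over_sum_poly subfield_subring[OF E]) (auto simp: poly_over_def)
    moreover have "coeff ?g ?n \<noteq> 0" using i by (simp add: coeff_sum_poly)
    then have "?g \<noteq> 0" by auto
    ultimately have "coeff h i \<noteq> 0" using a unfolding algebraic_over_iff by metis
    then show ?thesis by auto
  qed
  ultimately show ?thesis
    using q(3) unfolding algebraic_over_def by auto
qed

lemma acl_exchange:
  assumes "x \<in> acl K (insert b A)" "x \<notin> acl K A"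
  shows "b \<in> acl K (insert x A)"
proof -
  let ?E = "gen_field (K \<union> A)"
  have "algebraic_over (gen_field (?E \<union> {x})) b"
  proof (rule algebraic_exchange[OF gen_field_subfield])
    show "algebraic_over (gen_field (?E \<union> {b})) x" "\<not> algebraic_over ?E x"
      using assms unfolding acl_def gen_field_adjoin by auto
  qed
  then show ?thesis
    unfolding acl_def gen_field_adjoin by blast
qed

text \<open>Steinitz exchange. A generator outside I is either dropped or replaced by an element of
  I; both decrease \<open>card (G - I)\<close>.\<close>

lemma acl_indep_card_le:
  assumes "finite I" "finite G" and ind: "\<And>x. x \<in> I \<Longrightarrow> x \<notin> acl K (I - {x})" and "I \<subseteq> acl K G"
  shows "card I \<le> card G"
  using assms(2,4)
proof (induction "card (G - I)" arbitrary: G rule: less_induct)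
  case less
  show ?case
  proof (cases "G \<subseteq> I")
    case True
    have "I \<subseteq> G"
    proof
      fix x assume x: "x \<in> I"
      show "x \<in> G"
      proof (rule ccontr)
        assume "x \<notin> G"
        then have "acl K G \<subseteq> acl K (I - {x})" using True by (intro acl_mono) auto
        then show False using ind x less.prems by blast
      qed
    qed
    then show ?thesis using True by simp
  next
    case False
    then obtain b where b: "b \<in> G" "b \<notin> I" by blast
    let ?G' = "G - {b}"
    have lt: "card (?G' - I) < card (G - I)"
      using b less.prems by (intro psubset_card_mono) auto
    show ?thesis
    proof (cases "I \<subseteq> acl K ?G'")
      case True
      then have "card I \<le> card ?G'" using less.hyps[of ?G'] lt less.prems by simp
      then show ?thesis using less.prems b by (meson card_Diff1_le le_trans)
    next
      case False
      then obtain x where x: "x \<in> I" "x \<notin> acl K ?G'" by blast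
      let ?H = "insert x ?G'"
      have "x \<in> acl K (insert b ?G')" using x less.prems b by (simp add: insert_absorb) blast
      then have "b \<in> acl K ?H" using acl_exchange x by blast
      then have "G \<subseteq> acl K ?H" using acl_superset[of ?H K] by blast
      then have "I \<subseteq> acl K ?H" using acl_trans less.prems by blast
      moreover have "?H - I = ?G' - I" using x by blast
      ultimately have "card I \<le> card ?H" using less.hyps[of ?H] lt less.prems by auto
      also have "card ?H \<le> card G"
        using less.prems b card_insert_le_m1[of "card G" ?G' x] by (simp add: card_gt_0_iff) blast
      finally show ?thesis .
    qed
  qed
qed

section \<open>Polynomial relations and algebraic independence\<close>

lemma alg_indep_subset: "alg_indep K T \<Longrightarrow> S \<subseteq> T \<Longrightarrow> alg_indep K S"
  unfolding alg_indep_def by (meson subset_trans)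

definition mon :: "'a::field set \<Rightarrow> ('a \<Rightarrow> nat) \<Rightarrow> 'a" where
  "mon S m = (\<Prod>t\<in>S. t ^ m t)"

text \<open>The support condition makes an exponent function determined by its restriction to S, so
  that each formal monomial in S has exactly one representative.\<close>

definition exps :: "'a set \<Rightarrow> ('a \<Rightarrow> nat) set" where
  "exps S = {m. \<forall>t. t \<notin> S \<longrightarrow> m t = 0}"

lemma alg_indep_iff: "alg_indep K T \<longleftrightarrow> (\<forall>S M c. finite S \<and> S \<subseteq> T \<and> finite M \<and> M \<subseteq> exps S \<and>
     (\<forall>m\<in>M. c m \<in> K) \<and> (\<Sum>m\<in>M. c m * mon S m) = 0 \<longrightarrow> (\<forall>m\<in>M. c m = 0))"
  unfolding alg_indep_def exps_def mon_def subset_iff mem_Collect_eq Ball_def by (rule refl)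

lemma alg_indepD:
  assumes "alg_indep K T" "finite S" "S \<subseteq> T" "finite M" "M \<subseteq> exps S"
    and "\<forall>m\<in>M. c m \<in> K" "(\<Sum>m\<in>M. c m * mon S m) = 0"
  shows "\<forall>m\<in>M. c m = 0"
  using assms(1)[unfolded alg_indep_iff, THEN spec, THEN spec, THEN spec, of S M c] assms(2-)
  by (rule mp[OF _ conjI[OF _ conjI[OF _ conjI[OF _ conjI[OF _ conjI]]]]])

lemma mon_mult: "mon S m * mon S m' = mon S (\<lambda>t. m t + m' t)"
  by (simp add: mon_def prod.distrib power_add)

lemma mon_split: "finite S \<Longrightarrow> t \<in> S \<Longrightarrow> mon S m = t ^ m t * mon (S - {t}) m"
  by (simp add: mon_def prod.remove)

lemma mon_upd: "t \<notin> S \<Longrightarrow> mon S (m(t := k)) = mon S m"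
  unfolding mon_def by (intro prod.cong) auto

lemma polynomials_subring:
  assumes "is_subfield K"
  shows "is_subring (lspan K (mon S ` exps S))"
proof (rule lspan_subring[OF subfield_subring[OF assms]])
  have "mon S (\<lambda>_. 0) \<in> mon S ` exps S" by (auto simp: exps_def)
  then show "1 \<in> lspan K (mon S ` exps S)"
    using lspan_base[OF subfield_subring[OF assms]] by (fastforce simp: mon_def)
  show "b * b' \<in> lspan K (mon S ` exps S)" if "b \<in> mon S ` exps S" "b' \<in> mon S ` exps S" for b b'
    using that
    by (auto simp: mon_mult exps_def intro!: lspan_base[OF subfield_subring[OF assms]])
qed

lemma gen_field_polynomials:
  assumes K: "is_subfield K" and S: "finite S"
  shows "gen_field (K \<union> S) = fractions (lspan K (mon S ` exps S))"
proof (rule gen_field_fractions[OF polynomials_subring[OF K]])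
  let ?R = "lspan K (mon S ` exps S)"
  have "t \<in> ?R" if "t \<in> S" for t
  proof -
    let ?m = "(\<lambda>_. 0)(t := 1)"
    have "mon S ?m = t" using that S by (simp add: mon_split mon_upd) (simp add: mon_def)
    moreover have "?m \<in> exps S" using that by (auto simp: exps_def)
    ultimately show ?thesis using lspan_base[OF subfield_subring[OF K]] by (metis image_eqI)
  qed
  moreover have "K \<subseteq> ?R"
    using lspan_contains_scalars[OF subfield_subring[OF K]] sr_1[OF polynomials_subring[OF K]] by blast
  ultimately show "K \<union> S \<subseteq> ?R" by blast
  show "?R \<subseteq> gen_field (K \<union> S)"
  proof (rule lspan_subset[OF subfield_subring[OF gen_field_subfield]])
    show "K \<subseteq> gen_field (K \<union> S)" using gen_field_superset[of "K \<union> S"] by auto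
    show "mon S ` exps S \<subseteq> gen_field (K \<union> S)"
      unfolding mon_def using gen_field_superset[of "K \<union> S"]
      by (auto intro!: sf_prod sf_power gen_field_subfield)
  qed
qed

lemma polynomial_representation:
  assumes K: "is_subring K" and x: "x \<in> lspan K (mon S ` exps S)"
  shows "\<exists>M c. finite M \<and> M \<subseteq> exps S \<and> (\<forall>m\<in>M. c m \<in> K) \<and> x = (\<Sum>m\<in>M. c m * mon S m)"
proof -
  obtain A where A: "finite A" "A \<subseteq> mon S ` exps S" "x \<in> lspan K A"
    using lspan_finite_subset[OF x] by blast
  obtain c where c: "\<forall>b\<in>A. c b \<in> K" "x = (\<Sum>b\<in>A. c b * b)"
    using A(3) lspan_finite[OF A(1) K] by blast
  \<comment> \<open>Different exponent functions may give the same field element, so one preimage is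
    chosen for each element of A.\<close>
  obtain M where M: "M \<subseteq> exps S" "finite M" "inj_on (mon S) M" "A = mon S ` M"
    using A(1,2) by (metis subset_image_inj finite_imageD)
  have "x = (\<Sum>m\<in>M. c (mon S m) * mon S m)"
    using c M by (simp add: sum.reindex)
  moreover have "\<forall>m\<in>M. c (mon S m) \<in> K" using M c by auto
  ultimately show ?thesis using M by (intro exI[of _ M] exI[of _ "\<lambda>m. c (mon S m)"]) simp
qed

text \<open>Sorted by powers of t, a relation is a polynomial in t over K(T). Its coefficients
  vanish because t is transcendental, and each of them is a relation among elements of T.\<close>

lemma alg_indep_insert:
  assumes K: "is_subfield K" and T: "alg_indep K T" and t: "t \<notin> acl K T"
  shows "alg_indep K (insert t T)"
  unfolding alg_indep_iff
proof (intro allI impI, elim conjE)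
  fix S M c
  assume S: "finite S" "S \<subseteq> insert t T" and M: "finite M" "M \<subseteq> exps S"
    and c: "\<forall>m\<in>M. c m \<in> K" "(\<Sum>m\<in>M. c m * mon S m) = 0"
  show "\<forall>m\<in>M. c m = 0"
  proof (cases "t \<in> S")
    case False
    then show ?thesis using S M c by (intro alg_indepD[OF T, of S]) auto
  next
    case True
    define S' where "S' = S - {t}"
    have S': "finite S'" "S' \<subseteq> T" "t \<notin> S'" using S by (auto simp: S'_def)
    let ?E = "gen_field (K \<union> T)"
    define d where "d = (\<lambda>k. \<Sum>m\<in>{m\<in>M. m t = k}. c m * mon S' m)"
    define N where "N = Suc (Max ((\<lambda>m. m t) ` M))"
    have N: "m t < N" if "m \<in> M" for m
      unfolding N_def using M that by (simp add: le_imp_less_Suc)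
    have "(\<Sum>m\<in>M. c m * mon S m) = (\<Sum>m\<in>M. c m * mon S' m * t ^ m t)"
      by (intro sum.cong refl) (simp add: mon_split[OF S(1) True] S'_def mult_ac)
    also have "\<dots> = (\<Sum>k<N. \<Sum>m\<in>{m\<in>M. m t = k}. c m * mon S' m * t ^ m t)"
      using M N by (intro sum.group[symmetric]) auto
    also have "\<dots> = (\<Sum>k<N. d k * t ^ k)"
      unfolding d_def sum_distrib_right by (intro sum.cong refl) auto
    finally have "poly (sum_poly d N) t = 0" using c by (simp add: poly_sum_poly)
    moreover have "poly_over ?E (sum_poly d N)"
    proof (intro poly_over_sum_poly subfield_subring gen_field_subfield)
      fix k
      have "K \<subseteq> ?E" "T \<subseteq> ?E" using gen_field_superset[of "K \<union> T"] by auto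
      then show "d k \<in> ?E"
        unfolding d_def mon_def using c S'
        by (intro sf_sum sf_mult sf_prod sf_power gen_field_subfield) auto
    qed
    ultimately have "sum_poly d N = 0"
      using t unfolding acl_def algebraic_over_iff by blast
    then have d0: "d k = 0" if "k < N" for k
      using coeff_sum_poly[of d N k] that by simp
    show ?thesis
    proof
      fix m assume m: "m \<in> M"
      define k where "k = m t"
      \<comment> \<open>Among monomials of fixed t-degree k, erasing the exponent of t is injective,
        so \<open>d k = 0\<close> becomes a relation on S' with the same coefficients.\<close>
      let ?Mk = "{m\<in>M. m t = k}" and ?u = "\<lambda>m :: 'a \<Rightarrow> nat. m(t := 0)" and ?w = "\<lambda>m :: 'a \<Rightarrow> nat. m(t := k)"
      have inj: "inj_on ?u ?Mk"
        by (rule inj_on_inverseI[of _ ?w]) auto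
      have "(\<Sum>m\<in>?u ` ?Mk. c (?w m) * mon S' m) = d k"
        unfolding d_def
        by (subst sum.reindex[OF inj]) (auto intro!: sum.cong simp: mon_upd[OF S'(3)])
      then have "(\<Sum>m\<in>?u ` ?Mk. c (?w m) * mon S' m) = 0"
        using d0[of k] N[OF m] k_def by simp
      moreover have "\<forall>m\<in>?u ` ?Mk. c (?w m) \<in> K" using c by auto
      moreover have "?u ` ?Mk \<subseteq> exps S'" using M by (auto simp: exps_def S'_def)
      ultimately have "\<forall>m\<in>?u ` ?Mk. c (?w m) = 0"
        using M(1) by (intro alg_indepD[OF T S'(1,2)]) auto
      moreover have "?u m \<in> ?u ` ?Mk" using m k_def by blast
      ultimately have "c (?w (?u m)) = 0" by blast
      then show "c m = 0" by (simp add: k_def)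
    qed
  qed
qed

text \<open>Converse of \<open>alg_indep_insert\<close>: an algebraic equation for t over K(T),
  cleared of denominators and expanded into monomials, is a relation on
  \<open>insert t T\<close>.\<close>

lemma alg_indep_not_acl:
  assumes K: "is_subfield K" and T: "finite T" "alg_indep K (insert t T)" and t: "t \<notin> T"
  shows "t \<notin> acl K T"
proof
  assume "t \<in> acl K T"
  let ?R = "lspan K (mon T ` exps T)"
  note sr = subfield_subring[OF K]
  have R: "is_subring ?R" by (rule polynomials_subring[OF K])
  obtain p where p: "p \<noteq> 0" "poly_over (fractions ?R) p" "poly p t = 0"
    using \<open>t \<in> acl K T\<close> gen_field_polynomials[OF K T(1)] unfolding acl_def algebraic_over_iff by auto
  obtain q where q: "q \<noteq> 0" "poly_over ?R q" "poly q t = 0"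
    using clear_denominators_poly[OF R p] by blast
  have "\<forall>k. \<exists>M c. finite M \<and> M \<subseteq> exps T \<and> (\<forall>m\<in>M. c m \<in> K) \<and> coeff q k = (\<Sum>m\<in>M. c m * mon T m)"
    using q(2) polynomial_representation[OF sr] unfolding poly_over_def by blast
  then obtain M c where M: "\<And>k. finite (M k)" "\<And>k. M k \<subseteq> exps T"
    and c: "\<And>k m. m \<in> M k \<Longrightarrow> c k m \<in> K" "\<And>k. coeff q k = (\<Sum>m\<in>M k. c k m * mon T m)"
    by metis
  let ?n = "degree q"
  \<comment> \<open>Pairs of a power of t and a monomial of its coefficient; \<open>g\<close> merges
    them into one exponent function and \<open>C\<close> reads the coefficient back from it.\<close>
  define I where "I = (SIGMA k:{..?n}. M k)"
  define g where "g = (\<lambda>(k, m :: 'a \<Rightarrow> nat). m(t := k))"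
  define C where "C = (\<lambda>m :: 'a \<Rightarrow> nat. c (m t) (m(t := 0)))"
  have 0: "m(t := 0) = m" if "m \<in> M k" for m k
    using M(2)[of k] that t by (fastforce simp: exps_def)
  have inj: "inj_on g I"
    by (rule inj_on_inverseI[of _ "\<lambda>m. (m t, m(t := 0))"]) (auto simp: I_def g_def 0)
  have "(\<Sum>m\<in>g ` I. C m * mon (insert t T) m) = (\<Sum>x\<in>I. C (g x) * mon (insert t T) (g x))"
    by (simp add: sum.reindex[OF inj])
  also have "\<dots> = (\<Sum>(k, m)\<in>I. c k m * mon T m * t ^ k)"
  proof (rule sum.cong[OF refl])
    fix x assume "x \<in> I"
    then obtain k m where x: "x = (k, m)" "m \<in> M k" by (auto simp: I_def)
    have "mon (insert t T) (m(t := k)) = t ^ k * mon T m"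
      using T t by (simp add: mon_split[of _ t] mon_upd)
    then show "C (g x) * mon (insert t T) (g x) = (case x of (k, m) \<Rightarrow> c k m * mon T m * t ^ k)"
      using x 0[OF x(2)] by (simp add: C_def g_def)
  qed
  also have "\<dots> = (\<Sum>k\<le>?n. \<Sum>m\<in>M k. c k m * mon T m * t ^ k)"
    unfolding I_def using M(1) by (subst sum.Sigma) auto
  also have "\<dots> = (\<Sum>k\<le>?n. coeff q k * t ^ k)"
    by (simp add: c(2) sum_distrib_right)
  also have "\<dots> = 0" using q(3) by (simp add: poly_altdef)
  finally have sum0: "(\<Sum>m\<in>g ` I. C m * mon (insert t T) m) = 0" .
  have "finite (g ` I)" using M(1) by (auto simp: I_def)
  moreover have "g ` I \<subseteq> exps (insert t T)" using M(2) by (fastforce simp: I_def g_def exps_def)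
  moreover have Cg: "C (g (k, m)) = c k m" if "m \<in> M k" for k m
    using 0[OF that] by (simp add: C_def g_def)
  have "\<forall>m\<in>g ` I. C m \<in> K"
    using Cg c(1) by (auto simp: I_def)
  ultimately have "\<forall>m\<in>g ` I. C m = 0"
    using sum0 T(1) by (intro alg_indepD[OF T(2), of "insert t T"]) auto
  then have "coeff q ?n = 0"
  proof -
    have "c ?n m = 0" if "m \<in> M ?n" for m
      using that Cg[OF that] \<open>\<forall>m\<in>g ` I. C m = 0\<close> by (force simp: I_def)
    then show ?thesis using c(2)[of ?n] by simp
  qed
  then show False using q(1) by simp
qed

lemma alg_indep_card_le:
  assumes K: "is_subfield K" and I: "finite I" "alg_indep K I" and G: "finite G" "I \<subseteq> acl K G"
  shows "card I \<le> card G"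
proof (rule acl_indep_card_le[OF I(1) G(1) _ G(2)])
  fix x assume "x \<in> I"
  then show "x \<notin> acl K (I - {x})"
    using I by (intro alg_indep_not_acl[OF K]) (auto simp: insert_absorb)
qed

text \<open>\<open>has_trdeg\<close> only provides some basis. These are the three consequences in
  which that basis no longer appears: a bound above, a bound below, and maximality of independent
  sets of full size.\<close>

lemma has_trdegD:
  assumes K: "is_subfield K" and "has_trdeg K F n"
  shows "finite I \<Longrightarrow> I \<subseteq> F \<Longrightarrow> alg_indep K I \<Longrightarrow> card I \<le> n"
    and "finite A \<Longrightarrow> card A < n \<Longrightarrow> \<exists>a\<in>F. a \<notin> acl K A"
    and "finite I \<Longrightarrow> I \<subseteq> F \<Longrightarrow> alg_indep K I \<Longrightarrow> card I = n \<Longrightarrow> transc_basis K F I"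
proof -
  obtain T where T: "T \<subseteq> F" "alg_indep K T" "F \<subseteq> acl K T" "finite T" "card T = n"
    using assms(2) unfolding has_trdeg_def transc_basis_def acl_def by blast
  show 1: "card I \<le> n" if "finite I" "I \<subseteq> F" "alg_indep K I" for I
    using alg_indep_card_le[OF K that(1,3) T(4)] T that by auto
  show "\<exists>a\<in>F. a \<notin> acl K A" if "finite A" "card A < n"
    using alg_indep_card_le[OF K T(4,2) that(1)] T that by force
  show "transc_basis K F I" if I: "finite I" "I \<subseteq> F" "alg_indep K I" "card I = n"
  proof -
    have "z \<in> acl K I" if z: "z \<in> F" for z
    proof (rule ccontr)
      assume "z \<notin> acl K I"
      moreover from this have "z \<notin> I" using acl_superset by blast
      ultimately show False
        using 1[of "insert z I"] alg_indep_insert[OF K I(3)] I z by auto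
    qed
    then show ?thesis using I unfolding transc_basis_def acl_def by blast
  qed
qed

section \<open>Separability in characteristic p\<close>

text \<open>\<open>separable_ext\<close> quantifies over all primes vanishing in the field; this
  shows that there is at most one, and links it to \<open>CHAR\<close>.\<close>

lemma prime_char_eq:
  assumes "prime p" "(of_nat p :: 'a::field) = 0"
  shows "CHAR('a) = p"
proof -
  have "CHAR('a) dvd p" using assms(2) of_nat_eq_0_iff_char_dvd by blast
  then have "CHAR('a) = 1 \<or> CHAR('a) = p" using assms(1) prime_nat_iff by blast
  then show ?thesis by simp
qed

lemma frobenius_add:
  assumes "prime p" "(of_nat p :: 'a::field) = 0"
  shows "(x + y :: 'a) ^ p = x ^ p + y ^ p"
  by (rule freshmans_dream) (use prime_char_eq[OF assms] assms in simp_all)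

lemma frobenius_sum:
  assumes "prime p" "(of_nat p :: 'a::field) = 0"
  shows "(\<Sum>i\<in>I. f i :: 'a) ^ p = (\<Sum>i\<in>I. f i ^ p)"
  by (rule freshmans_dream_sum) (use prime_char_eq[OF assms] assms in simp_all)

lemma frobenius_diff:
  assumes "prime p" "(of_nat p :: 'a::field) = 0"
  shows "(x - y :: 'a) ^ p = x ^ p - y ^ p"
  using frobenius_add[OF assms, of "x - y" y] by (simp add: eq_diff_eq)

lemma of_nat_neq_0_below_char:
  assumes "prime p" "(of_nat p :: 'a::field) = 0" "0 < k" "k < p"
  shows "(of_nat k :: 'a) \<noteq> 0"
  using assms(3,4) prime_char_eq[OF assms(1,2)] nat_dvd_not_less[OF assms(3,4)]
  by (simp add: of_nat_eq_0_iff_char_dvd)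

abbreviation ppow :: "nat \<Rightarrow> 'a::field set \<Rightarrow> 'a set" where
  "ppow p L \<equiv> (\<lambda>x. x ^ p) ` L"

text \<open>The E-span of L^p is a ring, as products of p-th powers are p-th powers. It is algebraic
  over E, hence already the field generated by E and L^p.\<close>

lemma gen_field_ppow_lspan:
  assumes E: "is_subfield E" and L: "is_subfield L" and EL: "fin_ext E L"
    and gen: "L = gen_field (E \<union> ppow p L)"
  shows "L \<subseteq> lspan E (ppow p L)"
proof -
  let ?R = "lspan E (ppow p L)"
  note sr = subfield_subring[OF E]
  have "E \<subseteq> L" using EL unfolding fin_ext_def by blast
  have base: "x ^ p \<in> ?R" if "x \<in> L" for x using that by (intro lspan_base[OF sr]) auto
  have R: "is_subring ?R"
  proof (rule lspan_subring[OF sr])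
    show "1 \<in> ?R" using base[OF sf_1[OF L]] by simp
    show "b * b' \<in> ?R" if "b \<in> ppow p L" "b' \<in> ppow p L" for b b'
      using that base sf_mult[OF L] by (auto simp flip: power_mult_distrib)
  qed
  have ER: "E \<subseteq> ?R" using lspan_contains_scalars[OF sr sr_1[OF R]] .
  have RL: "?R \<subseteq> L"
    using \<open>E \<subseteq> L\<close> by (intro lspan_subset[OF subfield_subring[OF L]]) (auto intro: sf_power[OF L])
  have "inverse x \<in> ?R" if "x \<in> ?R" for x
    using that RL by (intro inverse_in_subring[OF E R ER] fin_ext_algebraic[OF E L EL]) auto
  then have "is_subfield ?R" by (intro subfieldI[OF R])
  then have "gen_field (E \<union> ppow p L) \<subseteq> ?R"
    using ER base by (intro gen_field_least) auto
  then show ?thesis using gen by simp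
qed

text \<open>If the p-th powers of a basis of \<open>L|E\<close> still span \<open>L\<close> over \<open>E\<close>, a dimension count makes
  them linearly independent over \<open>E\<close>, so the basis itself is independent over \<open>E\<^sup>1\<^sup>/\<^sup>p\<close>.\<close>

lemma lin_indep_ppow:
  assumes p: "prime p" "(of_nat p :: 'a::field) = 0"
    and E: "is_subfield (E :: 'a set)" and L: "is_subfield L" and EL: "fin_ext E L"
    and gen: "L = gen_field (E \<union> ppow p L)"
    and A: "finite A" "A \<subseteq> L" "lin_indep_over E A"
    and d: "\<forall>a\<in>A. d a \<in> E" "(\<Sum>a\<in>A. d a * a ^ p) = 0" and a: "a \<in> A"
  shows "d a = 0"
proof (rule ccontr)
  assume da: "d a \<noteq> 0"
  note sr = subfield_subring[OF E]
  obtain B0 where B0: "finite B0" "L \<subseteq> lspan E B0" using EL unfolding fin_ext_def by blast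
  then obtain B where B: "finite B" "A \<subseteq> B" "B \<subseteq> L" "lin_indep_over E B" "L \<subseteq> lspan E B"
    using lin_indep_extend[OF E B0(1) A B0(2)] by blast
  let ?W = "ppow p (B - {a})"
  have W: "b ^ p \<in> lspan E ?W" if "b \<in> B" for b
  proof (cases "b = a")
    case False
    then show ?thesis using that by (intro lspan_base[OF sr]) auto
  next
    case True
    have "d a * a ^ p + (\<Sum>x\<in>A - {a}. d x * x ^ p) = 0"
      using d(2) A(1) a by (simp add: sum.remove)
    then have "d a * a ^ p = - (\<Sum>x\<in>A - {a}. d x * x ^ p)"
      by (simp add: eq_neg_iff_add_eq_0)
    then have "a ^ p = (- inverse (d a)) * (\<Sum>x\<in>A - {a}. d x * x ^ p)"
      using da by (simp add: field_simps)
    moreover have "(\<Sum>x\<in>A - {a}. d x * x ^ p) \<in> lspan E ?W"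
      using d B by (intro lspan_sum lspan_scaled) auto
    moreover have "- inverse (d a) \<in> E" using d a sf_uminus[OF E] sf_inverse[OF E] by blast
    ultimately show ?thesis using lspan_scale[OF sr, of "- inverse (d a)"] True by simp
  qed
  have "ppow p L \<subseteq> lspan E ?W"
  proof clarify
    fix x assume "x \<in> L"
    then obtain c where c: "\<forall>b\<in>B. c b \<in> E" "x = (\<Sum>b\<in>B. c b * b)"
      using B lspan_finite[OF B(1) sr] by blast
    have "x ^ p = (\<Sum>b\<in>B. c b ^ p * b ^ p)"
      unfolding c(2) frobenius_sum[OF p] by (simp add: power_mult_distrib)
    also have "\<dots> \<in> lspan E ?W"
      using c W sf_power[OF E] by (intro lspan_sum lspan_scale[OF sr]) auto
    finally show "x ^ p \<in> lspan E ?W" .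
  qed
  then have "lspan E (ppow p L) \<subseteq> lspan E ?W" by (rule lspan_trans[OF sr])
  then have "B \<subseteq> lspan E ?W" using gen_field_ppow_lspan[OF E L EL gen] B by blast
  then have "card B \<le> card ?W" using B by (intro lin_indep_card_le[OF sr]) auto
  also have "\<dots> \<le> card (B - {a})" using B by (intro card_image_le) auto
  also have "\<dots> < card B" using B a by (intro card_Diff1_less) auto
  finally show False by simp
qed

text \<open>The p-th power of a relation with coefficients in E^(1/p) has coefficients in E and
  involves the p-th powers of the basis elements, so \<open>lin_indep_ppow\<close> applies.\<close>

lemma separable_extI:
  fixes E L :: "'a::field set"
  assumes E: "is_subfield E" and L: "is_subfield L" and EL: "fin_ext E L"
    and gen: "\<And>p. prime p \<Longrightarrow> (of_nat p :: 'a) = 0 \<Longrightarrow> L = gen_field (E \<union> ppow p L)"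
  shows "separable_ext E L"
  unfolding separable_ext_def lin_disjoint_def
proof (intro allI impI, elim conjE)
  fix p A assume p: "prime p" "(of_nat p :: 'a) = 0" and A: "finite A" "A \<subseteq> L" "lin_indep_over E A"
  show "lin_indep_over (proot_field p E) A"
    unfolding lin_indep_over_def
  proof (intro allI impI ballI, elim conjE)
    fix c a assume c: "\<forall>a\<in>A. c a \<in> proot_field p E" "(\<Sum>a\<in>A. c a * a) = 0" and a: "a \<in> A"
    have "(\<Sum>a\<in>A. c a ^ p * a ^ p) = (\<Sum>a\<in>A. c a * a) ^ p"
      unfolding frobenius_sum[OF p] by (simp add: power_mult_distrib)
    also have "\<dots> = 0" using c p by (simp add: prime_gt_0_nat)
    finally have "c a ^ p = 0"
      using c a by (intro lin_indep_ppow[OF p E L EL gen[OF p] A, of "\<lambda>a. c a ^ p"]) (auto simp: proot_field_def)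
    then show "c a = 0" by simp
  qed
qed

section \<open>Purely inseparable elements of degree p\<close>

lemma poly_division_over:
  assumes E: "is_subfield E" and f: "f \<noteq> 0" "poly_over E f"
  shows "poly_over E g \<Longrightarrow> \<exists>q r. poly_over E q \<and> poly_over E r \<and> g = q * f + r \<and> (r = 0 \<or> degree r < degree f)"
proof (induction "degree g" arbitrary: g rule: less_induct)
  case less
  note sr = subfield_subring[OF E]
  show ?case
  proof (cases "g = 0 \<or> degree g < degree f")
    case True
    then show ?thesis using less.prems poly_over_0[OF sr] by (intro exI[of _ 0] exI[of _ g]) auto
  next
    case False
    define c where "c = lead_coeff g / lead_coeff f"
    define m where "m = monom c (degree g - degree f)"
    have "c \<in> E" using less.prems f(2) E by (auto simp: c_def poly_over_def intro: sf_divide)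
    then have m: "poly_over E m" unfolding m_def by (intro poly_over_monom[OF sr])
    have c0: "c \<noteq> 0" using False f by (simp add: c_def)
    have "degree (m * f) = degree g"
      using False f c0 by (subst degree_mult_eq) (auto simp: m_def degree_monom_eq)
    moreover have "coeff (m * f) (degree g) = lead_coeff g"
      using False f by (simp add: m_def coeff_monom_mult c_def)
    ultimately have deg: "g - m * f = 0 \<or> degree (g - m * f) < degree g"
      using degree_diff_le[of g "degree g" "m * f"] eq_zero_or_degree_less[of "g - m * f" "degree g"]
      by simp
    have g': "poly_over E (g - m * f)"
      by (intro poly_over_diff[OF sr] poly_over_mult[OF sr] less.prems m f)
    show ?thesis
    proof (cases "g - m * f = 0")
      case True
      then show ?thesis using m poly_over_0[OF sr] by (intro exI[of _ m] exI[of _ 0]) auto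
    next
      case False
      then obtain q r where "poly_over E q" "poly_over E r" "g - m * f = q * f + r"
          "r = 0 \<or> degree r < degree f"
        using less.hyps[OF _ g'] deg by blast
      moreover from this have "g = (q + m) * f + r" by (simp add: algebra_simps)
      ultimately show ?thesis using poly_over_add[OF sr _ m] by blast
    qed
  qed
qed

text \<open>Since X^p - b^p = (X - b)^p, an annihilating polynomial of b of least degree k < p has
  the form c (X - b)^k. Its coefficient at X^(k-1) is -c k b, and k is invertible, which would put b
  into E.\<close>

lemma no_small_poly:
  assumes p: "prime p" "(of_nat p :: 'a::field) = 0" and ac: "alg_closed_ty TYPE('a)"
    and E: "is_subfield (E :: 'a set)" and b: "b \<notin> E" "b ^ p \<in> E"
    and f0: "poly_over E f0" "degree f0 < p" "poly f0 b = 0"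
  shows "f0 = 0"
proof (rule ccontr)
  assume "f0 \<noteq> 0"
  note sr = subfield_subring[OF E]
  let ?P = "\<lambda>f. f \<noteq> 0 \<and> poly_over E f \<and> poly f b = 0"
  obtain f where f: "?P f" and min: "\<And>g. ?P g \<Longrightarrow> degree f \<le> degree g"
    using ex_has_least_nat[of ?P f0 degree] f0 \<open>f0 \<noteq> 0\<close> by blast
  define k where "k = degree f"
  have k: "0 < k" "k < p"
    using algebraic_power_in_lspan[OF E] f min[of f0] f0 \<open>f0 \<noteq> 0\<close> unfolding k_def by auto
  define g where "g = monom 1 p - [:b ^ p:]"
  have "poly_over E g"
    unfolding g_def using b by (intro poly_over_diff[OF sr] poly_over_monom[OF sr])
      (auto simp: poly_over_pCons[OF sr] poly_over_0[OF sr] sr_1[OF sr])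
  then obtain q r where qr: "poly_over E r" "g = q * f + r" "r = 0 \<or> degree r < degree f"
    using poly_division_over[OF E, of f g] f by blast
  have g_eval: "poly g z = (z - b) ^ p" for z
    by (simp add: g_def poly_monom frobenius_diff[OF p])
  have "poly r b = 0"
    using arg_cong[OF qr(2), of "\<lambda>g. poly g b"] f g_eval[of b] k(2) by (simp add: power_0_left)
  then have "r = 0" using min[of r] qr(1,3) by linarith
  obtain h where h: "f = [:- b, 1:] ^ order b f * h" "\<not> [:- b, 1:] dvd h"
    using order_decomp[of f b] f by blast
  define j where "j = order b f"
  \<comment> \<open>A nonconstant cofactor would have a root in the algebraically closed ambient
    field. That root is a zero of (X - b)^p, hence b, although X - b does not divide
    \<open>h\<close>.\<close>
  have "degree h = 0"
  proof (rule ccontr)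
    assume "degree h \<noteq> 0"
    then obtain z where z: "poly h z = 0" using ac unfolding alg_closed_ty_def by blast
    then have "poly f z = 0" by (subst h(1)) simp
    then have "poly g z = 0" using qr(2) \<open>r = 0\<close> by simp
    then have "z = b" using g_eval[of z] by simp
    then show False using z h(2) by (simp add: poly_eq_0_iff_dvd)
  qed
  then obtain c where "h = [:c:]" by (auto elim: degree_eq_zeroE)
  then have fc: "f = smult c ([:- b, 1:] ^ j)" using h(1) by (simp add: j_def mult.commute)
  then have c: "c \<noteq> 0" using f by auto
  have "k = j" unfolding k_def fc using c by (simp add: degree_linear_power)
  have "coeff f k = c" "coeff f (k - 1) = c * (of_nat k * (- b))"
    unfolding fc \<open>k = j\<close> using k \<open>k = j\<close>
    by (simp_all add: coeff_linear_poly_power binomial_symmetric[of "j - Suc 0" j])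
  then have "c \<in> E" "c * (of_nat k * (- b)) \<in> E" using f unfolding poly_over_def by metis+
  then have "- (c * (of_nat k * (- b))) / (c * of_nat k) \<in> E"
    using sf_divide[OF E] sf_uminus[OF E] sf_mult[OF E _ sf_of_nat[OF E]] by metis
  then show False
    using b(1) c of_nat_neq_0_below_char[OF p k] by simp
qed

lemma lspan_image_sum:
  assumes "x \<in> lspan E (f ` {..<n::nat})" "is_subring E"
  shows "\<exists>c. (\<forall>i<n. c i \<in> E) \<and> x = (\<Sum>i<n. c i * f i)"
  using assms(1)
proof induction
  case zero
  then show ?case using sr_0[OF assms(2)] by (intro exI[of _ "\<lambda>_. 0"]) auto
next
  case (step d b x)
  then obtain c where c: "\<forall>i<n. c i \<in> E" "x = (\<Sum>i<n. c i * f i)" by blast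
  obtain k where k: "k < n" "b = f k" using step by auto
  have "(\<Sum>i<n. (c(k := c k + d)) i * f i) = (\<Sum>i<n. c i * f i + (if i = k then d * f k else 0))"
    by (intro sum.cong) (auto simp: algebra_simps)
  also have "\<dots> = d * b + x" using k c by (simp add: sum.distrib)
  finally show ?case
    using c step sr_add[OF assms(2)] k by (intro exI[of _ "c(k := c k + d)"]) auto
qed

text \<open>Write a as a polynomial in b of degree below p over E. If b were outside E(a), this
  polynomial minus a would be zero by \<open>no_small_poly\<close> over E(a), so a would equal its
  constant term in E.\<close>

lemma p_exchange:
  assumes p: "prime p" "(of_nat p :: 'a::field) = 0" and ac: "alg_closed_ty TYPE('a)"
    and E: "is_subfield (E :: 'a set)" and b: "b ^ p \<in> E"
    and a: "a \<in> gen_field (E \<union> {b})" "a \<notin> E"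
  shows "b \<in> gen_field (E \<union> {a})"
proof (rule ccontr)
  let ?L = "gen_field (E \<union> {a})"
  note sr = subfield_subring[OF E]
  assume bL: "b \<notin> ?L"
  have EL: "E \<subseteq> ?L" "a \<in> ?L" using gen_field_superset[of "E \<union> {a}"] by auto
  have p2: "2 \<le> p" using p prime_ge_2_nat by blast
  have "b ^ p \<in> lspan E ((\<lambda>i. b ^ i) ` {..<p})"
  proof -
    have "b ^ 0 \<in> (\<lambda>i. b ^ i) ` {..<p}" using p2 by (intro imageI) simp
    from lspan_scaled[OF b this] show ?thesis by simp
  qed
  then have "a \<in> lspan E ((\<lambda>i. b ^ i) ` {..<p})"
    using gen_field_power_basis[OF E, of p b] a p2 by simp
  then obtain c where c: "\<forall>i<p. c i \<in> E" "a = (\<Sum>i<p. c i * b ^ i)"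
    using lspan_image_sum[OF _ sr] by blast
  define f where "f = sum_poly c p - [:a:]"
  have co: "coeff f i = (if i < p then c i else 0) - (if i = 0 then a else 0)" for i
    by (auto simp: f_def coeff_sum_poly coeff_pCons split: nat.splits)
  have "poly f b = 0" using c by (simp add: f_def poly_sum_poly)
  moreover have "coeff f i \<in> ?L" for i
    unfolding co using c EL by (intro sf_diff[OF gen_field_subfield]) (auto intro: sf_0[OF gen_field_subfield])
  then have "poly_over ?L f" unfolding poly_over_def by blast
  moreover have "degree f < p"
    by (rule degree_lessI) (use p2 in \<open>auto simp: co\<close>)
  ultimately have "f = 0"
    using no_small_poly[OF p ac gen_field_subfield bL] b EL by blast
  then have "c 0 = a" using co[of 0] p2 by simp
  moreover have "c 0 \<in> E" using c(1) p2 by simp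
  ultimately show False using a(2) by simp
qed

section \<open>Mac Lane: p-independent elements are algebraically independent\<close>

lemma lin_indepD:
  assumes "lin_indep_over E A" "\<forall>a\<in>A. c a \<in> E" "(\<Sum>a\<in>A. c a * a) = 0"
  shows "\<forall>a\<in>A. c a = 0"
  using assms(1)[unfolded lin_indep_over_def, THEN spec, of c] assms(2,3) by (rule mp[OF _ conjI])

text \<open>Reduces to relations in all of T whose listed coefficients are all nonzero. On such
  relations a degree induction makes sense, since every monomial counted really occurs.\<close>

lemma alg_indep_finiteI:
  assumes "finite T" and no_rel: "\<And>M c. finite M \<Longrightarrow> M \<noteq> {} \<Longrightarrow> M \<subseteq> exps T \<Longrightarrow>
      \<forall>m\<in>M. c m \<in> K \<and> c m \<noteq> 0 \<Longrightarrow> (\<Sum>m\<in>M. c m * mon T m) = 0 \<Longrightarrow> False"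
  shows "alg_indep K T"
  unfolding alg_indep_iff
proof (intro allI impI, elim conjE)
  fix S M c
  assume S: "finite S" "S \<subseteq> T" and M: "finite M" "M \<subseteq> exps S"
    and c: "\<forall>m\<in>M. c m \<in> K" "(\<Sum>m\<in>M. c m * mon S m) = 0"
  have mon: "mon T m = mon S m" if "m \<in> exps S" for m
    unfolding mon_def using S assms(1) that
    by (intro prod.mono_neutral_right) (auto simp: exps_def)
  let ?N = "{m\<in>M. c m \<noteq> 0}"
  have "(\<Sum>m\<in>?N. c m * mon T m) = (\<Sum>m\<in>M. c m * mon S m)"
    using M mon by (intro sum.mono_neutral_cong_left) auto
  moreover have "?N \<subseteq> exps T" using M S by (fastforce simp: exps_def)
  moreover have "\<forall>m\<in>?N. c m \<in> K \<and> c m \<noteq> 0" using c by blast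
  moreover have "finite ?N" using M(1) by simp
  ultimately have "?N = {}" using no_rel[of ?N c] c(2) by argo
  then show "\<forall>m\<in>M. c m = 0" by blast
qed

text \<open>Mac Lane: a relation of minimal degree would either exhibit a generator \<open>z\<close> whose exponent
  is not always divisible by \<open>p\<close>, contradicting minimality of \<open>Z\<close>, or be a p-th power of a relation
  over \<open>K\<^sup>1\<^sup>/\<^sup>p\<close>, which linear disjointness brings back to \<open>K\<close>.\<close>

lemma p_independent_alg_indep:
  fixes K F Z :: "'a::field set"
  assumes p: "prime p" "(of_nat p :: 'a) = 0" and ac: "alg_closed_ty TYPE('a)"
    and K: "is_subfield K" and F: "is_subfield F" and KF: "K \<subseteq> F" and sep: "separable_ext K F"
    and Z: "finite Z" "Z \<subseteq> F"
    and ind: "\<And>z. z \<in> Z \<Longrightarrow> z \<notin> gen_field (K \<union> ppow p F \<union> (Z - {z}))"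
  shows "alg_indep K Z"
proof (rule alg_indep_finiteI[OF Z(1)])
  \<comment> \<open>The induction measure is the sum of the total degrees of all monomials of the
    relation, so that removing monomials never increases it.\<close>
  define deg where "deg = (\<lambda>m :: 'a \<Rightarrow> nat. \<Sum>t\<in>Z. m t)"
  fix M c
  assume "finite M" "M \<noteq> {}" "M \<subseteq> exps Z" "\<forall>m\<in>M. c m \<in> K \<and> c m \<noteq> 0" "(\<Sum>m\<in>M. c m * mon Z m) = 0"
  then show False
  proof (induction "sum deg M" arbitrary: M c rule: less_induct)
    case less
    note M = less.prems(1-3) and c = less.prems(4,5)
    have p0: "0 < p" using p prime_gt_0_nat by blast
    show False
    proof (cases "\<exists>m\<in>M. \<exists>z\<in>Z. \<not> p dvd m z")
      case True
      then obtain m0 z where m0: "m0 \<in> M" "z \<in> Z" "\<not> p dvd m0 z" by blast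
      define e where "e = m0 z mod p"
      have e: "0 < e" "e < p" using m0 p0 by (auto simp: e_def mod_greater_zero_iff_not_dvd)
      let ?E = "gen_field (K \<union> ppow p F \<union> (Z - {z}))"
      define red where "red = (\<lambda>e (m :: 'a \<Rightarrow> nat). m(z := m z - e))"
      \<comment> \<open>Grouping exponents of z modulo p leaves multiples of p, that is powers of
        z^p, in the coefficients. The relation becomes a polynomial in z of degree below p over
        \<open>?E\<close>, and \<open>no_small_poly\<close> kills it.\<close>
      define h where "h = (\<lambda>e. \<Sum>m\<in>{m\<in>M. m z mod p = e}. c m * mon Z (red e m))"
      have split: "mon Z m = z ^ e * mon Z (red e m)" if "e \<le> m z" for e m
      proof -
        have "mon Z (red e m) = z ^ (m z - e) * mon (Z - {z}) m"
          using mon_split[OF Z(1) m0(2), of "red e m"] mon_upd[of z "Z - {z}" m] by (simp add: red_def)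
        moreover have "z ^ m z = z ^ e * z ^ (m z - e)" using that by (simp flip: power_add)
        ultimately show ?thesis using mon_split[OF Z(1) m0(2), of m] by simp
      qed
      have "(\<Sum>m\<in>M. c m * mon Z m) = (\<Sum>e<p. \<Sum>m\<in>{m\<in>M. m z mod p = e}. c m * mon Z m)"
        using M p0 by (intro sum.group[symmetric]) auto
      also have "\<dots> = (\<Sum>e<p. h e * z ^ e)"
        unfolding h_def sum_distrib_right
      proof (intro sum.cong refl)
        fix e m assume "m \<in> {m\<in>M. m z mod p = e}"
        then have "e \<le> m z" by auto
        then show "c m * mon Z m = c m * mon Z (red e m) * z ^ e" by (simp add: split)
      qed
      finally have "poly (sum_poly h p) z = 0" using c by (simp add: poly_sum_poly)
      moreover have "poly_over ?E (sum_poly h p)"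
      proof (intro poly_over_sum_poly subfield_subring gen_field_subfield)
        fix e
        have sub: "K \<subseteq> ?E" "ppow p F \<subseteq> ?E" "Z - {z} \<subseteq> ?E"
          using gen_field_superset[of "K \<union> ppow p F \<union> (Z - {z})"] by auto
        have "mon Z (red e m) \<in> ?E" if "m z mod p = e" for m
        proof -
          have "m z - e = p * (m z div p)" using that by (metis minus_mod_eq_mult_div)
          then have "z ^ (m z - e) = (z ^ p) ^ (m z div p)" by (simp add: power_mult)
          moreover have "z ^ p \<in> ?E" using sub(2) Z(2) m0(2) by blast
          ultimately have "z ^ (m z - e) \<in> ?E" by (simp add: sf_power[OF gen_field_subfield])
          moreover have "mon (Z - {z}) m \<in> ?E"
            unfolding mon_def using sub by (intro sf_prod sf_power gen_field_subfield) auto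
          ultimately show ?thesis
            using mon_split[OF Z(1) m0(2), of "red e m"] mon_upd[of z "Z - {z}" m]
            by (simp add: red_def sf_mult[OF gen_field_subfield])
        qed
        then show "h e \<in> ?E"
          unfolding h_def using c sub by (intro sf_sum sf_mult gen_field_subfield) auto
      qed
      moreover have "degree (sum_poly h p) < p"
        by (rule degree_lessI) (use p0 in \<open>auto simp: coeff_sum_poly\<close>)
      moreover have "z ^ p \<in> ?E"
        using Z(2) m0(2) gen_field_superset[of "K \<union> ppow p F \<union> (Z - {z})"] by blast
      ultimately have "sum_poly h p = 0"
        using no_small_poly[OF p ac gen_field_subfield ind[OF m0(2)]] by blast
      \<comment> \<open>The vanishing coefficient of z^e is again a relation on Z: its monomials are
        those with z-exponent congruent to e, divided by z^e, so the measure drops because e >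
        0.\<close>
      then have he: "h e = 0" using coeff_sum_poly[of h p e] e by simp
      let ?Me = "{m\<in>M. m z mod p = e}"
      have le: "e \<le> m z" if "m \<in> ?Me" for m using that by auto
      have inj: "inj_on (red e) ?Me"
        by (rule inj_on_inverseI[of _ "\<lambda>m. m(z := m z + e)"]) (use le in \<open>auto simp: red_def\<close>)
      define N where "N = red e ` ?Me"
      define c' where "c' = (\<lambda>m. c (m(z := m z + e)))"
      have c': "c' (red e m) = c m" if "m \<in> ?Me" for m
        using le[OF that] by (simp add: c'_def red_def)
      have "(\<Sum>m\<in>N. c' m * mon Z m) = 0"
        unfolding N_def sum.reindex[OF inj] using he c' by (simp add: h_def)
      moreover have "\<forall>m\<in>N. c' m \<in> K \<and> c' m \<noteq> 0" using c c' by (auto simp: N_def)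
      moreover have "finite N" "N \<noteq> {}" using M m0 by (auto simp: N_def e_def)
      moreover have "N \<subseteq> exps Z"
      proof
        fix x assume "x \<in> N"
        then obtain m where "m \<in> exps Z" "x = red e m" using M(3) by (auto simp: N_def)
        then show "x \<in> exps Z" using m0(2) by (auto simp: exps_def red_def)
      qed
      moreover have "sum deg N < sum deg M"
      proof -
        have "deg (red e m) < deg m" if "m \<in> ?Me" for m
          unfolding deg_def
        proof (rule sum_strict_mono_ex1[OF Z(1)])
          show "\<forall>t\<in>Z. red e m t \<le> m t" by (simp add: red_def)
          show "\<exists>t\<in>Z. red e m t < m t" using m0 e le[OF that] by (intro bexI[of _ z]) (auto simp: red_def)
        qed
        then have "(\<Sum>m\<in>?Me. deg (red e m)) < sum deg ?Me"
          using M m0 by (intro sum_strict_mono) (auto simp: e_def)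
        also have "\<dots> \<le> sum deg M" using M by (intro sum_mono2) auto
        finally show ?thesis by (simp add: N_def sum.reindex[OF inj])
      qed
      ultimately show False using less.hyps[of N c'] by blast
    next
      case False
      define q where "q = (\<lambda>(m :: 'a \<Rightarrow> nat) t. m t div p)"
      have pq: "m t = p * q m t" if "m \<in> M" for m t
        using False that M by (cases "t \<in> Z") (auto simp: q_def exps_def)
      have inj: "inj_on q M"
        by (rule inj_on_inverseI[of _ "\<lambda>m t. p * m t"]) (use pq in auto)
      define N where "N = q ` M"
      have N: "finite N" "N \<noteq> {}" "N \<subseteq> exps Z"
        using M by (auto simp: N_def exps_def q_def)
      have degN: "sum deg M = p * sum deg N"
      proof -
        have "deg m = p * deg (q m)" if "m \<in> M" for m
          unfolding deg_def sum_distrib_left using pq[OF that] by (intro sum.cong) auto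
        then show ?thesis by (simp add: N_def sum.reindex[OF inj] sum_distrib_left)
      qed
      \<comment> \<open>Otherwise the relation would consist of one nonzero constant. Positivity is
        what makes division of all exponents by p a strict descent.\<close>
      have "sum deg M \<noteq> 0"
      proof
        assume "sum deg M = 0"
        then have "m t = 0" if "m \<in> M" for m t
          using M that Z(1) by (cases "t \<in> Z") (auto simp: deg_def exps_def)
        then have "m = (\<lambda>_. 0)" if "m \<in> M" for m using that by (intro ext)
        then have "M = {\<lambda>_. 0}" using M(2) by blast
        then show False using c by (auto simp: mon_def)
      qed
      then have less_deg: "sum deg N < sum deg M"
        using degN mult_le_mono1[OF prime_ge_2_nat[OF p(1)], of "sum deg N"]
        by (metis add_cancel_right_right gr0I le_neq_implies_less less_add_same_cancel1 mult_0_right mult_2 order_less_le_trans)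
      have "\<exists>r. r ^ p = c m" for m
      proof -
        have "degree ([:- c m:] + monom 1 p) = p"
          using p0 by (subst degree_add_eq_right) (simp_all add: degree_monom_eq)
        then obtain r where "poly ([:- c m:] + monom 1 p) r = 0"
          using ac p0 unfolding alg_closed_ty_def by metis
        then show ?thesis by (intro exI[of _ r]) (simp add: poly_monom)
      qed
      then obtain rt where rt: "\<And>m. rt m ^ p = c m" by metis
      \<comment> \<open>Indexed so that \<open>d (q m)\<close> is a p-th root of \<open>c m\<close>;
        the roots exist in the algebraically closed ambient field.\<close>
      define d where "d = (\<lambda>m. rt (\<lambda>t. p * m t))"
      have d: "d (q m) ^ p = c m" if "m \<in> M" for m
      proof -
        have "(\<lambda>t. p * q m t) = m" using pq[OF that] by auto
        then show ?thesis by (simp add: d_def rt)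
      qed
      have "(\<Sum>m\<in>N. d m * mon Z m) ^ p = (\<Sum>m\<in>M. (d (q m) * mon Z (q m)) ^ p)"
        by (simp add: N_def sum.reindex[OF inj] frobenius_sum[OF p])
      also have "\<dots> = (\<Sum>m\<in>M. c m * mon Z m)"
      proof (intro sum.cong refl)
        fix m assume m: "m \<in> M"
        have "mon Z (q m) ^ p = mon Z m"
          unfolding mon_def prod_power_distrib using pq[OF m]
          by (intro prod.cong) (auto simp: power_mult mult.commute simp flip: power_mult)
        then show "(d (q m) * mon Z (q m)) ^ p = c m * mon Z m" using d[OF m] by (simp add: power_mult_distrib)
      qed
      finally have d0: "(\<Sum>m\<in>N. d m * mon Z m) = 0" using c p0 by simp
      \<comment> \<open>Any relation over K supported on N contradicts the induction hypothesis.
        This yields both the distinctness of the monomials as field elements and their linear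
        independence over K, to which separability applies.\<close>
      have smaller: False if "N' \<subseteq> N" "N' \<noteq> {}" "\<forall>m\<in>N'. c' m \<in> K \<and> c' m \<noteq> 0"
        "(\<Sum>m\<in>N'. c' m * mon Z m) = 0" for N' c'
      proof -
        have "sum deg N' \<le> sum deg N" using that N by (intro sum_mono2) auto
        then show False
          using less.hyps[of N' c'] that less_deg N finite_subset[of N' N] by fastforce
      qed
      have injm: "inj_on (mon Z) N"
      proof (rule inj_onI, rule ccontr)
        fix m m' assume m: "m \<in> N" "m' \<in> N" "mon Z m = mon Z m'" "m \<noteq> m'"
        show False
          using m sf_1[OF K] sf_uminus[OF K sf_1[OF K]]
          by (intro smaller[of "{m, m'}" "\<lambda>x. if x = m then 1 else -1"]) auto
      qed
      have "mon Z ` N \<subseteq> F"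
        unfolding mon_def using Z by (auto intro!: sf_prod[OF F] sf_power[OF F])
      have "lin_indep_over K (mon Z ` N)"
        unfolding lin_indep_over_def
      proof (intro allI impI, elim conjE, rule ccontr)
        fix c' assume c': "\<forall>a\<in>mon Z ` N. c' a \<in> K" "(\<Sum>a\<in>mon Z ` N. c' a * a) = 0"
          "\<not> (\<forall>a\<in>mon Z ` N. c' a = 0)"
        let ?N' = "{m\<in>N. c' (mon Z m) \<noteq> 0}"
        have "(\<Sum>m\<in>?N'. c' (mon Z m) * mon Z m) = (\<Sum>m\<in>N. c' (mon Z m) * mon Z m)"
          using N by (intro sum.mono_neutral_left) auto
        also have "\<dots> = 0" using c'(2) by (simp add: sum.reindex[OF injm])
        finally show False
          using c' by (intro smaller[of ?N' "\<lambda>m. c' (mon Z m)"]) auto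
      qed
      then have "lin_indep_over (proot_field p K) (mon Z ` N)"
        using sep p N \<open>mon Z ` N \<subseteq> F\<close> unfolding separable_ext_def lin_disjoint_def by blast
      moreover have "(\<Sum>a\<in>mon Z ` N. d (inv_into N (mon Z) a) * a) = 0"
        using d0 by (simp add: sum.reindex[OF injm] inv_into_f_f[OF injm])
      moreover have "\<forall>a\<in>mon Z ` N. d (inv_into N (mon Z) a) \<in> proot_field p K"
      proof -
        have "\<forall>m\<in>N. d m \<in> proot_field p K" using d c by (simp add: N_def proot_field_def)
        then show ?thesis by (simp add: inv_into_f_f[OF injm])
      qed
      ultimately have "\<forall>a\<in>mon Z ` N. d (inv_into N (mon Z) a) = 0"
        by (intro lin_indepD)
      then have "\<forall>m\<in>N. d m = 0" by (simp add: inv_into_f_f[OF injm])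
      then have "c m = 0" if "m \<in> M" for m
        using that d[OF that] p0 by (simp add: N_def power_0_left)
      then show False using M c by auto
    qed
  qed
qed

text \<open>A generating subset of S over K F^p of least size is p-independent, hence algebraically
  independent; this bounds its size by the transcendence degree.\<close>

lemma p_generators_alg_indep:
  fixes K F S :: "'a::field set"
  assumes p: "prime p" "(of_nat p :: 'a) = 0" and ac: "alg_closed_ty TYPE('a)"
    and K: "is_subfield K" and S: "finite S" "F = gen_field (K \<union> S)" and sep: "separable_ext K F"
  shows "\<exists>Z\<subseteq>S. alg_indep K Z \<and> F = gen_field (K \<union> ppow p F \<union> Z)"
proof -
  have F: "is_subfield F" using S gen_field_subfield by blast
  have KF: "K \<subseteq> F" "S \<subseteq> F" using S gen_field_superset[of "K \<union> S"] by auto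
  let ?P = "\<lambda>Z. Z \<subseteq> S \<and> F = gen_field (K \<union> ppow p F \<union> Z)"
  have "?P S"
  proof
    have "K \<union> ppow p F \<union> S \<subseteq> F" using KF sf_power[OF F] by auto
    then have "gen_field (K \<union> ppow p F \<union> S) \<subseteq> F" by (rule gen_field_least[OF F])
    moreover have "F \<subseteq> gen_field (K \<union> ppow p F \<union> S)" unfolding S(2) by (intro gen_field_mono) auto
    ultimately show "F = gen_field (K \<union> ppow p F \<union> S)" by blast
  qed simp
  then obtain Z where Z: "?P Z" and min: "\<And>Y. ?P Y \<Longrightarrow> card Z \<le> card Y"
    using ex_has_least_nat[of ?P S card] by blast
  have finZ: "finite Z" using Z S finite_subset by blast
  have "z \<notin> gen_field (K \<union> ppow p F \<union> (Z - {z}))" if z: "z \<in> Z" for z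
  proof
    assume zE: "z \<in> gen_field (K \<union> ppow p F \<union> (Z - {z}))"
    have "gen_field (K \<union> ppow p F \<union> Z) = gen_field (K \<union> ppow p F \<union> (Z - {z}))"
    proof (rule gen_field_eqI)
      show "K \<union> ppow p F \<union> Z \<subseteq> gen_field (K \<union> ppow p F \<union> (Z - {z}))"
        using gen_field_superset[of "K \<union> ppow p F \<union> (Z - {z})"] zE by auto
      show "K \<union> ppow p F \<union> (Z - {z}) \<subseteq> gen_field (K \<union> ppow p F \<union> Z)"
        using gen_field_superset[of "K \<union> ppow p F \<union> Z"] by auto
    qed
    then have "card Z \<le> card (Z - {z})" using Z by (intro min) auto
    then show False using finZ z by (meson card_Diff1_less not_le)
  qed
  then have "alg_indep K Z"
    using p_independent_alg_indep[OF p ac K F KF(1) sep finZ] Z KF by blast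
  then show ?thesis using Z by blast
qed

section \<open>Separating transcendence bases\<close>

text \<open>Take Y maximal in Z with t outside E(Y). Adjoining any further z captures t, and
  \<open>p_exchange\<close> over E(Y) gives z back from t.\<close>

lemma p_step_exchange:
  assumes p: "prime p" "(of_nat p :: 'a::field) = 0" and ac: "alg_closed_ty TYPE('a)"
    and E: "is_subfield (E :: 'a set)" and pE: "ppow p F \<subseteq> E"
    and Z: "finite Z" "Z \<subseteq> F" and gen: "F = gen_field (E \<union> Z)" and t: "t \<in> F" "t \<notin> E"
  shows "\<exists>z\<in>Z. F = gen_field (insert t E \<union> (Z - {z}))"
proof -
  let ?P = "\<lambda>Y. Y \<subseteq> Z \<and> t \<notin> gen_field (E \<union> Y)"
  have "?P {}" using t gen_field_self[OF E] by simp
  moreover have "\<forall>Y. ?P Y \<longrightarrow> card Y < Suc (card Z)"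
    using Z(1) card_mono less_Suc_eq_le by metis
  ultimately obtain Y where Y: "?P Y" and max: "\<And>Y'. ?P Y' \<Longrightarrow> card Y' \<le> card Y"
    using ex_has_greatest_nat[of ?P "{}" card "Suc (card Z)"] by blast
  have "Y \<noteq> Z" using Y t gen by blast
  then obtain z where z: "z \<in> Z" "z \<notin> Y" using Y by blast
  have finY: "finite Y" using Y Z finite_subset by blast
  let ?L = "gen_field (E \<union> Y)"
  have EL: "E \<subseteq> ?L" using gen_field_superset[of "E \<union> Y"] by auto
  have "t \<in> gen_field (E \<union> insert z Y)"
  proof (rule ccontr)
    assume "t \<notin> gen_field (E \<union> insert z Y)"
    then have "card (insert z Y) \<le> card Y" using Y z by (intro max) auto
    then show False using z finY by simp
  qed
  then have "t \<in> gen_field (?L \<union> {z})" by (simp only: gen_field_adjoin)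
  moreover have "z ^ p \<in> ?L" using pE z Z EL by blast
  ultimately have "z \<in> gen_field (?L \<union> {t})"
    using p_exchange[OF p ac gen_field_subfield] Y by blast
  then have "z \<in> gen_field (E \<union> insert t Y)" by (simp only: gen_field_adjoin)
  moreover have "E \<union> insert t Y \<subseteq> insert t E \<union> (Z - {z})" using Y z by blast
  ultimately have zin: "z \<in> gen_field (insert t E \<union> (Z - {z}))" using gen_field_mono by blast
  have "gen_field (E \<union> Z) = gen_field (insert t E \<union> (Z - {z}))"
  proof (rule gen_field_eqI)
    show "E \<union> Z \<subseteq> gen_field (insert t E \<union> (Z - {z}))"
      using gen_field_superset[of "insert t E \<union> (Z - {z})"] zin by auto
    show "insert t E \<union> (Z - {z}) \<subseteq> gen_field (E \<union> Z)"
      using gen_field_superset[of "E \<union> Z"] t gen by auto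
  qed
  then show ?thesis using gen z by blast
qed

text \<open>A t outside E replaces a generator as it stands. For t in E the corrected element t +
  b^p z replaces z, since t and b^p lie in E. The abstract \<open>Q\<close> records what the
  correction must preserve.\<close>

lemma p_step:
  fixes E F Z :: "'a::field set"
  assumes p: "prime p" "(of_nat p :: 'a) = 0" and ac: "alg_closed_ty TYPE('a)"
    and F: "is_subfield F" and E: "is_subfield E" "E \<subseteq> F" and pE: "ppow p F \<subseteq> E"
    and Z: "finite Z" "Z \<subseteq> F" and gen: "F = gen_field (E \<union> Z)" and card: "card Z \<le> Suc n"
    and t: "t \<in> F" "Q t" "\<And>z. z \<in> F \<Longrightarrow> \<exists>b\<in>F. b \<noteq> 0 \<and> Q (t + b ^ p * z)"
  shows "\<exists>t'\<in>F. Q t' \<and> (\<exists>Z'\<subseteq>F. finite Z' \<and> card Z' \<le> n \<and> F = gen_field (insert t' E \<union> Z'))"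
proof (cases "t \<in> E")
  case False
  then obtain z where "z \<in> Z" "F = gen_field (insert t E \<union> (Z - {z}))"
    using p_step_exchange[OF p ac E(1) pE Z gen t(1)] by blast
  then show ?thesis
    using t Z card by (intro bexI[of _ t] conjI exI[of _ "Z - {z}"]) auto
next
  case True
  show ?thesis
  proof (cases "Z = {}")
    case True
    then have "F = gen_field (insert t E \<union> {})" using gen \<open>t \<in> E\<close> by (simp add: insert_absorb)
    then show ?thesis using t by (intro bexI[of _ t] conjI exI[of _ "{}"]) auto
  next
    case False
    then obtain z where z: "z \<in> Z" by blast
    then obtain b where b: "b \<in> F" "b \<noteq> 0" "Q (t + b ^ p * z)" using t Z by blast
    define t' where "t' = t + b ^ p * z"
    have bE: "b ^ p \<in> E" using b pE by blast
    have "t' \<in> F" 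
      unfolding t'_def using t(1) b(1) z Z(2)
      by (intro sf_add[OF F] sf_mult[OF F] sf_power[OF F]) auto
    have "gen_field (E \<union> Z) = gen_field (insert t' E \<union> (Z - {z}))"
    proof (rule gen_field_eqI)
      let ?G = "gen_field (insert t' E \<union> (Z - {z}))"
      have sub: "insert t' E \<union> (Z - {z}) \<subseteq> ?G" by (rule gen_field_superset)
      have "(t' - t) / b ^ p \<in> ?G"
        using sub True bE by (intro sf_divide[OF gen_field_subfield] sf_diff[OF gen_field_subfield]) auto
      moreover have "(t' - t) / b ^ p = z" using b by (simp add: t'_def)
      ultimately show "E \<union> Z \<subseteq> ?G" using sub by auto
      show "insert t' E \<union> (Z - {z}) \<subseteq> gen_field (E \<union> Z)"
        using gen_field_superset[of "E \<union> Z"] \<open>t' \<in> F\<close> gen by auto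
    qed
    then have "F = gen_field (insert t' E \<union> (Z - {z}))" using gen by simp
    then show ?thesis
      using b Z card z \<open>t' \<in> F\<close> by (intro bexI[of _ t'] conjI exI[of _ "Z - {z}"]) (auto simp: t'_def)
  qed
qed

text \<open>\<open>Q\<close> sees the elements chosen so far, which allows two uses: transcendence
  over the earlier elements, and, through the length of the list, a prescribed value and residue for
  each position.\<close>

lemma p_generators_choice:
  fixes E F Z :: "'a::field set"
  assumes p: "prime p" "(of_nat p :: 'a) = 0" and ac: "alg_closed_ty TYPE('a)"
    and F: "is_subfield F" and E: "E \<subseteq> F" and pE: "ppow p F \<subseteq> E"
    and Z: "finite Z" "Z \<subseteq> F" and gen: "F = gen_field (E \<union> Z)" and card: "card Z \<le> n"
    and choice: "\<And>ts. length ts < n \<Longrightarrow> set ts \<subseteq> F \<Longrightarrow>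
      \<exists>t\<in>F. Q ts t \<and> (\<forall>z\<in>F. \<exists>b\<in>F. b \<noteq> 0 \<and> Q ts (t + b ^ p * z))"
  shows "\<exists>ts. length ts = n \<and> set ts \<subseteq> F \<and> F = gen_field (E \<union> set ts) \<and> (\<forall>i<n. Q (take i ts) (ts ! i))"
proof -
  \<comment> \<open>Each choice consumes one of the at most n generators in reserve, so for k = n
    the set Z is empty and the chosen elements suffice.\<close>
  have "\<exists>ts Z. length ts = k \<and> set ts \<subseteq> F \<and> finite Z \<and> Z \<subseteq> F \<and> card Z \<le> n - k \<and>
      F = gen_field (E \<union> set ts \<union> Z) \<and> (\<forall>i<k. Q (take i ts) (ts ! i))" if "k \<le> n" for k
    using that
  proof (induction k)
    case 0
    then show ?case using Z gen card by (intro exI[of _ "[]"] exI[of _ Z]) auto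
  next
    case (Suc k)
    then obtain ts Z where ts: "length ts = k" "set ts \<subseteq> F" "\<forall>i<k. Q (take i ts) (ts ! i)"
      and Z: "finite Z" "Z \<subseteq> F" "card Z \<le> Suc (n - Suc k)" "F = gen_field (E \<union> set ts \<union> Z)"
      by (metis Suc_diff_le Suc_leD diff_Suc_Suc)
    obtain t where t: "t \<in> F" "Q ts t" "\<forall>z\<in>F. \<exists>b\<in>F. b \<noteq> 0 \<and> Q ts (t + b ^ p * z)"
      using choice[of ts] ts Suc.prems by auto
    let ?L = "gen_field (E \<union> set ts)"
    have "?L \<subseteq> F" using E ts by (intro gen_field_least[OF F]) auto
    moreover have "ppow p F \<subseteq> ?L" using pE gen_field_superset[of "E \<union> set ts"] by blast
    moreover have "F = gen_field (?L \<union> Z)" using Z(4) by (simp only: gen_field_Un_gen_field)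
    ultimately obtain t' Z' where t': "t' \<in> F" "Q ts t'" and Z': "Z' \<subseteq> F" "finite Z'"
        "card Z' \<le> n - Suc k" "F = gen_field (insert t' ?L \<union> Z')"
      using p_step[OF p ac F gen_field_subfield _ _ Z(1,2) _ Z(3) t(1), of "E \<union> set ts" "Q ts"] t by blast
    have "insert t' ?L \<union> Z' = ?L \<union> insert t' Z'" by blast
    then have "F = gen_field (?L \<union> insert t' Z')" using Z'(4) by simp
    also have "\<dots> = gen_field (E \<union> set ts \<union> insert t' Z')" by (rule gen_field_Un_gen_field)
    also have "E \<union> set ts \<union> insert t' Z' = E \<union> set (ts @ [t']) \<union> Z'" by auto
    finally have "F = gen_field (E \<union> set (ts @ [t']) \<union> Z')" .
    moreover have "Q (take i (ts @ [t'])) ((ts @ [t']) ! i)" if "i < Suc k" for i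
      using that ts t' by (cases "i = k") (auto simp: nth_append)
    ultimately show ?case
      using ts t' Z' by (intro exI[of _ "ts @ [t']"] exI[of _ Z']) auto
  qed
  from this[of n] obtain ts Z where "length ts = n" "set ts \<subseteq> F" "finite Z" "card Z \<le> 0"
      "F = gen_field (E \<union> set ts \<union> Z)" "\<forall>i<n. Q (take i ts) (ts ! i)"
    by auto
  then show ?thesis by (intro exI[of _ ts]) auto
qed

section \<open>Finiteness and separability over a transcendence basis\<close>

lemma fin_gen_extE:
  assumes "fin_gen_ext K F"
  obtains S where "finite S" "F = gen_field (K \<union> S)" "S \<subseteq> F" "K \<subseteq> F"
proof -
  obtain S where "finite S" "F = gen_field (K \<union> S)" using assms unfolding fin_gen_ext_def by blast
  then show ?thesis using gen_field_superset[of "K \<union> S"] by (intro that) auto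
qed

lemma fin_ext_over_transc_basis:
  assumes fg: "fin_gen_ext K F" and T: "transc_basis K F T"
  shows "fin_ext (gen_field (K \<union> T)) F"
proof -
  obtain S where S: "finite S" "F = gen_field (K \<union> S)" "S \<subseteq> F" "K \<subseteq> F" by (rule fin_gen_extE[OF fg])
  let ?E = "gen_field (K \<union> T)"
  have TF: "T \<subseteq> F" using T unfolding transc_basis_def by blast
  have F: "is_subfield F" using S gen_field_subfield by blast
  have "gen_field (?E \<union> S) = F"
  proof
    show "gen_field (?E \<union> S) \<subseteq> F"
      using S TF gen_field_least[OF F, of "K \<union> T"] by (intro gen_field_least[OF F]) auto
    show "F \<subseteq> gen_field (?E \<union> S)"
      unfolding S(2) using gen_field_superset[of "K \<union> T"] by (intro gen_field_mono) auto
  qed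
  moreover have "fin_ext ?E (gen_field (?E \<union> S))"
    using T S unfolding transc_basis_def by (intro fin_ext_gen_field gen_field_subfield) auto
  ultimately show ?thesis by simp
qed

text \<open>The bridge from the exchange argument, which produces generators over K F^p, to
  separability over K(T).\<close>

lemma separable_over_transc_basis:
  fixes K F T :: "'a::field set"
  assumes fg: "fin_gen_ext K F" and T: "transc_basis K F T"
    and gen: "\<And>p. prime p \<Longrightarrow> (of_nat p :: 'a) = 0 \<Longrightarrow> F = gen_field (K \<union> ppow p F \<union> T)"
  shows "separable_ext (gen_field (K \<union> T)) F"
proof (rule separable_extI)
  show "is_subfield F" using fg gen_field_subfield unfolding fin_gen_ext_def by blast
  show "fin_ext (gen_field (K \<union> T)) F" by (rule fin_ext_over_transc_basis[OF fg T])
  fix p assume "prime p" "(of_nat p :: 'a) = 0"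
  then have "F = gen_field (K \<union> ppow p F \<union> T)" by (rule gen)
  also have "\<dots> = gen_field (K \<union> T \<union> ppow p F)" by (simp add: Un_ac)
  also have "\<dots> = gen_field (gen_field (K \<union> T) \<union> ppow p F)" by (simp only: gen_field_Un_gen_field)
  finally show "F = gen_field (gen_field (K \<union> T) \<union> ppow p F)" .
qed (rule gen_field_subfield)

lemma p_generators:
  fixes K F :: "'a::field set"
  assumes p: "prime p" "(of_nat p :: 'a) = 0" and ac: "alg_closed_ty TYPE('a)"
    and K: "is_subfield K" and fg: "fin_gen_ext K F" and sep: "separable_ext K F" and n: "has_trdeg K F n"
  shows "\<exists>Z\<subseteq>F. finite Z \<and> card Z \<le> n \<and> F = gen_field (gen_field (K \<union> ppow p F) \<union> Z)"
proof -
  obtain S where S: "finite S" "F = gen_field (K \<union> S)" "S \<subseteq> F" "K \<subseteq> F" by (rule fin_gen_extE[OF fg])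
  obtain Z where Z: "Z \<subseteq> S" "alg_indep K Z" "F = gen_field (K \<union> ppow p F \<union> Z)"
    using p_generators_alg_indep[OF p ac K S(1,2) sep] by blast
  have "finite Z" using Z S finite_subset by blast
  then show ?thesis
    using Z S has_trdegD(1)[OF K n _ _ Z(2)] gen_field_Un_gen_field[of "K \<union> ppow p F" Z]
    by (intro exI[of _ Z]) auto
qed

text \<open>If a + z and a + z^(p+1) were both algebraic, so would be z^(p+1) - z, hence z, being a
  root of X^(p+1) - X - (z^(p+1) - z), and then a itself. So b = 1 or b = z works.\<close>

lemma acl_perturb:
  assumes a: "a \<notin> acl K A" and p: "0 < p"
  shows "\<exists>b\<in>{1, z}. b \<noteq> 0 \<and> a + b ^ p * z \<notin> acl K A"
proof (rule ccontr)
  assume neg: "\<not> ?thesis"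
  note A = acl_subfield[of K A]
  have 1: "a + z \<in> acl K A" using neg by auto
  have "z \<notin> acl K A"
    using sf_diff[OF A 1] a by fastforce
  then have "z \<noteq> 0" using sf_0[OF A] by blast
  then have "a + z ^ p * z \<in> acl K A" using neg by auto
  then have "(a + z ^ p * z) - (a + z) \<in> acl K A" using sf_diff[OF A _ 1] by blast
  then have c: "z ^ p * z - z \<in> acl K A" by simp
  define f where "f = monom 1 (Suc p) - [:z ^ p * z - z, 1:]"
  have "coeff f (Suc p) = 1" using p by (simp add: f_def coeff_pCons split: nat.splits)
  then have "f \<noteq> 0" by auto
  moreover have "poly_over (acl K A) f"
    unfolding f_def using c subfield_subring[OF A]
    by (intro poly_over_diff poly_over_monom) (auto simp: poly_over_pCons poly_over_0 sf_1[OF A])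
  moreover have "poly f z = 0" by (simp add: f_def poly_monom)
  ultimately have "algebraic_over (acl K A) z" unfolding algebraic_over_iff by blast
  then have "z \<in> acl K A"
    using algebraic_over_trans[OF gen_field_subfield, of "acl K A" "K \<union> A" z] unfolding acl_def by blast
  then show False using \<open>z \<notin> acl K A\<close> by blast
qed

lemma alg_indep_list:
  fixes K :: "'a::field set"
  assumes K: "is_subfield K" and ts: "\<forall>i<length ts. ts ! i \<notin> acl K (set (take i ts))"
  shows "alg_indep K (set ts) \<and> distinct ts"
  using ts
proof (induction ts rule: rev_induct)
  case Nil
  have "alg_indep K {}"
  proof (rule alg_indep_finiteI)
    fix M c assume M: "finite M" "M \<noteq> {}" "M \<subseteq> exps {}" "\<forall>m\<in>M. c m \<in> K \<and> c m \<noteq> 0"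
      "(\<Sum>m\<in>M. c m * mon {} m) = 0"
    have "exps {} = {\<lambda>_ :: 'a. 0}" by (auto simp: exps_def)
    then have "M = {\<lambda>_. 0}" using M(2,3) by (metis subset_singletonD)
    then show False using M by (simp add: mon_def)
  qed simp
  then show ?case by simp
next
  case (snoc t ts)
  have "ts ! i \<notin> acl K (set (take i ts))" if "i < length ts" for i
    using snoc.prems[rule_format, of i] that by (simp add: nth_append)
  then have IH: "alg_indep K (set ts)" "distinct ts" using snoc.IH by auto
  have "t \<notin> acl K (set ts)" using snoc.prems[rule_format, of "length ts"] by simp
  then show ?case
    using IH alg_indep_insert[OF K IH(1)] acl_superset[of "set ts" K] by auto
qed

text \<open>Serves F|K when the valuation is trivial and Fv|Kv in the second part. Separability is
  delivered as generation over K F^p, the form that \<open>separable_over_transc_basis\<close> uses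
  and that can be carried along the residue map.\<close>

lemma separating_transc_basis:
  fixes K F :: "'a::field set"
  assumes ac: "alg_closed_ty TYPE('a)"
    and K: "is_subfield K" and fg: "fin_gen_ext K F" and sep: "separable_ext K F" and n: "has_trdeg K F n"
  shows "\<exists>T. transc_basis K F T \<and> finite T \<and> card T = n \<and>
    (\<forall>p. prime p \<and> (of_nat p :: 'a) = 0 \<longrightarrow> F = gen_field (K \<union> ppow p F \<union> T))"
proof (cases "\<exists>p. prime p \<and> (of_nat p :: 'a) = 0")
  case False
  then show ?thesis using n unfolding has_trdeg_def by blast
next
  case True
  then obtain p where p: "prime p" "(of_nat p :: 'a) = 0" by blast
  have F: "is_subfield F" using fg gen_field_subfield unfolding fin_gen_ext_def by blast
  have KF: "K \<subseteq> F" using fg by (rule fin_gen_extE)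
  let ?E = "gen_field (K \<union> ppow p F)"
  have E: "?E \<subseteq> F" using KF sf_power[OF F] by (intro gen_field_least[OF F]) auto
  have pE: "ppow p F \<subseteq> ?E" using gen_field_superset[of "K \<union> ppow p F"] by auto
  obtain Z where Z: "Z \<subseteq> F" "finite Z" "card Z \<le> n" "F = gen_field (?E \<union> Z)"
    using p_generators[OF p ac K fg sep n] by blast
  have "\<exists>t\<in>F. t \<notin> acl K (set ts) \<and> (\<forall>z\<in>F. \<exists>b\<in>F. b \<noteq> 0 \<and> t + b ^ p * z \<notin> acl K (set ts))"
    if "length ts < n" for ts
  proof -
    have "card (set ts) < n" using that card_length[of ts] by linarith
    then obtain t where t: "t \<in> F" "t \<notin> acl K (set ts)" using has_trdegD(2)[OF K n] by blast
    have "\<exists>b\<in>F. b \<noteq> 0 \<and> t + b ^ p * z \<notin> acl K (set ts)" if "z \<in> F" for z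
      using acl_perturb[OF t(2) prime_gt_0_nat[OF p(1)], of z] that sf_1[OF F] by blast
    then show ?thesis using t by blast
  qed
  then obtain ts where ts: "length ts = n" "set ts \<subseteq> F" "F = gen_field (?E \<union> set ts)"
      "\<forall>i<n. ts ! i \<notin> acl K (set (take i ts))"
    using p_generators_choice[OF p ac F E pE Z(2,1,4,3), of "\<lambda>ts t. t \<notin> acl K (set ts)"] by blast
  have ind: "alg_indep K (set ts)" "distinct ts" using alg_indep_list[OF K] ts by blast+
  have "transc_basis K F (set ts)"
    using ind ts distinct_card[of ts] by (intro has_trdegD(3)[OF K n]) auto
  moreover have "F = gen_field (K \<union> ppow q F \<union> set ts)" if "prime q" "(of_nat q :: 'a) = 0" for q
  proof -
    have "q = p" using prime_char_eq[OF that] prime_char_eq[OF p] by simp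
    then show ?thesis using ts(3) gen_field_Un_gen_field[of "K \<union> ppow p F" "set ts"] by simp
  qed
  ultimately show ?thesis
    using ind ts distinct_card[of ts] by (intro exI[of _ "set ts"]) auto
qed

section \<open>Integer multiples\<close>

lemma zsmul_0 [simp]: "zsmul 0 g = 0"
  by (simp add: zsmul_def)

lemma zsmul_of_nat: "zsmul (int n) g = nsmul n g"
  by (simp add: zsmul_def)

lemma zsmul_uminus: "zsmul (- n) g = - zsmul n g"
  by (cases "n = 0") (auto simp: zsmul_def)

lemma zsmul_plus1: "zsmul (n + 1) g = g + zsmul n g"
proof (cases "0 \<le> n")
  case True
  then show ?thesis by (simp add: zsmul_def nat_add_distrib)
next
  case False
  define k where "k = nat (- n - 1)"
  have k: "n = - int (Suc k)" "n + 1 = - int k" using False by (auto simp: k_def)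
  have "zsmul (n + 1) g = - nsmul k g" unfolding k(2) by (simp only: zsmul_uminus zsmul_of_nat)
  moreover have "zsmul n g = - nsmul (Suc k) g" unfolding k(1) by (simp only: zsmul_uminus zsmul_of_nat)
  ultimately show ?thesis by simp
qed

lemma zsmul_add: "zsmul (m + n) g = zsmul m g + zsmul n g"
proof (induction m rule: int_induct[where k = 0])
  case (step1 i)
  have "zsmul (i + 1 + n) g = zsmul (i + n + 1) g" by (simp add: algebra_simps)
  also have "\<dots> = g + (zsmul i g + zsmul n g)" by (simp only: zsmul_plus1 step1)
  also have "\<dots> = zsmul (i + 1) g + zsmul n g" by (simp only: zsmul_plus1 add.assoc)
  finally show ?case .
next
  case (step2 i)
  have "g + zsmul (i - 1 + n) g = zsmul (i + n) g" "g + zsmul (i - 1) g = zsmul i g"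
    using zsmul_plus1[of "i - 1 + n" g] zsmul_plus1[of "i - 1" g] by (simp_all add: algebra_simps)
  then have "g + zsmul (i - 1 + n) g = g + zsmul (i - 1) g + zsmul n g"
    using step2 by simp
  then show ?case by (simp add: add.assoc)
qed simp

lemma zsmul_1 [simp]: "zsmul 1 g = g"
  using zsmul_plus1[of 0 g] by simp

lemma zsmul_diff: "zsmul (m - n) g = zsmul m g - zsmul n g"
  using zsmul_add[of m "- n" g] zsmul_uminus[of n g] by simp

lemma nsmul_add_right: "nsmul n (g + h) = nsmul n g + nsmul n h"
  by (induction n) (auto simp: algebra_simps)

lemma zsmul_add_right: "zsmul n (g + h) = zsmul n g + zsmul n h"
  by (auto simp: zsmul_def nsmul_add_right)

lemma zsmul_zero_right [simp]: "zsmul n 0 = 0"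
  using zsmul_add_right[of n 0 0] by simp

lemma zsmul_sum_right: "zsmul n (\<Sum>i\<in>I. f i) = (\<Sum>i\<in>I. zsmul n (f i))"
  by (induction I rule: infinite_finite_induct) (auto simp: zsmul_add_right)

lemma zsmul_sum_left: "zsmul (\<Sum>i\<in>I. f i) g = (\<Sum>i\<in>I. zsmul (f i) g)"
  by (induction I rule: infinite_finite_induct) (auto simp: zsmul_add)

lemma zsmul_mult: "zsmul (m * n) g = zsmul m (zsmul n g)"
proof (induction m rule: int_induct[where k = 0])
  case (step1 i)
  then show ?case by (simp add: zsmul_plus1 zsmul_add algebra_simps)
next
  case (step2 i)
  then show ?case by (simp add: zsmul_diff left_diff_distrib)
qed simp

definition subgroup_of :: "'g::ab_group_add set \<Rightarrow> bool" where
  "subgroup_of H \<longleftrightarrow> 0 \<in> H \<and> (\<forall>a\<in>H. \<forall>b\<in>H. a + b \<in> H) \<and> (\<forall>a\<in>H. - a \<in> H)"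

lemma sg_0: "subgroup_of H \<Longrightarrow> 0 \<in> H"
  and sg_add: "subgroup_of H \<Longrightarrow> a \<in> H \<Longrightarrow> b \<in> H \<Longrightarrow> a + b \<in> H"
  and sg_uminus: "subgroup_of H \<Longrightarrow> a \<in> H \<Longrightarrow> - a \<in> H"
  unfolding subgroup_of_def by blast+

lemma sg_diff: "subgroup_of H \<Longrightarrow> a \<in> H \<Longrightarrow> b \<in> H \<Longrightarrow> a - b \<in> H"
  using sg_add[of H a "- b"] sg_uminus[of H b] by simp

lemma sg_zsmul: "subgroup_of H \<Longrightarrow> a \<in> H \<Longrightarrow> zsmul n a \<in> H"
proof (induction n rule: int_induct[where k = 0])
  case (step1 i)
  then show ?case by (simp add: zsmul_plus1 sg_add)
next
  case (step2 i)
  then show ?case by (simp add: zsmul_diff sg_diff)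
qed (simp add: sg_0)

lemma sg_sum: "subgroup_of H \<Longrightarrow> (\<And>i. i \<in> I \<Longrightarrow> f i \<in> H) \<Longrightarrow> sum f I \<in> H"
  by (induction I rule: infinite_finite_induct) (auto intro: sg_add sg_0)

section \<open>Valued fields\<close>

text \<open>Nothing is assumed about \<open>v 0\<close>, about \<open>v\<close> outside F or about
  \<open>res\<close> outside the valuation ring, which explains the membership and nonzero
  conditions throughout.\<close>

locale valued_field =
  fixes F :: "'a::field set" and v :: "'a \<Rightarrow> 'g::linordered_ab_group_add" and res :: "'a \<Rightarrow> 'b::field"
  assumes F: "is_subfield F" and val: "valuation F v" and resmap: "residue_map F v res"
begin

text \<open>The maximal ideal of the valuation ring.\<close>

definition mx :: "'a set" where
  "mx = {x\<in>F. x = 0 \<or> 0 < v x}"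

abbreviation "vring \<equiv> val_ring F v"

lemma v_mult: "x \<in> F \<Longrightarrow> y \<in> F \<Longrightarrow> x \<noteq> 0 \<Longrightarrow> y \<noteq> 0 \<Longrightarrow> v (x * y) = v x + v y"
  and v_add: "x \<in> F \<Longrightarrow> y \<in> F \<Longrightarrow> x \<noteq> 0 \<Longrightarrow> y \<noteq> 0 \<Longrightarrow> x + y \<noteq> 0 \<Longrightarrow> min (v x) (v y) \<le> v (x + y)"
  using val unfolding valuation_def by blast+

lemma v_1: "v 1 = 0"
  using v_mult[of 1 1] sf_1[OF F] by simp

lemma v_inverse: "x \<in> F \<Longrightarrow> x \<noteq> 0 \<Longrightarrow> v (inverse x) = - v x"
  using v_mult[of x "inverse x"] sf_inverse[OF F, of x] v_1 by (simp add: eq_neg_iff_add_eq_0 add.commute)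

lemma v_divide: "x \<in> F \<Longrightarrow> y \<in> F \<Longrightarrow> x \<noteq> 0 \<Longrightarrow> y \<noteq> 0 \<Longrightarrow> v (x / y) = v x - v y"
  using v_mult[of x "inverse y"] v_inverse[of y] sf_inverse[OF F, of y] by (simp add: divide_inverse)

lemma v_uminus_1: "v (- 1) = 0"
proof -
  have "v (- 1) + v (- 1) = 0"
    using v_mult[of "- 1" "- 1"] sf_uminus[OF F sf_1[OF F]] v_1 by simp
  then show ?thesis by (simp add: double_zero)
qed

lemma v_uminus: "x \<in> F \<Longrightarrow> x \<noteq> 0 \<Longrightarrow> v (- x) = v x"
  using v_mult[of "- 1" x] v_uminus_1 sf_uminus[OF F sf_1[OF F]] by simp

lemma v_power: "x \<in> F \<Longrightarrow> x \<noteq> 0 \<Longrightarrow> v (x ^ n) = zsmul (int n) (v x)"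
proof (induction n)
  case (Suc n)
  then have "v (x ^ Suc n) = v x + v (x ^ n)" using v_mult[of x "x ^ n"] sf_power[OF F] by simp
  moreover have "v (x ^ n) = nsmul n (v x)" using Suc by (simp add: zsmul_of_nat)
  ultimately show ?case by (simp only: zsmul_of_nat nsmul.simps)
qed (simp add: v_1)

lemma vringI: "x \<in> F \<Longrightarrow> (x \<noteq> 0 \<Longrightarrow> 0 \<le> v x) \<Longrightarrow> x \<in> vring"
  unfolding val_ring_def by blast

lemma vringD: "x \<in> vring \<Longrightarrow> x \<in> F" "x \<in> vring \<Longrightarrow> x \<noteq> 0 \<Longrightarrow> 0 \<le> v x"
  unfolding val_ring_def by blast+

lemma vring_subring: "is_subring vring"
  unfolding is_subring_def
proof (intro conjI ballI)
  show "1 \<in> vring" using sf_1[OF F] v_1 by (intro vringI) auto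
  fix x y assume x: "x \<in> vring" and y: "y \<in> vring"
  show "x + y \<in> vring"
  proof (rule vringI)
    show "x + y \<in> F" using x y vringD sf_add[OF F] by blast
    show "0 \<le> v (x + y)" if "x + y \<noteq> 0"
    proof (cases "x = 0 \<or> y = 0")
      case True
      then show ?thesis using x y that vringD(2) by auto
    next
      case False
      then have "min (v x) (v y) \<le> v (x + y)" using x y that vringD(1) by (intro v_add) auto
      moreover have "0 \<le> v x" "0 \<le> v y" using x y False vringD(2) by auto
      ultimately show ?thesis by (meson min.boundedI order_trans)
    qed
  qed
  show "x * y \<in> vring"
  proof (rule vringI)
    show "x * y \<in> F" using x y vringD sf_mult[OF F] by blast
    show "0 \<le> v (x * y)" if "x * y \<noteq> 0"
      using that x y vringD[of x] vringD[of y] v_mult[of x y] by simp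
  qed
next
  fix x assume "x \<in> vring"
  then show "- x \<in> vring"
    using vringD[of x] v_uminus[of x] sf_uminus[OF F] by (intro vringI) auto
qed

lemma mx_vring: "mx \<subseteq> vring"
  unfolding mx_def val_ring_def by auto

lemma res_1: "res 1 = 1"
  and res_add: "x \<in> vring \<Longrightarrow> y \<in> vring \<Longrightarrow> res (x + y) = res x + res y"
  and res_mult: "x \<in> vring \<Longrightarrow> y \<in> vring \<Longrightarrow> res (x * y) = res x * res y"
  and res_eq_0: "x \<in> vring \<Longrightarrow> res x = 0 \<longleftrightarrow> x = 0 \<or> 0 < v x"
  using resmap unfolding residue_map_def by blast+

lemma res_0: "res 0 = 0"
  using res_eq_0[OF sr_0[OF vring_subring]] by simp

lemma res_uminus: "x \<in> vring \<Longrightarrow> res (- x) = - res x"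
  using res_add[of x "- x"] sr_uminus[OF vring_subring, of x] res_0 by (simp add: eq_neg_iff_add_eq_0 add.commute)

lemma res_sum: "(\<And>i. i \<in> I \<Longrightarrow> f i \<in> vring) \<Longrightarrow> res (sum f I) = (\<Sum>i\<in>I. res (f i))"
  by (induction I rule: infinite_finite_induct)
    (auto simp: res_0 res_add sr_sum[OF vring_subring])

lemma res_power: "x \<in> vring \<Longrightarrow> res (x ^ n) = res x ^ n"
  by (induction n) (auto simp: res_1 res_mult sr_power[OF vring_subring])

lemma mx_iff: "x \<in> mx \<longleftrightarrow> x \<in> vring \<and> res x = 0"
  using res_eq_0[of x] mx_vring unfolding mx_def val_ring_def by auto

lemma mx_sum: "(\<And>i. i \<in> I \<Longrightarrow> f i \<in> mx) \<Longrightarrow> sum f I \<in> mx"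
  using res_sum[of I f] sr_sum[OF vring_subring, of I f] by (simp add: mx_iff)

text \<open>The unit group of the valuation ring, equivalently its elements of nonzero residue
  (\<open>U_iff\<close>).\<close>

definition U :: "'a set" where
  "U = {x\<in>F. x \<noteq> 0 \<and> v x = 0}"

lemma U_iff: "x \<in> U \<longleftrightarrow> x \<in> vring \<and> res x \<noteq> 0"
  using res_eq_0[of x] unfolding U_def val_ring_def by auto

lemma U_inverse: "x \<in> U \<Longrightarrow> inverse x \<in> U \<and> res (inverse x) = inverse (res x)"
proof -
  assume x: "x \<in> U"
  then have i: "inverse x \<in> U" using v_inverse[of x] sf_inverse[OF F] unfolding U_def by auto
  have "res x * res (inverse x) = res (x * inverse x)"
    using x i by (simp add: U_iff res_mult)
  also have "x * inverse x = 1" using x by (simp add: U_def)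
  finally have "res x * res (inverse x) = 1" by (simp add: res_1)
  then show ?thesis using i inverse_unique by metis
qed

lemma U_divide: "x \<in> U \<Longrightarrow> y \<in> U \<Longrightarrow> x / y \<in> U \<and> res (x / y) = res x / res y"
proof -
  assume x: "x \<in> U" and y: "y \<in> U"
  have "x / y \<in> U" using x y v_divide[of x y] sf_divide[OF F] unfolding U_def by auto
  then show ?thesis
    using U_inverse[OF y] x res_mult[of x "inverse y"] by (simp add: U_iff divide_inverse)
qed

lemma one_plus_mx: "e \<in> mx \<Longrightarrow> 1 + e \<in> U \<and> res (1 + e) = 1"
proof -
  assume e: "e \<in> mx"
  have 1: "1 \<in> vring" using sr_1[OF vring_subring] .
  have "res (1 + e) = 1" using res_add[OF 1] e mx_iff res_1 by auto
  moreover have "1 + e \<in> vring" using sr_add[OF vring_subring 1] e mx_iff by blast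
  ultimately show ?thesis by (simp add: U_iff)
qed

text \<open>The quotient (a + e)/a is 1 plus an element of the maximal ideal, so it has value 0 and
  residue 1.\<close>

lemma v_add_small:
  assumes a: "a \<in> F" "a \<noteq> 0" and e: "e \<in> F" "e \<noteq> 0 \<Longrightarrow> v a < v e"
  shows "a + e \<noteq> 0" "v (a + e) = v a" "v a = 0 \<Longrightarrow> res (a + e) = res a"
proof -
  have "e / a \<in> mx"
  proof (cases "e = 0")
    case False
    then have "0 < v (e / a)" using v_divide[OF e(1) a(1)] a(2) e(2) by simp
    then show ?thesis using sf_divide[OF F e(1) a(1)] by (simp add: mx_def)
  qed (simp add: mx_def sf_0[OF F])
  then have u: "1 + e / a \<in> U" "res (1 + e / a) = 1" using one_plus_mx by auto
  have eq: "a + e = a * (1 + e / a)" using a by (simp add: field_simps)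
  then show "a + e \<noteq> 0" "v (a + e) = v a" using u a v_mult[of a "1 + e / a"] by (auto simp: U_def)
  show "res (a + e) = res a" if "v a = 0"
    using that u a eq res_mult[of a "1 + e / a"] U_iff vringI[of a] by simp
qed

text \<open>After factoring out the term of least value, the other terms lie in the maximal ideal.
  The factor \<open>u\<close> of residue 1 gives nonvanishing, value and residue of the sum at
  once.\<close>

lemma sum_distinct_values:
  assumes I: "finite I" "I \<noteq> {}" and a: "\<And>i. i \<in> I \<Longrightarrow> a i \<in> F" "\<And>i. i \<in> I \<Longrightarrow> a i \<noteq> 0"
    and inj: "inj_on (\<lambda>i. v (a i)) I"
  shows "\<exists>i\<in>I. \<exists>u\<in>U. res u = 1 \<and> (\<Sum>i\<in>I. a i) = a i * u"
proof -
  let ?m = "Min ((\<lambda>i. v (a i)) ` I)"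
  have "?m \<in> (\<lambda>i. v (a i)) ` I" using I by (intro Min_in) auto
  then obtain i where i: "i \<in> I" "v (a i) = ?m" by auto
  have min: "v (a i) < v (a j)" if "j \<in> I" "j \<noteq> i" for j
  proof -
    have "v (a i) \<le> v (a j)" using that I i by simp
    moreover have "v (a i) \<noteq> v (a j)" using inj that i unfolding inj_on_def by metis
    ultimately show ?thesis by simp
  qed
  define e where "e = (\<Sum>j\<in>I - {i}. a j / a i)"
  have "e \<in> mx"
    unfolding e_def
  proof (rule mx_sum)
    fix j assume "j \<in> I - {i}"
    then show "a j / a i \<in> mx"
      using a[of j] a[of i] i min[of j] v_divide[of "a j" "a i"] sf_divide[OF F] by (auto simp: mx_def)
  qed
  moreover have "(\<Sum>i\<in>I. a i) = a i * (1 + e)"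
    using I i a(2)[of i] by (simp add: e_def sum.remove[of I i] distrib_left sum_distrib_left)
  ultimately show ?thesis using one_plus_mx i by blast
qed

text \<open>Dividing by a coefficient of least value makes all coefficients integral and one of them
  1, so passing to residues keeps a nontrivial relation.\<close>

lemma dominant_coefficient:
  assumes I: "finite I" and c: "\<And>i. i \<in> I \<Longrightarrow> c i \<in> F" and nz: "\<exists>i\<in>I. c i \<noteq> 0"
  shows "\<exists>k\<in>I. c k \<noteq> 0 \<and> (\<forall>i\<in>I. c i / c k \<in> vring)"
proof -
  let ?J = "{i\<in>I. c i \<noteq> 0}"
  let ?m = "Min ((\<lambda>i. v (c i)) ` ?J)"
  have "?m \<in> (\<lambda>i. v (c i)) ` ?J" using I nz by (intro Min_in) auto
  then obtain k where k: "k \<in> ?J" "v (c k) = ?m" by auto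
  have "c i / c k \<in> vring" if i: "i \<in> I" for i
  proof (rule vringI)
    show "c i / c k \<in> F" using i k c sf_divide[OF F] by auto
    assume "c i / c k \<noteq> 0"
    then have ci: "c i \<noteq> 0" by auto
    then have "v (c k) \<le> v (c i)" using i k I by simp
    then show "0 \<le> v (c i / c k)" using v_divide[of "c i" "c k"] c i k ci by simp
  qed
  then show ?thesis using k by blast
qed

section \<open>Value groups and residue fields of subfields and of simple transcendental
  extensions\<close>

lemma vgroup_subgroup:
  assumes E: "is_subfield E" "E \<subseteq> F"
  shows "subgroup_of (vgroup v E)"
  unfolding subgroup_of_def vgroup_def
proof (intro conjI ballI)
  show "0 \<in> v ` (E - {0})" using sf_1[OF E(1)] v_1 by (intro image_eqI[of _ _ 1]) auto
  fix a assume "a \<in> v ` (E - {0})"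
  then obtain x where x: "x \<in> E" "x \<noteq> 0" "a = v x" by auto
  then show "- a \<in> v ` (E - {0})"
    using v_inverse[of x] subsetD[OF E(2)] sf_inverse[OF E(1)] by (intro image_eqI[of _ _ "inverse x"]) auto
  fix b assume "b \<in> v ` (E - {0})"
  then obtain y where y: "y \<in> E" "y \<noteq> 0" "b = v y" by auto
  then show "a + b \<in> v ` (E - {0})"
    using x v_mult[of x y] subsetD[OF E(2)] sf_mult[OF E(1)] by (intro image_eqI[of _ _ "x * y"]) auto
qed

lemma vgroupI: "x \<in> E \<Longrightarrow> x \<noteq> 0 \<Longrightarrow> v x \<in> vgroup v E"
  unfolding vgroup_def by blast

lemma resfieldI: "x \<in> E \<Longrightarrow> x \<in> vring \<Longrightarrow> res x \<in> resfield v res E"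
  unfolding resfield_def val_ring_def by blast

lemma resfieldE:
  assumes "a \<in> resfield v res E" "E \<subseteq> F"
  obtains x where "x \<in> E" "x \<in> vring" "a = res x"
  using assms unfolding resfield_def val_ring_def by blast

lemma resfield_mono: "E \<subseteq> L \<Longrightarrow> resfield v res E \<subseteq> resfield v res L"
  unfolding resfield_def val_ring_def by blast

lemma resfield_subfield:
  assumes E: "is_subfield E" "E \<subseteq> F"
  shows "is_subfield (resfield v res E)" (is "is_subfield ?R")
proof (rule subfieldI)
  note e = resfieldE[OF _ E(2)]
  show "is_subring ?R"
    unfolding is_subring_def
  proof (intro conjI ballI)
    show "1 \<in> ?R" using resfieldI[OF sf_1[OF E(1)] sr_1[OF vring_subring]] res_1 by simp
    fix a assume "a \<in> ?R"
    then obtain x where x: "x \<in> E" "x \<in> vring" "a = res x" by (rule e)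
    then show "- a \<in> ?R"
      using resfieldI[OF sf_uminus[OF E(1)] sr_uminus[OF vring_subring]] res_uminus by metis
    fix b assume "b \<in> ?R"
    then obtain y where y: "y \<in> E" "y \<in> vring" "b = res y" by (rule e)
    show "a + b \<in> ?R" "a * b \<in> ?R"
      using x y resfieldI[OF sf_add[OF E(1) x(1) y(1)] sr_add[OF vring_subring x(2) y(2)]]
        resfieldI[OF sf_mult[OF E(1) x(1) y(1)] sr_mult[OF vring_subring x(2) y(2)]] res_add res_mult
      by auto
  qed
  fix a assume a: "a \<in> ?R" "a \<noteq> 0"
  then obtain x where x: "x \<in> E" "x \<in> vring" "a = res x" using e by blast
  then have "x \<in> U" using a U_iff by blast
  then show "inverse a \<in> ?R"
    using U_inverse resfieldI[OF sf_inverse[OF E(1) x(1)]] x U_iff by metis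
qed

text \<open>The monomials have pairwise distinct values, so the one of least value dominates.\<close>

lemma x_poly_value:
  assumes E: "is_subfield E" "E \<subseteq> F" and x: "x \<in> F" "x \<noteq> 0"
    and ind: "\<forall>n. zsmul n (v x) \<in> vgroup v E \<longrightarrow> n = 0"
    and p: "poly_over E p" "p \<noteq> 0"
  shows "\<exists>c\<in>E. c \<noteq> 0 \<and> (\<exists>k. \<exists>u\<in>U. res u = 1 \<and> poly p x = c * x ^ k * u)"
proof -
  let ?I = "{i. i \<le> degree p \<and> coeff p i \<noteq> 0}" and ?a = "\<lambda>i. coeff p i * x ^ i"
  have cE: "coeff p i \<in> E" for i using p unfolding poly_over_def by blast
  have "poly p x = (\<Sum>i\<le>degree p. ?a i)" by (rule poly_altdef)
  also have "\<dots> = (\<Sum>i\<in>?I. ?a i)" by (intro sum.mono_neutral_right) auto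
  finally have eq: "poly p x = (\<Sum>i\<in>?I. ?a i)" .
  have "degree p \<in> ?I" using p by simp
  then have ne: "?I \<noteq> {}" by blast
  have vi: "v (?a i) = v (coeff p i) + zsmul (int i) (v x)" if "i \<in> ?I" for i
    using that x cE E by (subst v_mult) (auto simp: v_power intro: sf_power[OF F])
  have "inj_on (\<lambda>i. v (?a i)) ?I"
  proof (rule inj_onI)
    fix i j assume ij: "i \<in> ?I" "j \<in> ?I" "v (?a i) = v (?a j)"
    then have "zsmul (int i - int j) (v x) = v (coeff p j) - v (coeff p i)"
      using vi[OF ij(1)] vi[OF ij(2)] by (simp add: zsmul_diff algebra_simps)
    moreover have "v (coeff p j) - v (coeff p i) \<in> vgroup v E"
      using ij cE by (intro sg_diff[OF vgroup_subgroup[OF E]] vgroupI) auto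
    ultimately have "int i - int j = 0" by (intro ind[rule_format]) simp
    then show "i = j" by simp
  qed
  moreover have "?a i \<in> F" "i \<in> ?I \<Longrightarrow> ?a i \<noteq> 0" for i
    using subsetD[OF E(2) cE] x(2) by (auto intro: sf_mult[OF F] sf_power[OF F x(1)])
  ultimately obtain i u where "i \<in> ?I" "u \<in> U" "res u = 1" "(\<Sum>i\<in>?I. ?a i) = ?a i * u"
    using sum_distinct_values[of ?I ?a] ne by auto
  then show ?thesis using eq cE by (intro bexI[of _ "coeff p i"]) auto
qed

lemma v_powi: "x \<in> F \<Longrightarrow> x \<noteq> 0 \<Longrightarrow> v (x powi n) = zsmul n (v x)"
proof (cases "0 \<le> n")
  case True
  assume "x \<in> F" "x \<noteq> 0"
  then show ?thesis using True v_power[of x "nat n"] by (simp add: power_int_def)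
next
  case False
  assume x: "x \<in> F" "x \<noteq> 0"
  then have "v (inverse x ^ nat (- n)) = zsmul (- n) (- v x)"
    using False v_power[of "inverse x" "nat (- n)"] sf_inverse[OF F] v_inverse by simp
  also have "\<dots> = zsmul n (v x)"
    using zsmul_mult[of "- n" "- 1" "v x"] zsmul_uminus[of 1 "v x"] by simp
  finally show ?thesis using False by (simp add: power_int_def)
qed

lemma sf_powi: "is_subfield E \<Longrightarrow> x \<in> E \<Longrightarrow> x powi n \<in> E"
  by (simp add: power_int_def sf_power sf_inverse)

text \<open>Every nonzero element of E(x) has the form c x^k u with c in E and u of residue 1.
  Values are read off directly; a unit has k = 0 by independence, so its residue is that of
  c.\<close>

lemma x_step:
  assumes E: "is_subfield E" "E \<subseteq> F" and x: "x \<in> F" "x \<noteq> 0"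
    and ind: "\<forall>n. zsmul n (v x) \<in> vgroup v E \<longrightarrow> n = 0"
  defines "L \<equiv> gen_field (E \<union> {x})"
  shows "\<not> algebraic_over E x"
    and "vgroup v L = {a + zsmul n (v x) | a n. a \<in> vgroup v E}"
    and "resfield v res L = resfield v res E"
proof -
  note pv = x_poly_value[OF E x ind]
  have U0: "u \<noteq> 0" "u \<in> F" "v u = 0" if "u \<in> U" for u using that by (auto simp: U_def)
  show "\<not> algebraic_over E x"
  proof
    assume "algebraic_over E x"
    then obtain p where "p \<noteq> 0" "poly_over E p" "poly p x = 0" unfolding algebraic_over_iff by blast
    then show False using pv[of p] x U0 by auto
  qed
  have LF: "is_subfield L" "E \<subseteq> L" "x \<in> L" "L \<subseteq> F"
    using gen_field_superset[of "E \<union> {x}"] E x gen_field_least[OF F, of "E \<union> {x}"]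
    unfolding L_def by (auto intro: gen_field_subfield)
  have form: "\<exists>c\<in>E. c \<noteq> 0 \<and> (\<exists>k. \<exists>u\<in>U. res u = 1 \<and> z = c * x powi k * u)" if z: "z \<in> L" "z \<noteq> 0" for z
  proof -
    obtain f g where fg: "poly_over E f" "poly_over E g" "poly g x \<noteq> 0" "z = poly f x / poly g x"
      using z(1) gen_field_simple[OF E(1), of x] unfolding L_def fractions_def by auto
    have "f \<noteq> 0" "g \<noteq> 0" using fg z by auto
    obtain c k u where c: "c \<in> E" "c \<noteq> 0" "u \<in> U" "res u = 1" "poly f x = c * x ^ k * u"
      using pv[OF fg(1) \<open>f \<noteq> 0\<close>] by blast
    obtain c' k' u' where c': "c' \<in> E" "c' \<noteq> 0" "u' \<in> U" "res u' = 1" "poly g x = c' * x ^ k' * u'"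
      using pv[OF fg(2) \<open>g \<noteq> 0\<close>] by blast
    have "z = (c / c') * x powi (int k - int k') * (u / u')"
      using fg(4) c c' x U0 by (simp add: power_int_diff field_simps)
    then show ?thesis
      using c c' U_divide[OF c(3) c'(3)] sf_divide[OF E(1)]
      by (intro bexI[of _ "c / c'"] conjI exI[of _ "int k - int k'"] bexI[of _ "u / u'"]) auto
  qed
  have vform: "v (c * x powi k * u) = v c + zsmul k (v x)" if "c \<in> E" "c \<noteq> 0" "u \<in> U" for c k u
    using that E x U0[OF that(3)] sf_powi[OF F x(1)]
    by (simp add: v_mult v_powi sf_mult[OF F] subset_iff)
  show "vgroup v L = {a + zsmul n (v x) | a n. a \<in> vgroup v E}"
  proof (intro subset_antisym subsetI)
    fix g assume "g \<in> vgroup v L"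
    then obtain z where z: "z \<in> L" "z \<noteq> 0" "g = v z" unfolding vgroup_def by auto
    then obtain c k u where c: "c \<in> E" "c \<noteq> 0" "u \<in> U" "z = c * x powi k * u" using form by blast
    then have "g = v c + zsmul k (v x)" using z vform by simp
    then show "g \<in> {a + zsmul n (v x) | a n. a \<in> vgroup v E}" using c vgroupI by blast
  next
    fix g assume "g \<in> {a + zsmul n (v x) | a n. a \<in> vgroup v E}"
    then obtain c n where c: "c \<in> E" "c \<noteq> 0" "g = v c + zsmul n (v x)" unfolding vgroup_def by auto
    have "1 \<in> U" using sf_1[OF F] v_1 by (simp add: U_def)
    then have "v (c * x powi n) = g" using vform[OF c(1,2), of 1] c(3) by simp
    moreover have "c * x powi n \<in> L" using c LF sf_mult[OF LF(1)] sf_powi[OF LF(1)] by blast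
    moreover have "c * x powi n \<noteq> 0" using c x by simp
    ultimately show "g \<in> vgroup v L" using vgroupI by blast
  qed
  show "resfield v res L = resfield v res E"
  proof
    show "resfield v res E \<subseteq> resfield v res L" using LF by (intro resfield_mono)
    show "resfield v res L \<subseteq> resfield v res E"
    proof
      fix a assume "a \<in> resfield v res L"
      then obtain z where z: "z \<in> L" "z \<in> vring" "a = res z" using LF resfieldE by metis
      show "a \<in> resfield v res E"
      proof (cases "a = 0")
        case True
        then show ?thesis using sf_0[OF resfield_subfield[OF E]] by simp
      next
        case False
        then have "z \<in> U" using z U_iff by simp
        then have z0: "z \<noteq> 0" "v z = 0" using U_def by auto
        obtain c k u where c: "c \<in> E" "c \<noteq> 0" "u \<in> U" "res u = 1" "z = c * x powi k * u"
          using form[OF z(1) z0(1)] by blast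
        have eq: "v c + zsmul k (v x) = 0" using vform[OF c(1-3)] c(5) z0 by simp
        then have "zsmul k (v x) = - v c" by (simp add: eq_neg_iff_add_eq_0 add.commute)
        then have "k = 0" using sg_uminus[OF vgroup_subgroup[OF E] vgroupI[OF c(1,2)]] by (intro ind[rule_format]) simp
        then have "z = c * u" "v c = 0" using c eq by auto
        then have "c \<in> vring" "u \<in> vring" using c E U_iff by (auto intro!: vringI)
        then have "a = res c" using z(3) c(4) res_mult[of c u] \<open>z = c * u\<close> by simp
        then show ?thesis using resfieldI[OF c(1) \<open>c \<in> vring\<close>] by simp
      qed
    qed
  qed
qed

text \<open>The Gauss valuation: divided by a coefficient of least value, the polynomial has a
  nonzero reduction, which cannot vanish at the transcendental residue of y.\<close>

lemma y_poly_value: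
  assumes E: "is_subfield E" "E \<subseteq> F" and y: "y \<in> vring"
    and tr: "\<not> algebraic_over (resfield v res E) (res y)"
    and p: "poly_over E p" "p \<noteq> 0"
  shows "\<exists>c\<in>E. c \<noteq> 0 \<and> (\<exists>u\<in>U. res u \<in> gen_field (resfield v res E \<union> {res y}) \<and> poly p y = c * u)"
proof -
  let ?n = "degree p" and ?R = "resfield v res E" and ?G = "gen_field (resfield v res E \<union> {res y})"
  have cE: "coeff p i \<in> E" for i using p unfolding poly_over_def by blast
  have "\<exists>i\<in>{..?n}. coeff p i \<noteq> 0" using p by (intro bexI[of _ ?n]) auto
  then obtain k where k: "k \<le> ?n" "coeff p k \<noteq> 0" "\<And>i. i \<le> ?n \<Longrightarrow> coeff p i / coeff p k \<in> vring"
    using dominant_coefficient[of "{..?n}" "coeff p"] subsetD[OF E(2) cE] by auto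
  let ?c = "coeff p k"
  define u where "u = (\<Sum>i\<le>?n. coeff p i / ?c * y ^ i)"
  have pu: "poly p y = ?c * u"
    using k(2) by (simp add: poly_altdef u_def sum_distrib_left)
  have term_in: "coeff p i / ?c * y ^ i \<in> vring" if "i \<le> ?n" for i
    using k(3)[OF that] y by (intro sr_mult[OF vring_subring] sr_power[OF vring_subring])
  then have uO: "u \<in> vring" unfolding u_def by (intro sr_sum[OF vring_subring]) auto
  define q where "q = sum_poly (\<lambda>i. res (coeff p i / ?c)) (Suc ?n)"
  have rescoeff: "res (coeff p i / ?c) \<in> ?R" if "i \<le> ?n" for i
    using k(3)[OF that] cE sf_divide[OF E(1)] by (intro resfieldI) auto
  have "res u = (\<Sum>i\<le>?n. res (coeff p i / ?c * y ^ i))"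
    unfolding u_def using term_in by (intro res_sum) auto
  also have "\<dots> = (\<Sum>i\<le>?n. res (coeff p i / ?c) * res y ^ i)"
    by (intro sum.cong refl)
      (simp only: atMost_iff res_mult[OF k(3) sr_power[OF vring_subring y]] res_power[OF y])
  also have "\<dots> = poly q (res y)"
    by (simp add: q_def poly_sum_poly lessThan_Suc_atMost)
  finally have ru: "res u = poly q (res y)" .
  have qR: "poly_over ?R q"
    unfolding q_def using rescoeff by (intro poly_over_sum_poly subfield_subring[OF resfield_subfield[OF E]]) auto
  \<comment> \<open>The coefficient divided by itself reduces to 1, so the reduction is not the zero
    polynomial.\<close>
  have "coeff q k = 1" using k by (simp add: q_def coeff_sum_poly res_1)
  then have "q \<noteq> 0" by auto
  then have "res u \<noteq> 0" using tr qR ru unfolding algebraic_over_iff by metis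
  then have "u \<in> U" using uO U_iff by blast
  moreover have "res u \<in> ?G"
    unfolding ru using gen_field_superset[of "?R \<union> {res y}"] poly_over_mono[OF _ qR, of ?G]
    by (intro poly_in_subring[OF subfield_subring[OF gen_field_subfield]]) auto
  ultimately show ?thesis using pu cE k(2) by blast
qed

text \<open>Every nonzero element of E(y) is c u with c in E and u a unit whose residue lies in
  Ev(yv). Hence no new values arise, and the residue of a unit is a product of residues already
  known.\<close>

lemma y_step:
  assumes E: "is_subfield E" "E \<subseteq> F" and y: "y \<in> vring"
    and tr: "\<not> algebraic_over (resfield v res E) (res y)"
  defines "L \<equiv> gen_field (E \<union> {y})"
  shows "\<not> algebraic_over E y"
    and "vgroup v L = vgroup v E"
    and "resfield v res L = gen_field (resfield v res E \<union> {res y})"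
proof -
  let ?R = "resfield v res E" and ?G = "gen_field (resfield v res E \<union> {res y})"
  note pv = y_poly_value[OF E y tr]
  have yF: "y \<in> F" using y vringD by blast
  have U0: "u \<noteq> 0" "u \<in> F" "v u = 0" if "u \<in> U" for u using that by (auto simp: U_def)
  show "\<not> algebraic_over E y"
  proof
    assume "algebraic_over E y"
    then obtain p where "p \<noteq> 0" "poly_over E p" "poly p y = 0" unfolding algebraic_over_iff by blast
    then show False using pv[of p] U0 by auto
  qed
  have LF: "is_subfield L" "E \<subseteq> L" "y \<in> L" "L \<subseteq> F"
    using gen_field_superset[of "E \<union> {y}"] E yF gen_field_least[OF F, of "E \<union> {y}"]
    unfolding L_def by (auto intro: gen_field_subfield)
  have form: "\<exists>c\<in>E. c \<noteq> 0 \<and> (\<exists>u\<in>U. res u \<in> ?G \<and> z = c * u)" if z: "z \<in> L" "z \<noteq> 0" for z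
  proof -
    obtain f g where fg: "poly_over E f" "poly_over E g" "poly g y \<noteq> 0" "z = poly f y / poly g y"
      using z(1) gen_field_simple[OF E(1), of y] unfolding L_def fractions_def by auto
    have "f \<noteq> 0" "g \<noteq> 0" using fg z by auto
    obtain c u where c: "c \<in> E" "c \<noteq> 0" "u \<in> U" "res u \<in> ?G" "poly f y = c * u"
      using pv[OF fg(1) \<open>f \<noteq> 0\<close>] by blast
    obtain c' u' where c': "c' \<in> E" "c' \<noteq> 0" "u' \<in> U" "res u' \<in> ?G" "poly g y = c' * u'"
      using pv[OF fg(2) \<open>g \<noteq> 0\<close>] by blast
    have "z = (c / c') * (u / u')" using fg(4) c c' by simp
    then show ?thesis
      using c c' U_divide[OF c(3) c'(3)] sf_divide[OF E(1)] sf_divide[OF gen_field_subfield c(4) c'(4)]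
      by (intro bexI[of _ "c / c'"] conjI bexI[of _ "u / u'"]) auto
  qed
  have vform: "v (c * u) = v c" if "c \<in> E" "c \<noteq> 0" "u \<in> U" for c u
    using that E U0[OF that(3)] by (simp add: v_mult subset_iff)
  show "vgroup v L = vgroup v E"
  proof
    show "vgroup v E \<subseteq> vgroup v L" using LF unfolding vgroup_def by blast
    show "vgroup v L \<subseteq> vgroup v E"
    proof
      fix g assume "g \<in> vgroup v L"
      then obtain z where z: "z \<in> L" "z \<noteq> 0" "g = v z" unfolding vgroup_def by auto
      then obtain c u where "c \<in> E" "c \<noteq> 0" "u \<in> U" "z = c * u" using form by blast
      then show "g \<in> vgroup v E" using z vform vgroupI by metis
    qed
  qed
  show "resfield v res L = ?G"
  proof
    show "?G \<subseteq> resfield v res L"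
      using resfield_mono[OF LF(2)] resfieldI[OF LF(3) y]
      by (intro gen_field_least[OF resfield_subfield[OF LF(1,4)]]) auto
    show "resfield v res L \<subseteq> ?G"
    proof
      fix a assume "a \<in> resfield v res L"
      then obtain z where z: "z \<in> L" "z \<in> vring" "a = res z" using LF resfieldE by metis
      show "a \<in> ?G"
      proof (cases "a = 0")
        case True
        then show ?thesis using sf_0[OF gen_field_subfield] by simp
      next
        case False
        then have "z \<in> U" using z U_iff by simp
        then have z0: "z \<noteq> 0" "v z = 0" using U_def by auto
        obtain c u where c: "c \<in> E" "c \<noteq> 0" "u \<in> U" "res u \<in> ?G" "z = c * u"
          using form[OF z(1) z0(1)] by blast
        have "v c = 0" using vform[OF c(1-3)] c(5) z0 by simp
        then have "c \<in> vring" "u \<in> vring" using c E U_iff by (auto intro!: vringI)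
        moreover from this have "res c \<in> ?G" using resfieldI[OF c(1)] gen_field_superset[of "?R \<union> {res y}"] by auto
        ultimately show ?thesis using z c res_mult sf_mult[OF gen_field_subfield] by simp
      qed
    qed
  qed
qed

end

section \<open>Transcendence bases with prescribed values and residues\<close>

lemma alg_indep_empty: "is_subfield K \<Longrightarrow> alg_indep K {}"
  using alg_indep_list[of K "[]"] by simp

lemma alg_indep_sequence:
  fixes n :: nat
  assumes K: "is_subfield K" and A: "alg_indep K A" and x: "\<And>i. i < n \<Longrightarrow> x i \<notin> acl K (A \<union> x ` {..<i})"
  shows "alg_indep K (A \<union> x ` {..<n}) \<and> inj_on x {..<n} \<and> A \<inter> x ` {..<n} = {}"
  using x
proof (induction n)
  case (Suc n)
  then have IH: "alg_indep K (A \<union> x ` {..<n})" "inj_on x {..<n}" "A \<inter> x ` {..<n} = {}" by auto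
  have xn: "x n \<notin> acl K (A \<union> x ` {..<n})" using Suc.prems by blast
  then have "x n \<notin> A \<union> x ` {..<n}" using acl_superset[of "A \<union> x ` {..<n}" K] by blast
  moreover have "alg_indep K (insert (x n) (A \<union> x ` {..<n}))" by (rule alg_indep_insert[OF K IH(1) xn])
  ultimately show ?case using IH by (auto simp: lessThan_Suc)
qed (use A in simp)

context valued_field
begin

lemma y_tower:
  fixes n :: nat
  assumes K: "is_subfield K" "K \<subseteq> F" and y: "\<forall>i<n. y i \<in> vring"
    and tr: "\<forall>i<n. res (y i) \<notin> acl (resfield v res K) (res ` y ` {..<i})"
  shows "vgroup v (gen_field (K \<union> y ` {..<n})) = vgroup v K \<and>
    resfield v res (gen_field (K \<union> y ` {..<n})) = gen_field (resfield v res K \<union> res ` y ` {..<n}) \<and>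
    (\<forall>i<n. y i \<notin> acl K (y ` {..<i}))"
  using y tr
proof (induction n)
  case 0
  then show ?case using gen_field_self[OF K(1)] gen_field_self[OF resfield_subfield[OF K]] by simp
next
  case (Suc n)
  let ?E = "gen_field (K \<union> y ` {..<n})" and ?R = "resfield v res K"
  have IH: "vgroup v ?E = vgroup v K" "resfield v res ?E = gen_field (?R \<union> res ` y ` {..<n})"
    "\<forall>i<n. y i \<notin> acl K (y ` {..<i})"
    using Suc by auto
  have "y ` {..<n} \<subseteq> F" using Suc.prems(1) vringD(1) by auto
  then have EF: "?E \<subseteq> F" using K by (intro gen_field_least[OF F]) auto
  have yn: "y n \<in> vring" using Suc.prems(1) by simp
  have "\<not> algebraic_over (resfield v res ?E) (res (y n))"
    using Suc.prems(2)[rule_format, of n] unfolding IH(2) acl_def by simp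
  note step = y_step[OF gen_field_subfield EF yn this]
  have L: "gen_field (?E \<union> {y n}) = gen_field (K \<union> y ` {..<Suc n})"
    unfolding gen_field_adjoin by (simp add: lessThan_Suc)
  have R: "gen_field (resfield v res ?E \<union> {res (y n)}) = gen_field (?R \<union> res ` y ` {..<Suc n})"
    unfolding IH(2) gen_field_adjoin by (simp add: lessThan_Suc)
  have "y n \<notin> acl K (y ` {..<n})" using step(1) unfolding acl_def by simp
  then show ?case
    using step(2,3) IH(1,3) unfolding L R by (simp add: less_Suc_eq)
qed

lemma x_tower:
  assumes E: "is_subfield E" "E \<subseteq> F" and x: "\<forall>i<n. x i \<in> F \<and> x i \<noteq> 0"
    and ind: "rat_indep_mod (vgroup v E) (\<lambda>i. v (x i)) n"
  shows "vgroup v (gen_field (E \<union> x ` {..<n})) =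
      {a + (\<Sum>i<n. zsmul (k i) (v (x i))) | a k. a \<in> vgroup v E} \<and>
    resfield v res (gen_field (E \<union> x ` {..<n})) = resfield v res E \<and>
    (\<forall>i<n. x i \<notin> acl E (x ` {..<i}))"
  using x ind
proof (induction n)
  case 0
  then show ?case using gen_field_self[OF E(1)] by simp
next
  case (Suc n)
  let ?L = "gen_field (E \<union> x ` {..<n})" and ?G = "vgroup v E"
  have "rat_indep_mod ?G (\<lambda>i. v (x i)) n"
    unfolding rat_indep_mod_def
  proof (intro allI impI)
    fix c i assume c: "(\<Sum>i<n. zsmul (c i) (v (x i))) \<in> ?G" and i: "i < n"
    have "(\<Sum>i<Suc n. zsmul ((c(n := 0)) i) (v (x i))) = (\<Sum>i<n. zsmul (c i) (v (x i)))" by simp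
    then have "(c(n := 0)) i = 0"
      using Suc.prems(2)[unfolded rat_indep_mod_def, rule_format, of "c(n := 0)" i] c i by simp
    then show "c i = 0" using i by simp
  qed
  then have IH: "vgroup v ?L = {a + (\<Sum>i<n. zsmul (k i) (v (x i))) | a k. a \<in> ?G}"
    "resfield v res ?L = resfield v res E" "\<forall>i<n. x i \<notin> acl E (x ` {..<i})"
    using Suc by auto
  have "x ` {..<n} \<subseteq> F" using Suc.prems(1) by auto
  then have LF: "?L \<subseteq> F" using E by (intro gen_field_least[OF F]) auto
  have xn: "x n \<in> F" "x n \<noteq> 0" using Suc.prems(1) by auto
  have "\<forall>k. zsmul k (v (x n)) \<in> vgroup v ?L \<longrightarrow> k = 0"
  proof (intro allI impI)
    fix k assume "zsmul k (v (x n)) \<in> vgroup v ?L"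
    then obtain a c where ac: "a \<in> ?G" "zsmul k (v (x n)) = a + (\<Sum>i<n. zsmul (c i) (v (x i)))"
      unfolding IH(1) by blast
    \<comment> \<open>Brings the combination to the other side, giving a relation of length
      \<open>Suc n\<close> modulo vE with last coefficient k.\<close>
    let ?c = "(\<lambda>i. - c i)(n := k)"
    have "(\<Sum>i<Suc n. zsmul (?c i) (v (x i))) = a"
      using ac(2) by (simp add: zsmul_uminus sum_negf)
    then have "?c n = 0"
      using Suc.prems(2)[unfolded rat_indep_mod_def, rule_format, of ?c n] ac(1) by simp
    then show "k = 0" by simp
  qed
  note step = x_step[OF gen_field_subfield LF xn this]
  have L: "gen_field (?L \<union> {x n}) = gen_field (E \<union> x ` {..<Suc n})"
    unfolding gen_field_adjoin by (simp add: lessThan_Suc)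
  have "x n \<notin> acl E (x ` {..<n})" using step(1) unfolding acl_def by simp
  moreover have "vgroup v (gen_field (E \<union> x ` {..<Suc n})) =
      {a + (\<Sum>i<Suc n. zsmul (k i) (v (x i))) | a k. a \<in> ?G}"
    unfolding L[symmetric] step(2)
  proof (intro subset_antisym subsetI)
    fix g assume "g \<in> {a + zsmul m (v (x n)) | a m. a \<in> vgroup v ?L}"
    then obtain a c m where ac: "a \<in> ?G" "g = a + (\<Sum>i<n. zsmul (c i) (v (x i))) + zsmul m (v (x n))"
      unfolding IH(1) by blast
    then have "g = a + (\<Sum>i<Suc n. zsmul ((c(n := m)) i) (v (x i)))" by (simp add: add.assoc)
    then show "g \<in> {a + (\<Sum>i<Suc n. zsmul (k i) (v (x i))) | a k. a \<in> ?G}" using ac(1) by blast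
  next
    fix g assume "g \<in> {a + (\<Sum>i<Suc n. zsmul (k i) (v (x i))) | a k. a \<in> ?G}"
    then obtain a k where ak: "a \<in> ?G" "g = a + (\<Sum>i<Suc n. zsmul (k i) (v (x i)))" by blast
    have "a + (\<Sum>i<n. zsmul (k i) (v (x i))) \<in> vgroup v ?L" using ak(1) unfolding IH(1) by blast
    moreover have "g = a + (\<Sum>i<n. zsmul (k i) (v (x i))) + zsmul (k n) (v (x n))"
      using ak(2) by (simp add: add.assoc)
    ultimately show "g \<in> {a + zsmul m (v (x n)) | a m. a \<in> vgroup v ?L}" by blast
  qed
  ultimately show ?case
    using step(3) IH(2,3) unfolding L by (simp add: less_Suc_eq)
qed

text \<open>The y are adjoined first: they leave the value group unchanged, so the values of the x
  remain independent modulo it, and adjoining the x then leaves the residue field unchanged.\<close>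

theorem abhyankar_basis:
  fixes r s :: nat
  assumes K: "is_subfield K" "K \<subseteq> F"
    and x: "\<forall>i<r. x i \<in> F \<and> x i \<noteq> 0" and y: "\<forall>i<s. y i \<in> vring"
    and ind: "rat_indep_mod (vgroup v K) (\<lambda>i. v (x i)) r"
    and tr: "\<forall>i<s. res (y i) \<notin> acl (resfield v res K) (res ` y ` {..<i})"
  defines "T \<equiv> x ` {..<r} \<union> y ` {..<s}"
  shows "alg_indep K T" "inj_on x {..<r}" "inj_on y {..<s}" "x ` {..<r} \<inter> y ` {..<s} = {}"
    and "vgroup v (gen_field (K \<union> T)) = {a + (\<Sum>i<r. zsmul (n i) (v (x i))) | a n. a \<in> vgroup v K}"
    and "resfield v res (gen_field (K \<union> T)) = gen_field (resfield v res K \<union> res ` y ` {..<s})"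
proof -
  let ?E = "gen_field (K \<union> y ` {..<s})"
  note yt = y_tower[OF K y tr]
  have "y ` {..<s} \<subseteq> F" using y vringD(1) by auto
  then have EF: "?E \<subseteq> F" using K by (intro gen_field_least[OF F]) auto
  have ind': "rat_indep_mod (vgroup v ?E) (\<lambda>i. v (x i)) r" using ind yt by simp
  note xt = x_tower[OF gen_field_subfield EF x ind']
  have eq: "gen_field (?E \<union> x ` A) = gen_field (K \<union> (y ` {..<s} \<union> x ` A))" for A
    unfolding gen_field_Un_gen_field by (simp add: Un_assoc)
  have T: "T = y ` {..<s} \<union> x ` {..<r}" unfolding T_def by blast
  have Y: "alg_indep K ({} \<union> y ` {..<s}) \<and> inj_on y {..<s} \<and> {} \<inter> y ` {..<s} = {}"
    using yt by (intro alg_indep_sequence[OF K(1) alg_indep_empty[OF K(1)]]) simp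
  have "x i \<notin> acl K (y ` {..<s} \<union> x ` {..<i})" if "i < r" for i
    using xt that eq unfolding acl_def by metis
  then have X: "alg_indep K (y ` {..<s} \<union> x ` {..<r}) \<and> inj_on x {..<r} \<and> y ` {..<s} \<inter> x ` {..<r} = {}"
    using Y by (intro alg_indep_sequence[OF K(1)]) auto
  show "alg_indep K T" "inj_on x {..<r}" "inj_on y {..<s}" "x ` {..<r} \<inter> y ` {..<s} = {}"
    using X Y T by auto
  show "vgroup v (gen_field (K \<union> T)) = {a + (\<Sum>i<r. zsmul (n i) (v (x i))) | a n. a \<in> vgroup v K}"
    using xt yt unfolding T eq[symmetric] by simp
  show "resfield v res (gen_field (K \<union> T)) = gen_field (resfield v res K \<union> res ` y ` {..<s})"
    using xt yt unfolding T eq[symmetric] by simp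
qed

section \<open>Value groups and residue fields of finite extensions\<close>

text \<open>Elements whose values lie in distinct cosets of vE are linearly independent over E, as
  the terms of a combination have distinct values. A largest such set is therefore finite and
  represents every coset.\<close>

lemma finite_ext_values:
  assumes E: "is_subfield E" and L: "is_subfield L" "L \<subseteq> F" and fin: "fin_ext E L"
  shows "\<exists>A\<subseteq>L - {0}. finite A \<and> (\<forall>z\<in>L - {0}. \<exists>a\<in>A. v z - v a \<in> vgroup v E)"
proof -
  obtain B where B: "finite B" "L \<subseteq> lspan E B" "E \<subseteq> L" using fin unfolding fin_ext_def by blast
  have EF: "E \<subseteq> F" using B L by blast
  note vE = vgroup_subgroup[OF E EF]
  let ?P = "\<lambda>A. A \<subseteq> L - {0} \<and> finite A \<and> (\<forall>a\<in>A. \<forall>b\<in>A. a \<noteq> b \<longrightarrow> v a - v b \<notin> vgroup v E)"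
  have bound: "card A < Suc (card B)" if A: "?P A" for A
  proof (rule ccontr)
    assume "\<not> ?thesis"
    then obtain d where d: "\<forall>a\<in>A. d a \<in> E" "\<exists>a\<in>A. d a \<noteq> 0" "(\<Sum>a\<in>A. d a * a) = 0"
      using lin_dep_family[OF subfield_subring[OF E] B(1), of A "\<lambda>a. a"] A B(2) by auto
    let ?I = "{a\<in>A. d a \<noteq> 0}"
    have sum0: "(\<Sum>a\<in>?I. d a * a) = 0"
      using d(3) A by (subst sum.mono_neutral_left[of A ?I]) auto
    have mem: "d a \<in> E" "d a \<in> F" "a \<in> F" "a \<noteq> 0" "d a \<noteq> 0" if "a \<in> ?I" for a
      using that d(1) A EF L(2) by auto
    have "inj_on (\<lambda>a. v (d a * a)) ?I"
    proof (rule inj_onI, rule ccontr)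
      fix a b assume ab: "a \<in> ?I" "b \<in> ?I" "v (d a * a) = v (d b * b)" "a \<noteq> b"
      then have "v (d a) + v a = v (d b) + v b"
        using mem[OF ab(1)] mem[OF ab(2)] by (simp add: v_mult)
      then have "v a - v b = v (d b) - v (d a)" by (simp add: algebra_simps)
      moreover have "v (d b) - v (d a) \<in> vgroup v E"
        using mem[OF ab(1)] mem[OF ab(2)] by (intro sg_diff[OF vE] vgroupI)
      ultimately have "v a - v b \<in> vgroup v E" by simp
      then show False using A ab by blast
    qed
    moreover have "finite ?I" "?I \<noteq> {}" using A d(2) by auto
    moreover have "d a * a \<in> F" "d a * a \<noteq> 0" if "a \<in> ?I" for a
      using mem[OF that] sf_mult[OF F] by auto
    ultimately obtain a u where "a \<in> ?I" "u \<in> U" "(\<Sum>a\<in>?I. d a * a) = d a * a * u"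
      using sum_distinct_values[of ?I "\<lambda>a. d a * a"] by blast
    then show False using sum0 mem[of a] by (simp add: U_def)
  qed
  have "?P {}" by simp
  moreover have "\<forall>A. ?P A \<longrightarrow> card A < Suc (card B)" by (intro allI impI bound)
  ultimately have "\<exists>A. ?P A \<and> (\<forall>A'. ?P A' \<longrightarrow> card A' \<le> card A)" by (rule ex_has_greatest_nat)
  then obtain A where A: "?P A" and "\<forall>A'. ?P A' \<longrightarrow> card A' \<le> card A" by (elim exE conjE) blast
  then have max: "card A' \<le> card A" if "?P A'" for A' using that by (elim allE impE)
  have "\<exists>a\<in>A. v z - v a \<in> vgroup v E" if z: "z \<in> L - {0}" for z
  proof (rule ccontr)
    assume neg: "\<not> ?thesis"
    have "z \<notin> A" using neg sg_0[OF vE] by force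
    have "v a - v z \<notin> vgroup v E" if "a \<in> A" for a
      using neg that sg_uminus[OF vE, of "v a - v z"] by auto
    then have "?P (insert z A)" using A z neg by auto
    then have "card (insert z A) \<le> card A" by (rule max)
    then show False using A \<open>z \<notin> A\<close> by simp
  qed
  then show ?thesis using A by blast
qed

text \<open>Lifts of residues independent over Ev are independent over E: normalise a relation by
  its dominant coefficient and take residues. A largest independent set of residues therefore exists
  and spans.\<close>

lemma finite_ext_residues:
  assumes E: "is_subfield E" and L: "is_subfield L" "L \<subseteq> F" and fin: "fin_ext E L"
  shows "fin_ext (resfield v res E) (resfield v res L)"
proof -
  obtain B where B: "finite B" "L \<subseteq> lspan E B" "E \<subseteq> L" using fin unfolding fin_ext_def by blast
  have EF: "E \<subseteq> F" using B L by blast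
  let ?R = "resfield v res E" and ?S = "resfield v res L"
  have R: "is_subfield ?R" by (rule resfield_subfield[OF E EF])
  let ?P = "\<lambda>A. A \<subseteq> ?S \<and> finite A \<and> lin_indep_over ?R A"
  have bound: "card A < Suc (card B)" if A: "?P A" for A
  proof (rule ccontr)
    assume neg: "\<not> ?thesis"
    have "\<forall>a\<in>A. \<exists>w. w \<in> L \<and> w \<in> vring \<and> res w = a"
      using A resfieldE[OF _ L(2)] by (metis subsetD)
    then obtain w where w: "\<And>a. a \<in> A \<Longrightarrow> w a \<in> L" "\<And>a. a \<in> A \<Longrightarrow> w a \<in> vring"
        "\<And>a. a \<in> A \<Longrightarrow> res (w a) = a" by metis
    obtain d where d: "\<forall>a\<in>A. d a \<in> E" "\<exists>a\<in>A. d a \<noteq> 0" "(\<Sum>a\<in>A. d a * w a) = 0"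
      using lin_dep_family[OF subfield_subring[OF E] B(1), of A w] A B(2) w(1) neg by auto
    obtain k where k: "k \<in> A" "d k \<noteq> 0" "\<And>a. a \<in> A \<Longrightarrow> d a / d k \<in> vring"
      using dominant_coefficient[of A d] A d(2) subsetD[OF EF] d(1) by (metis (no_types, lifting))
    have "(\<Sum>a\<in>A. d a / d k * w a) = (\<Sum>a\<in>A. d a * w a) / d k"
      by (simp add: sum_divide_distrib)
    then have "res (\<Sum>a\<in>A. d a / d k * w a) = 0" using d(3) res_0 by simp
    moreover have "res (\<Sum>a\<in>A. d a / d k * w a) = (\<Sum>a\<in>A. res (d a / d k) * a)"
    proof -
      have "res (\<Sum>a\<in>A. d a / d k * w a) = (\<Sum>a\<in>A. res (d a / d k * w a))"
        using k(3) w(2) by (intro res_sum sr_mult[OF vring_subring])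
      also have "\<dots> = (\<Sum>a\<in>A. res (d a / d k) * a)"
        by (intro sum.cong refl) (simp only: res_mult[OF k(3) w(2)] w(3))
      finally show ?thesis .
    qed
    ultimately have "(\<Sum>a\<in>A. res (d a / d k) * a) = 0" by simp
    moreover have "\<forall>a\<in>A. res (d a / d k) \<in> ?R"
      using k d(1) sf_divide[OF E] by (auto intro: resfieldI)
    moreover have "lin_indep_over ?R A" using A by blast
    ultimately have "\<forall>a\<in>A. res (d a / d k) = 0" by (intro lin_indepD)
    then have "res (d k / d k) = 0" using k(1) by blast
    then show False using k(2) res_1 by simp
  qed
  have "?P {}" by (simp add: lin_indep_over_def)
  moreover have "\<forall>A. ?P A \<longrightarrow> card A < Suc (card B)" by (intro allI impI bound)
  ultimately have "\<exists>A. ?P A \<and> (\<forall>A'. ?P A' \<longrightarrow> card A' \<le> card A)" by (rule ex_has_greatest_nat)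
  then obtain A where A: "?P A" and "\<forall>A'. ?P A' \<longrightarrow> card A' \<le> card A" by (elim exE conjE) blast
  then have max: "card A' \<le> card A" if "?P A'" for A' using that by (elim allE impE)
  have "?S \<subseteq> lspan ?R A"
  proof
    fix z assume z: "z \<in> ?S"
    show "z \<in> lspan ?R A"
    proof (rule ccontr)
      assume neg: "z \<notin> lspan ?R A"
      then have "z \<notin> A" using lspan_base[OF subfield_subring[OF R]] by blast
      have "?P (insert z A)" using A z lin_indep_insert[OF R _ _ neg] by blast
      then have "card (insert z A) \<le> card A" by (rule max)
      then show False using A \<open>z \<notin> A\<close> by simp
    qed
  qed
  then show ?thesis unfolding fin_ext_def using A resfield_mono[OF B(3)] by blast
qed

end

section \<open>Finitely generated torsion-free quotients\<close>

text \<open>Generation of the quotient G/H by the classes of g_0, ..., g_(n-1), phrased without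
  quotient groups to match \<open>rat_indep_mod\<close>.\<close>

definition generates_mod :: "'g::ab_group_add set \<Rightarrow> 'g set \<Rightarrow> nat \<Rightarrow> (nat \<Rightarrow> 'g) \<Rightarrow> bool" where
  "generates_mod H G n g \<longleftrightarrow> (\<forall>i<n. g i \<in> G) \<and> (\<forall>a\<in>G. \<exists>c. a - (\<Sum>i<n. zsmul (c i) (g i)) \<in> H)"

text \<open>Euclid's algorithm on the coefficients of a relation: the pair \<open>c\<^sub>i g\<^sub>i + c\<^sub>j g\<^sub>j\<close> is rewritten as
  \<open>(c\<^sub>i - e c\<^sub>j) g\<^sub>i + c\<^sub>j (g\<^sub>j + e g\<^sub>i)\<close> with \<open>e = \<plusminus>1\<close> chosen to shrink \<open>\<bar>c\<^sub>i\<bar>\<close>; torsion-freeness removes a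
  generator once a single coefficient is left.\<close>

lemma relation_drop_generator:
  assumes H: "subgroup_of H" and G: "subgroup_of G" "H \<subseteq> G" and tf: "torsion_free_mod H G"
    and gen: "generates_mod H G (Suc n) g"
    and rel: "(\<Sum>i<Suc n. zsmul (c i) (g i)) \<in> H" "\<exists>i<Suc n. c i \<noteq> 0"
  shows "\<exists>g'. generates_mod H G n g'"
  using gen rel
proof (induction "\<Sum>i<Suc n. nat \<bar>c i\<bar>" arbitrary: c g rule: less_induct)
  case less
  note gen = less.prems(1) and rel = less.prems(2,3)
  have gG: "g i \<in> G" if "i < Suc n" for i using gen that unfolding generates_mod_def by blast
  obtain j where j: "j < Suc n" "c j \<noteq> 0" using rel by blast
  show ?case
  proof (cases "\<exists>i<Suc n. i \<noteq> j \<and> c i \<noteq> 0")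
    case False
    have "(\<Sum>i<Suc n. zsmul (c i) (g i)) = (\<Sum>i<Suc n. if i = j then zsmul (c j) (g j) else 0)"
      using False by (intro sum.cong refl) auto
    also have "\<dots> = zsmul (c j) (g j)" using j by simp
    finally have cj: "zsmul (c j) (g j) \<in> H" using rel(1) by simp
    have "nsmul (nat \<bar>c j\<bar>) (g j) \<in> H"
      using cj sg_uminus[OF H cj] by (cases "0 \<le> c j") (auto simp: zsmul_def)
    moreover have "0 < nat \<bar>c j\<bar>" using j by simp
    ultimately have gj: "g j \<in> H" using tf gG[OF j(1)] unfolding torsion_free_mod_def by blast
    define f where "f = (\<lambda>i. if i < j then i else Suc i)"
    have f: "bij_betw f {..<n} ({..<Suc n} - {j})"
      unfolding f_def by (rule bij_betw_byWitness[of _ "\<lambda>i. if i < j then i else i - 1"]) (use j in auto)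
    have "\<exists>c. a - (\<Sum>i<n. zsmul (c i) (g (f i))) \<in> H" if "a \<in> G" for a
    proof -
      obtain e where e: "a - (\<Sum>i<Suc n. zsmul (e i) (g i)) \<in> H"
        using gen \<open>a \<in> G\<close> unfolding generates_mod_def by blast
      have "(\<Sum>i<Suc n. zsmul (e i) (g i)) = zsmul (e j) (g j) + (\<Sum>i\<in>{..<Suc n} - {j}. zsmul (e i) (g i))"
        using j by (intro sum.remove) auto
      also have "(\<Sum>i\<in>{..<Suc n} - {j}. zsmul (e i) (g i)) = (\<Sum>i<n. zsmul (e (f i)) (g (f i)))"
        by (rule sum.reindex_bij_betw[OF f, symmetric])
      finally have "a - (\<Sum>i<n. zsmul (e (f i)) (g (f i))) =
          a - (\<Sum>i<Suc n. zsmul (e i) (g i)) + zsmul (e j) (g j)" by simp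
      also have "\<dots> \<in> H" by (rule sg_add[OF H e sg_zsmul[OF H gj]])
      finally show ?thesis by (rule exI[of _ "\<lambda>i. e (f i)"])
    qed
    moreover have "g (f i) \<in> G" if "i < n" for i using that gG[of "f i"] by (auto simp: f_def)
    ultimately show ?thesis unfolding generates_mod_def by (intro exI[of _ "\<lambda>i. g (f i)"]) auto
  next
    case True
    then obtain k where k: "k < Suc n" "k \<noteq> j" "c k \<noteq> 0" by blast
    have "\<exists>i l. i < Suc n \<and> l < Suc n \<and> i \<noteq> l \<and> c l \<noteq> 0 \<and> \<bar>c l\<bar> \<le> \<bar>c i\<bar>"
    proof (cases "\<bar>c j\<bar> \<le> \<bar>c k\<bar>")
      case True
      then show ?thesis using j k by blast
    next
      case False
      then show ?thesis using j k by (metis linear)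
    qed
    then obtain i l where il: "i < Suc n" "l < Suc n" "i \<noteq> l" "c l \<noteq> 0" "\<bar>c l\<bar> \<le> \<bar>c i\<bar>" by blast
    \<comment> \<open>With this sign the new coefficient has absolute value
      \<open>\<bar>c i\<bar> - \<bar>c l\<bar>\<close>, strictly below
      \<open>\<bar>c i\<bar>\<close>.\<close>
    define e where "e = sgn (c i) * sgn (c l)"
    define c' where "c' = c(i := c i - e * c l)"
    define g' where "g' = g(l := g l + zsmul e (g i))"
    have "c i \<noteq> 0" using il by auto
    then have smaller: "\<bar>c i - e * c l\<bar> < \<bar>c i\<bar>"
      using il by (auto simp: e_def sgn_if abs_if split: if_splits)
    have "(\<Sum>m<Suc n. nat \<bar>c' m\<bar>) < (\<Sum>m<Suc n. nat \<bar>c m\<bar>)"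
    proof (rule sum_strict_mono_ex1)
      show "\<forall>m\<in>{..<Suc n}. nat \<bar>c' m\<bar> \<le> nat \<bar>c m\<bar>" using smaller by (auto simp: c'_def)
      show "\<exists>m\<in>{..<Suc n}. nat \<bar>c' m\<bar> < nat \<bar>c m\<bar>"
        using smaller il(1) by (intro bexI[of _ i]) (auto simp: c'_def)
    qed simp
    moreover have split: "(\<Sum>m<Suc n. f m) = f i + f l + (\<Sum>m\<in>{..<Suc n} - {i} - {l}. f m)"
      for f :: "nat \<Rightarrow> 'a"
    proof -
      have "(\<Sum>m<Suc n. f m) = f i + (\<Sum>m\<in>{..<Suc n} - {i}. f m)"
        using il by (intro sum.remove) auto
      also have "(\<Sum>m\<in>{..<Suc n} - {i}. f m) = f l + (\<Sum>m\<in>{..<Suc n} - {i} - {l}. f m)"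
        using il by (intro sum.remove) auto
      finally show ?thesis by (simp only: add.assoc)
    qed
    \<comment> \<open>The substitution is compensated for every coefficient family d, not only for
      the relation; hence the new elements still generate.\<close>
    have change: "(\<Sum>m<Suc n. zsmul ((d(i := d i - e * d l)) m) (g' m)) = (\<Sum>m<Suc n. zsmul (d m) (g m))" for d
    proof -
      have "zsmul (d i - e * d l) (g i) + zsmul (d l) (g l + zsmul e (g i)) = zsmul (d i) (g i) + zsmul (d l) (g l)"
        by (simp add: zsmul_diff zsmul_add_right mult.commute[of e] zsmul_mult)
      moreover have "(\<Sum>m\<in>{..<Suc n} - {i} - {l}. zsmul ((d(i := d i - e * d l)) m) (g' m)) =
          (\<Sum>m\<in>{..<Suc n} - {i} - {l}. zsmul (d m) (g m))"
        by (intro sum.cong) (auto simp: g'_def)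
      ultimately show ?thesis
        unfolding split using il(3) by (simp add: g'_def)
    qed
    have "(\<Sum>m<Suc n. zsmul (c' m) (g' m)) \<in> H" unfolding c'_def change using rel(1) .
    moreover have "\<exists>m<Suc n. c' m \<noteq> 0" using il by (intro exI[of _ l]) (auto simp: c'_def)
    moreover have "generates_mod H G (Suc n) g'"
      unfolding generates_mod_def
    proof (intro conjI allI impI ballI)
      fix m assume "m < Suc n"
      then show "g' m \<in> G"
        using gG il sg_add[OF G(1)] sg_zsmul[OF G(1)] by (auto simp: g'_def)
    next
      fix a assume "a \<in> G"
      then obtain d where "a - (\<Sum>i<Suc n. zsmul (d i) (g i)) \<in> H"
        using gen unfolding generates_mod_def by blast
      then show "\<exists>d. a - (\<Sum>m<Suc n. zsmul (d m) (g' m)) \<in> H"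
        using change[of d] by (intro exI[of _ "d(i := d i - e * d l)"]) simp
    qed
    ultimately show ?thesis using less.hyps[of c' g'] by blast
  qed
qed

text \<open>A generating family of least length is independent, since a nontrivial relation would
  allow one generator to be dropped.\<close>

lemma torsion_free_basis:
  assumes H: "subgroup_of H" and G: "subgroup_of G" "H \<subseteq> G" and tf: "torsion_free_mod H G"
    and gen: "generates_mod H G n g"
  shows "\<exists>m g. generates_mod H G m g \<and> rat_indep_mod H g m"
proof -
  let ?P = "\<lambda>m. \<exists>g. generates_mod H G m g"
  define m where "m = (LEAST m. ?P m)"
  have "?P m" unfolding m_def by (rule LeastI[of ?P n]) (use gen in blast)
  then obtain g where g: "generates_mod H G m g" by blast
  have "rat_indep_mod H g m"
    unfolding rat_indep_mod_def
  proof (intro allI impI, rule ccontr)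
    fix c i assume c: "(\<Sum>i<m. zsmul (c i) (g i)) \<in> H" "i < m" "c i \<noteq> 0"
    then obtain k where k: "m = Suc k" by (cases m) auto
    have "?P k"
      using relation_drop_generator[OF H G tf, of k g c] g c unfolding k by blast
    then have "m \<le> k" unfolding m_def by (rule Least_le)
    then show False using k by simp
  qed
  then show ?thesis using g by blast
qed

text \<open>Identifies the length of the basis just found with the given rational rank, so that
  exactly r elements x_i result.\<close>

lemma ratrank_basis:
  assumes H: "subgroup_of H" and rk: "ratrank H G r"
    and gen: "generates_mod H G m g" and ind: "rat_indep_mod H g m"
  shows "m = r"
proof (rule antisym)
  show "m \<le> r"
  proof (rule ccontr)
    assume m: "\<not> m \<le> r"
    have "rat_indep_mod H g (Suc r)"
      unfolding rat_indep_mod_def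
    proof (intro allI impI)
      fix c i assume c: "(\<Sum>i<Suc r. zsmul (c i) (g i)) \<in> H" and i: "i < Suc r"
      let ?c = "\<lambda>i. if i < Suc r then c i else 0"
      have "(\<Sum>i<m. zsmul (?c i) (g i)) = (\<Sum>i<Suc r. zsmul (?c i) (g i))"
        using m by (intro sum.mono_neutral_right) auto
      also have "\<dots> = (\<Sum>i<Suc r. zsmul (c i) (g i))" by (intro sum.cong) auto
      finally have "?c i = 0"
        using ind[unfolded rat_indep_mod_def, rule_format, of ?c i] c i m by simp
      then show "c i = 0" using i by simp
    qed
    moreover have "\<forall>i<Suc r. g i \<in> G" using gen m unfolding generates_mod_def by auto
    ultimately show False using rk unfolding ratrank_def by blast
  qed
  show "r \<le> m"
  proof (rule ccontr)
    assume m: "\<not> r \<le> m"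
    obtain f where f: "\<forall>i<r. f i \<in> G" "rat_indep_mod H f r" using rk unfolding ratrank_def by blast
    have "\<forall>i<r. \<exists>c. f i - (\<Sum>j<m. zsmul (c j) (g j)) \<in> H"
      using f(1) gen unfolding generates_mod_def by blast
    then obtain c where c: "\<And>i. i < r \<Longrightarrow> f i - (\<Sum>j<m. zsmul (c i j) (g j)) \<in> H" by metis
    \<comment> \<open>There are more unknowns than equations over the integers: a nontrivial
      combination of the \<open>f i\<close> in which all the \<open>g j\<close> cancel modulo
      H.\<close>
    obtain d :: "nat \<Rightarrow> int" where d: "\<exists>i\<in>{..<r}. d i \<noteq> 0" "\<forall>j\<in>{..<m}. (\<Sum>i<r. d i * c i j) = 0"
      using homogeneous_system[of UNIV "{..<m}" "{..<r}" c] m by auto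
    have "(\<Sum>i<r. zsmul (d i) (f i - (\<Sum>j<m. zsmul (c i j) (g j)))) \<in> H"
      using c by (intro sg_sum[OF H] sg_zsmul[OF H]) auto
    moreover have "(\<Sum>i<r. zsmul (d i) (\<Sum>j<m. zsmul (c i j) (g j))) = 0"
    proof -
      have "(\<Sum>i<r. zsmul (d i) (\<Sum>j<m. zsmul (c i j) (g j))) = (\<Sum>i<r. \<Sum>j<m. zsmul (d i * c i j) (g j))"
        by (simp add: zsmul_sum_right zsmul_mult)
      also have "\<dots> = (\<Sum>j<m. \<Sum>i<r. zsmul (d i * c i j) (g j))" by (rule sum.swap)
      also have "\<dots> = (\<Sum>j<m. zsmul (\<Sum>i<r. d i * c i j) (g j))" by (simp only: zsmul_sum_left)
      also have "\<dots> = 0" using d(2) by simp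
      finally show ?thesis .
    qed
    moreover have zsd: "zsmul (d i) (a - b) = zsmul (d i) a - zsmul (d i) b" for i a b
      using zsmul_add_right[of "d i" "a - b" b] by (simp add: eq_diff_eq)
    have "(\<Sum>i<r. zsmul (d i) (f i - (\<Sum>j<m. zsmul (c i j) (g j)))) =
        (\<Sum>i<r. zsmul (d i) (f i)) - (\<Sum>i<r. zsmul (d i) (\<Sum>j<m. zsmul (c i j) (g j)))"
      by (simp only: zsd sum_subtractf)
    ultimately have "(\<Sum>i<r. zsmul (d i) (f i)) \<in> H" by (simp only: diff_0_right)
    then show False using f(2) d(1) unfolding rat_indep_mod_def by blast
  qed
qed

section \<open>Lifting generators of the value group and the residue field\<close>

lemma nsmul_pos:
  fixes g :: "'g::linordered_ab_group_add"
  assumes "0 < g" "0 < n"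
  shows "0 < nsmul n g"
  using assms(2)
proof (induction n)
  case (Suc n)
  then show ?case using assms(1) by (cases "n = 0") (auto intro: add_pos_pos)
qed simp

lemma sum_append:
  fixes \<alpha> \<beta> :: "nat \<Rightarrow> 'b::comm_monoid_add"
  shows "(\<Sum>i<r + m. if i < r then \<alpha> i else \<beta> (i - r)) = (\<Sum>i<r. \<alpha> i) + (\<Sum>j<m. \<beta> j)"
  by (induction m) (auto simp: add.assoc)

lemma image_append: "f ` {..<r + s} = f ` {..<r} \<union> (\<lambda>j. f (r + j)) ` {..<s::nat}"
proof -
  have "{..<r + s} = {..<r} \<union> (\<lambda>j. r + j) ` {..<s}"
  proof (intro subset_antisym subsetI)
    fix i assume "i \<in> {..<r + s}"
    then show "i \<in> {..<r} \<union> (\<lambda>j. r + j) ` {..<s}"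
      by (cases "i < r") (auto intro!: image_eqI[of _ _ "i - r"])
  qed auto
  then show ?thesis by (simp add: image_Un image_image)
qed

lemma transc_basis_enum:
  assumes K: "is_subfield K" and T: "transc_basis K F T" "finite T" "card T = n"
  shows "\<exists>y. inj_on y {..<n} \<and> y ` {..<n} = T \<and> (\<forall>i<n. y i \<notin> acl K (y ` {..<i}))"
proof -
  obtain y where y: "bij_betw y {..<n} T" using ex_bij_betw_nat_finite[OF T(2)] T(3) lessThan_atLeast0 by metis
  have inj: "inj_on y {..<n}" and im: "y ` {..<n} = T" using y unfolding bij_betw_def by auto
  have "y i \<notin> acl K (y ` {..<i})" if i: "i < n" for i
  proof (rule alg_indep_not_acl[OF K])
    have "insert (y i) (y ` {..<i}) \<subseteq> T" using i im by force
    then show "alg_indep K (insert (y i) (y ` {..<i}))"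
      using T(1) alg_indep_subset unfolding transc_basis_def by blast
    show "y i \<notin> y ` {..<i}"
    proof
      assume "y i \<in> y ` {..<i}"
      then obtain j where "j < i" "y i = y j" by auto
      then show False using inj_onD[OF inj, of i j] i by simp
    qed
  qed simp
  then show ?thesis using inj im by blast
qed

context valued_field
begin

text \<open>Here the absence of transcendence defect is used: r + s independent elements exhaust the
  transcendence degree.\<close>

lemma abhyankar_transc_basis:
  fixes r s :: nat
  assumes K: "is_subfield K" "K \<subseteq> F" and trd: "has_trdeg K F (r + s)"
    and x: "\<forall>i<r. x i \<in> F \<and> x i \<noteq> 0" and y: "\<forall>i<s. y i \<in> vring"
    and ind: "rat_indep_mod (vgroup v K) (\<lambda>i. v (x i)) r"
    and tr: "\<forall>i<s. res (y i) \<notin> acl (resfield v res K) (res ` y ` {..<i})"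
  shows "transc_basis K F (x ` {..<r} \<union> y ` {..<s})"
proof -
  note ab = abhyankar_basis[OF K x y ind tr]
  have "card (x ` {..<r} \<union> y ` {..<s}) = r + s"
    using ab(2-4) by (simp add: card_Un_disjoint card_image)
  moreover have "x ` {..<r} \<union> y ` {..<s} \<subseteq> F" using x y vringD(1) by auto
  ultimately show ?thesis using ab(1) by (intro has_trdegD(3)[OF K(1) trd]) auto
qed

lemma value_group_lift:
  assumes "\<forall>i<n. g i \<in> vgroup v F"
  shows "\<exists>x. \<forall>i<n. x i \<in> F \<and> x i \<noteq> 0 \<and> v (x i) = g i"
proof -
  have "\<exists>x. i < n \<longrightarrow> x \<in> F \<and> x \<noteq> 0 \<and> v x = g i" for i
  proof (cases "i < n")
    case True
    then have "g i \<in> v ` (F - {0})" using assms by (simp add: vgroup_def)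
    then show ?thesis by auto
  qed simp
  then show ?thesis by metis
qed

text \<open>Elements transcendental over Kv are nonzero, so their lifts are units; value 0 is what
  later protects their residues under corrections.\<close>

lemma residue_field_lift:
  assumes K: "is_subfield K" "K \<subseteq> F" and y: "\<forall>i<n. y i \<in> resfield v res F"
    and tr: "\<forall>i<n. y i \<notin> acl (resfield v res K) (y ` {..<i})"
  shows "\<exists>z. \<forall>i<n. z i \<in> U \<and> res (z i) = y i"
proof -
  have "\<exists>z. i < n \<longrightarrow> z \<in> U \<and> res z = y i" for i
  proof (cases "i < n")
    case True
    then obtain z where z: "z \<in> vring" "y i = res z" using y resfieldE by blast
    have "y i \<noteq> 0" using tr True sf_0[OF acl_subfield] by metis
    then show ?thesis using z U_iff by auto
  qed simp
  then show ?thesis by metis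
qed

text \<open>Any lifted basis will do at this stage, separating or not: F is finite over K(T), so
  finitely many coset representatives and finitely many residues complete the generators coming from
  T.\<close>

lemma fin_gen_value_group_and_residue_field:
  fixes r s :: nat
  assumes K: "is_subfield K" "K \<subseteq> F" and fg: "fin_gen_ext K F" and trd: "has_trdeg K F (r + s)"
    and rk: "ratrank (vgroup v K) (vgroup v F) r"
    and rtr: "has_trdeg (resfield v res K) (resfield v res F) s"
  shows "\<exists>n g. generates_mod (vgroup v K) (vgroup v F) n g"
    and "fin_gen_ext (resfield v res K) (resfield v res F)"
proof -
  let ?Kv = "resfield v res K" and ?Fv = "resfield v res F"
  have Kv: "is_subfield ?Kv" by (rule resfield_subfield[OF K])
  obtain g where g: "\<forall>i<r. g i \<in> vgroup v F" "rat_indep_mod (vgroup v K) g r"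
    using rk unfolding ratrank_def by blast
  obtain x where x: "\<forall>i<r. x i \<in> F \<and> x i \<noteq> 0 \<and> v (x i) = g i" using value_group_lift[OF g(1)] by blast
  obtain Tb where Tb: "transc_basis ?Kv ?Fv Tb" "finite Tb" "card Tb = s"
    using rtr unfolding has_trdeg_def by blast
  obtain b where b: "b ` {..<s} = Tb" "\<forall>i<s. b i \<notin> acl ?Kv (b ` {..<i})"
    using transc_basis_enum[OF Kv Tb] by blast
  have "\<forall>i<s. b i \<in> ?Fv" using b Tb(1) unfolding transc_basis_def by auto
  then obtain y where y: "\<forall>i<s. y i \<in> U \<and> res (y i) = b i" using residue_field_lift[OF K _ b(2)] by blast
  have yO: "\<forall>i<s. y i \<in> vring" using y U_iff by blast
  have ind: "rat_indep_mod (vgroup v K) (\<lambda>i. v (x i)) r"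
    using g(2) x unfolding rat_indep_mod_def by simp
  have resy: "res ` y ` {..<i} = b ` {..<i}" if "i \<le> s" for i
    using y that by (auto simp: image_image intro!: image_cong)
  then have tr: "\<forall>i<s. res (y i) \<notin> acl ?Kv (res ` y ` {..<i})"
    using b(2) y by simp
  let ?T = "x ` {..<r} \<union> y ` {..<s}"
  let ?E = "gen_field (K \<union> ?T)"
  have x': "\<forall>i<r. x i \<in> F \<and> x i \<noteq> 0" using x by blast
  have T: "transc_basis K F ?T" by (rule abhyankar_transc_basis[OF K trd x' yO ind tr])
  note ab = abhyankar_basis[OF K x' yO ind tr]
  have fin: "fin_ext ?E F" by (rule fin_ext_over_transc_basis[OF fg T])
  obtain A where A: "A \<subseteq> F - {0}" "finite A" "\<forall>z\<in>F - {0}. \<exists>a\<in>A. v z - v a \<in> vgroup v ?E"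
    using finite_ext_values[OF gen_field_subfield F subset_refl fin] by blast
  obtain e where e: "bij_betw e {..<card A} A" using ex_bij_betw_nat_finite[OF A(2)] lessThan_atLeast0 by metis
  \<comment> \<open>The values of the x_i generate vK(T) modulo vK; they are followed by the values
    of the coset representatives of vF modulo vK(T).\<close>
  define h where "h = (\<lambda>i. if i < r then v (x i) else v (e (i - r)))"
  have "generates_mod (vgroup v K) (vgroup v F) (r + card A) h"
    unfolding generates_mod_def
  proof (intro conjI allI impI ballI)
    fix i assume i: "i < r + card A"
    show "h i \<in> vgroup v F"
    proof (cases "i < r")
      case True
      then show ?thesis using g(1) x by (simp add: h_def)
    next
      case False
      then have "e (i - r) \<in> A" using i bij_betwE[OF e] by auto
      then show ?thesis using False A(1) vgroupI[of "e (i - r)" F] by (auto simp: h_def)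
    qed
  next
    fix a assume "a \<in> vgroup v F"
    then obtain z where z: "z \<in> F - {0}" "a = v z" unfolding vgroup_def by blast
    then obtain k where k: "k \<in> A" "v z - v k \<in> vgroup v ?E" using A(3) by blast
    have "k \<in> e ` {..<card A}" using k(1) e unfolding bij_betw_def by simp
    then obtain j where j: "j < card A" "e j = k" by auto
    obtain a' n where a': "a' \<in> vgroup v K" "v z - v k = a' + (\<Sum>i<r. zsmul (n i) (v (x i)))"
      using k(2) unfolding ab(5) by blast
    define c where "c = (\<lambda>i. if i < r then n i else if i - r = j then 1 else 0)"
    have "(\<Sum>i<r + card A. zsmul (c i) (h i)) = (\<Sum>i<r + card A. if i < r then zsmul (n i) (v (x i))
        else (\<lambda>l. if l = j then v k else 0) (i - r))"
      by (intro sum.cong refl) (auto simp: c_def h_def j)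
    also have "\<dots> = (\<Sum>i<r. zsmul (n i) (v (x i))) + v k"
      using j(1) sum_append[where \<alpha> = "\<lambda>i. zsmul (n i) (v (x i))" and \<beta> = "\<lambda>l. if l = j then v k else 0"
        and r = r and m = "card A"] by simp
    finally have "a - (\<Sum>i<r + card A. zsmul (c i) (h i)) = a'"
      using a'(2) z(2) by (simp add: algebra_simps)
    then show "\<exists>c. a - (\<Sum>i<r + card A. zsmul (c i) (h i)) \<in> vgroup v K" using a'(1) by metis
  qed
  then show "\<exists>n g. generates_mod (vgroup v K) (vgroup v F) n g" by blast
  have EF: "?E \<subseteq> F" using fin unfolding fin_ext_def by blast
  have "fin_ext (resfield v res ?E) ?Fv"
    by (rule finite_ext_residues[OF gen_field_subfield F subset_refl fin])
  then obtain B where B: "finite B" "B \<subseteq> ?Fv" "?Fv \<subseteq> lspan (resfield v res ?E) B"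
    "resfield v res ?E \<subseteq> ?Fv"
    unfolding fin_ext_def by blast
  have Fv: "is_subfield ?Fv" by (rule resfield_subfield[OF F subset_refl])
  let ?G = "gen_field (?Kv \<union> (res ` y ` {..<s} \<union> B))"
  have "?Fv \<subseteq> ?G"
  proof -
    have "resfield v res ?E \<subseteq> ?G" unfolding ab(6) by (intro gen_field_mono) auto
    moreover have "B \<subseteq> ?G" using gen_field_superset[of "?Kv \<union> (res ` y ` {..<s} \<union> B)"] by auto
    ultimately have "lspan (resfield v res ?E) B \<subseteq> ?G"
      by (intro lspan_subset subfield_subring gen_field_subfield)
    then show ?thesis using B(3) by blast
  qed
  moreover have "?G \<subseteq> ?Fv"
  proof (rule gen_field_least[OF Fv])
    have "res ` y ` {..<s} \<subseteq> ?Fv" using resy[of s] b(1) Tb(1) unfolding transc_basis_def by simp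
    then show "?Kv \<union> (res ` y ` {..<s} \<union> B) \<subseteq> ?Fv" using B(2) resfield_mono[OF K(2)] by blast
  qed
  ultimately show "fin_gen_ext ?Kv ?Fv"
    unfolding fin_gen_ext_def using B(1) by (intro exI[of _ "res ` y ` {..<s} \<union> B"]) auto
qed

text \<open>The correction \<open>b\<^sup>p z\<close> is taken of larger value than \<open>t\<close>, so it changes neither value nor residue.\<close>

lemma perturb:
  assumes w: "w \<in> F" "w \<noteq> 0" "0 < v w" and p: "2 \<le> p" and t: "t \<in> F" "t \<noteq> 0" and z: "z \<in> F"
  shows "\<exists>b\<in>F. b \<noteq> 0 \<and> t + b ^ p * z \<in> F \<and> t + b ^ p * z \<noteq> 0 \<and> v (t + b ^ p * z) = v t \<and>
    (v t = 0 \<longrightarrow> res (t + b ^ p * z) = res t)"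
proof -
  have "\<exists>b\<in>F. b \<noteq> 0 \<and> (b ^ p * z \<noteq> 0 \<longrightarrow> v t < v (b ^ p * z))"
  proof (cases "z = 0")
    case True
    then show ?thesis using w by (intro bexI[of _ w]) auto
  next
    case False
    have vb: "v (b ^ p * z) = nsmul p (v b) + v z" if "b \<in> F" "b \<noteq> 0" for b
      using that z False sf_power[OF F that(1)] by (simp add: v_mult v_power zsmul_of_nat)
    consider "v t < v z" | "v t = v z" | "v z < v t" by fastforce
    then show ?thesis
    proof cases
      case 1
      then show ?thesis using sf_1[OF F] by (intro bexI[of _ 1]) auto
    next
      case 2
      have "0 < nsmul p (v w)" using w(3) p by (intro nsmul_pos) auto
      then show ?thesis using 2 w vb[of w] by (intro bexI[of _ w]) auto
    next
      case 3
      \<comment> \<open>With d = v t - v z > 0 and b = t/z, the value of b^p z is v t + (p - 1) d,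
        above v t because p is at least 2. Powers of w need not suffice here when the value group is
        not archimedean.\<close>
      let ?b = "t / z" and ?d = "v t - v z"
      have b: "?b \<in> F" "?b \<noteq> 0" "v ?b = ?d" using t z False sf_divide[OF F] v_divide by auto
      obtain q where q: "p = Suc q" "0 < q" using p by (cases p) auto
      have "0 < nsmul q ?d" using 3 q by (intro nsmul_pos) auto
      then have "v t < nsmul p ?d + v z" unfolding q(1) by (simp add: algebra_simps)
      then show ?thesis using b vb[of ?b] by (intro bexI[of _ ?b]) auto
    qed
  qed
  then obtain b where b: "b \<in> F" "b \<noteq> 0" "b ^ p * z \<noteq> 0 \<Longrightarrow> v t < v (b ^ p * z)" by blast
  have "b ^ p * z \<in> F" using sf_mult[OF F sf_power[OF F b(1)] z] .
  then show ?thesis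
    using v_add_small[OF t _ b(3)] b sf_add[OF F t(1)] by (intro bexI[of _ b]) auto
qed

text \<open>Reconciles the prescribed values and residues with generation over K F^p; the element w
  of positive value supplies the room for the corrections.\<close>

lemma separating_lift:
  fixes r s :: nat
  assumes ac: "alg_closed_ty TYPE('a)"
    and K: "is_subfield K" "K \<subseteq> F" and fg: "fin_gen_ext K F" and sep: "separable_ext K F"
    and trd: "has_trdeg K F (r + s)"
    and w: "w \<in> F" "w \<noteq> 0" "0 < v w"
    and x0: "\<forall>i<r. x0 i \<in> F \<and> x0 i \<noteq> 0" and y0: "\<forall>i<s. y0 i \<in> U"
  shows "\<exists>x y. (\<forall>i<r. x i \<in> F \<and> x i \<noteq> 0 \<and> v (x i) = v (x0 i)) \<and>
    (\<forall>i<s. y i \<in> U \<and> res (y i) = res (y0 i)) \<and>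
    (\<forall>p. prime p \<and> (of_nat p :: 'a) = 0 \<longrightarrow>
      F = gen_field (K \<union> ppow p F \<union> (x ` {..<r} \<union> y ` {..<s})))"
proof (cases "\<exists>p. prime p \<and> (of_nat p :: 'a) = 0")
  case False
  then show ?thesis using x0 y0 by (intro exI[of _ x0] exI[of _ y0]) auto
next
  case True
  then obtain p where p: "prime p" "(of_nat p :: 'a) = 0" by blast
  let ?E = "gen_field (K \<union> ppow p F)"
  have EF: "?E \<subseteq> F" using K sf_power[OF F] by (intro gen_field_least[OF F]) auto
  have pE: "ppow p F \<subseteq> ?E" using gen_field_superset[of "K \<union> ppow p F"] by auto
  obtain Z where Z: "Z \<subseteq> F" "finite Z" "card Z \<le> r + s" "F = gen_field (?E \<union> Z)"
    using p_generators[OF p ac K(1) fg sep trd] by blast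
  define t where "t = (\<lambda>i. if i < r then x0 i else y0 (i - r))"
  have t: "t i \<in> F" "t i \<noteq> 0" if "i < r + s" for i
    using that x0 y0 by (auto simp: t_def U_def)
  \<comment> \<open>The number of earlier choices tells which prescribed element is due. Its residue
    is fixed only when its value is 0, which covers the y_i.\<close>
  define Q where "Q = (\<lambda>(ts :: 'a list) u. u \<in> F \<and> u \<noteq> 0 \<and> v u = v (t (length ts)) \<and>
    (v (t (length ts)) = 0 \<longrightarrow> res u = res (t (length ts))))"
  have choice: "\<exists>u\<in>F. Q ts u \<and> (\<forall>z\<in>F. \<exists>b\<in>F. b \<noteq> 0 \<and> Q ts (u + b ^ p * z))" if len: "length ts < r + s" for ts
  proof (rule bexI[of _ "t (length ts)"], intro conjI ballI)
    show "Q ts (t (length ts))" using t[OF len] by (simp add: Q_def)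
    show "t (length ts) \<in> F" using t[OF len] by blast
    fix z assume "z \<in> F"
    then show "\<exists>b\<in>F. b \<noteq> 0 \<and> Q ts (t (length ts) + b ^ p * z)"
      unfolding Q_def by (rule perturb[OF w prime_ge_2_nat[OF p(1)] t[OF len]])
  qed
  have "\<exists>ts. length ts = r + s \<and> set ts \<subseteq> F \<and> F = gen_field (?E \<union> set ts) \<and>
      (\<forall>i<r + s. Q (take i ts) (ts ! i))"
    by (rule p_generators_choice[OF p ac F EF pE Z(2,1,4,3)]) (rule choice)
  then obtain ts where ts: "length ts = r + s" "F = gen_field (?E \<union> set ts)"
      "\<forall>i<r + s. Q (take i ts) (ts ! i)"
    by blast
  have Qi: "ts ! i \<in> F" "ts ! i \<noteq> 0" "v (ts ! i) = v (t i)" "v (t i) = 0 \<Longrightarrow> res (ts ! i) = res (t i)"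
    if "i < r + s" for i
    using ts(3)[rule_format, OF that] that ts(1) by (simp_all add: Q_def)
  let ?x = "\<lambda>i. ts ! i" and ?y = "\<lambda>j. ts ! (r + j)"
  have "set ts = ?x ` {..<r + s}" using ts(1) by (auto simp: set_conv_nth)
  also have "\<dots> = ?x ` {..<r} \<union> ?y ` {..<s}" by (rule image_append)
  finally have setts: "set ts = ?x ` {..<r} \<union> ?y ` {..<s}" .
  have "F = gen_field (K \<union> ppow q F \<union> (?x ` {..<r} \<union> ?y ` {..<s}))" if "prime q" "(of_nat q :: 'a) = 0" for q
  proof -
    have "q = p" using prime_char_eq[OF that] prime_char_eq[OF p] by simp
    then show ?thesis using ts(2) gen_field_Un_gen_field[of "K \<union> ppow p F" "set ts"] setts by simp
  qed
  moreover have "?x i \<in> F \<and> ?x i \<noteq> 0 \<and> v (?x i) = v (x0 i)" if "i < r" for i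
    using Qi[of i] that by (simp add: t_def)
  moreover have "?y i \<in> U \<and> res (?y i) = res (y0 i)" if "i < s" for i
  proof -
    have "t (r + i) = y0 i" "y0 i \<in> U" using that y0 by (auto simp: t_def)
    then show ?thesis using Qi[of "r + i"] that by (simp add: U_def)
  qed
  ultimately show ?thesis by (intro exI[of _ ?x] exI[of _ ?y]) auto
qed

section \<open>The trivially valued case\<close>

text \<open>Under a trivial valuation \<open>res\<close> is a field embedding of all of F, so it
  commutes with field generation.\<close>

lemma trivial_resfield_gen_field:
  assumes triv: "\<forall>x\<in>F. x \<noteq> 0 \<longrightarrow> v x = 0" and S: "S \<subseteq> F"
  shows "resfield v res (gen_field S) = gen_field (res ` S)"
proof
  have ring: "vring = F" using triv unfolding val_ring_def by auto
  have GF: "gen_field S \<subseteq> F" by (rule gen_field_least[OF F S])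
  show "gen_field (res ` S) \<subseteq> resfield v res (gen_field S)"
  proof (rule gen_field_least[OF resfield_subfield[OF gen_field_subfield GF]])
    show "res ` S \<subseteq> resfield v res (gen_field S)"
      using gen_field_superset[of S] S ring by (auto intro!: resfieldI)
  qed
  \<comment> \<open>The preimage of the field generated by the residues is itself a subfield
    containing S.\<close>
  let ?P = "{x\<in>F. res x \<in> gen_field (res ` S)}"
  have "is_subfield ?P"
  proof (rule subfieldI)
    show "is_subring ?P"
      unfolding is_subring_def
      using ring res_1 sf_1[OF F] sf_1[OF gen_field_subfield[of "res ` S"]] res_add res_mult res_uminus
        sf_add[OF F] sf_mult[OF F] sf_uminus[OF F] sf_add[OF gen_field_subfield[of "res ` S"]]
        sf_mult[OF gen_field_subfield[of "res ` S"]] sf_uminus[OF gen_field_subfield[of "res ` S"]]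
      by auto
    fix x assume x: "x \<in> ?P" "x \<noteq> 0"
    then have "x \<in> U" using triv by (simp add: U_def)
    then show "inverse x \<in> ?P"
      using U_inverse[of x] x sf_inverse[OF F] sf_inverse[OF gen_field_subfield[of "res ` S"]] by auto
  qed
  moreover have "S \<subseteq> ?P" using S gen_field_superset[of "res ` S"] by auto
  ultimately have "gen_field S \<subseteq> ?P" by (rule gen_field_least)
  then show "resfield v res (gen_field S) \<subseteq> gen_field (res ` S)"
    unfolding resfield_def val_ring_def by auto
qed

text \<open>The identity F = E F^p is carried to the residue fields by the embedding
  \<open>res\<close>, where it again implies separability.\<close>

lemma trivial_separable_residue:
  assumes triv: "\<forall>x\<in>F. x \<noteq> 0 \<longrightarrow> v x = 0" and E: "is_subfield E" and fin: "fin_ext E F"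
    and gen: "\<And>p. prime p \<Longrightarrow> (of_nat p :: 'a) = 0 \<Longrightarrow> F = gen_field (E \<union> ppow p F)"
  shows "separable_ext (resfield v res E) (resfield v res F)"
proof (rule separable_extI)
  have EF: "E \<subseteq> F" using fin unfolding fin_ext_def by blast
  have ring: "vring = F" using triv unfolding val_ring_def by auto
  have image: "resfield v res L = res ` L" if "L \<subseteq> F" for L
    using that triv unfolding resfield_def val_ring_def by auto
  show "is_subfield (resfield v res E)" "is_subfield (resfield v res F)"
    using resfield_subfield E EF F by blast+
  show "fin_ext (resfield v res E) (resfield v res F)"
    by (rule finite_ext_residues[OF E F subset_refl fin])
  fix p assume p: "prime p" "(of_nat p :: 'b) = 0"
  \<comment> \<open>Shows that a prime vanishing in the residue field also vanishes in F, so that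
    the assumed generation applies to it.\<close>
  have "res (of_nat n) = of_nat n" for n
    by (induction n) (use ring sf_1[OF F] sf_of_nat[OF F] res_0 res_1 in \<open>auto simp: res_add\<close>)
  then have "res (of_nat p) = 0" using p by simp
  then have "(of_nat p :: 'a) = 0"
    using res_eq_0[of "of_nat p"] ring sf_of_nat[OF F, of p] triv by auto
  then have "F = gen_field (E \<union> ppow p F)" using gen p by blast
  then have "resfield v res F = gen_field (res ` (E \<union> ppow p F))"
    using trivial_resfield_gen_field[OF triv, of "E \<union> ppow p F"] EF sf_power[OF F] by auto
  moreover have "res ` ppow p F = ppow p (res ` F)"
    using ring res_power by (auto simp: image_image intro!: image_cong)
  ultimately show "resfield v res F = gen_field (resfield v res E \<union> ppow p (resfield v res F))"
    using image[OF EF] image[of F] by (simp add: image_Un)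
qed

end


theorem theorem1p4:
  fixes F K :: "'a::field set" and v :: "'a \<Rightarrow> 'g::linordered_ab_group_add"
    and res :: "'a \<Rightarrow> 'b::field" and r s :: nat
  assumes "alg_closed_ty TYPE('a)" and "alg_closed_ty TYPE('b)"
    and "is_subfield K" and "is_subfield F" and "K \<subseteq> F"
    and "fin_gen_ext K F"
    and "valuation F v" and "residue_map F v res"
    and "separable_ext K F"
    and "ratrank (vgroup v K) (vgroup v F) r"
    and "has_trdeg (resfield v res K) (resfield v res F) s"
    and "has_trdeg K F (r + s)"
  shows "\<exists>(x :: nat \<Rightarrow> 'a) (y :: nat \<Rightarrow> 'a).
    (let T = x ` {..<r} \<union> y ` {..<s}; KT = gen_field (K \<union> T) in
      inj_on x {..<r} \<and> inj_on y {..<s} \<and> x ` {..<r} \<inter> y ` {..<s} = {} \<and>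
      transc_basis K F T \<and> separable_ext KT F \<and>
      vgroup v KT = {a + (\<Sum>i<r. zsmul (n i) (v (x i))) | a n. a \<in> vgroup v K} \<and>
      (\<forall>n. (\<Sum>i<r. zsmul (n i) (v (x i))) \<in> vgroup v K \<longrightarrow> (\<forall>i<r. n i = 0)) \<and>
      (\<forall>i<s. 0 \<le> v (y i)) \<and>
      resfield v res KT = gen_field (resfield v res K \<union> res ` y ` {..<s}) \<and>
      ((torsion_free_mod (vgroup v K) (vgroup v F) \<and>
        separable_ext (resfield v res K) (resfield v res F)) \<longrightarrow>
         vgroup v KT = vgroup v F \<and> separable_ext (resfield v res KT) (resfield v res F)))"
proof -
  interpret valued_field F v res using assms by unfold_locales
  note ac = assms(1,2) and K = assms(3,5) and fg = assms(6) and sep = assms(9)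
    and rk = assms(10) and rtr = assms(11) and trd = assms(12)
  let ?Kv = "resfield v res K" and ?Fv = "resfield v res F"
  have Kv: "is_subfield ?Kv" by (rule resfield_subfield[OF K])
  have H: "subgroup_of (vgroup v K)" by (rule vgroup_subgroup[OF K])
  have G: "subgroup_of (vgroup v F)" by (rule vgroup_subgroup[OF F subset_refl])
  have HG: "vgroup v K \<subseteq> vgroup v F" using K(2) unfolding vgroup_def by blast
  show ?thesis
  proof (cases "\<forall>z\<in>F. z \<noteq> 0 \<longrightarrow> v z = 0")
    case triv: True
    have vg: "vgroup v E = {0}" if "is_subfield E" "E \<subseteq> F" for E
      using that triv sg_0[OF vgroup_subgroup[OF that]] unfolding vgroup_def by auto
    \<comment> \<open>All values are 0, so for r > 0 the coefficients 1 would contradict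
      independence modulo vK.\<close>
    have r: "r = 0"
    proof (rule ccontr)
      assume "r \<noteq> 0"
      obtain g where g: "\<forall>i<r. g i \<in> vgroup v F" "rat_indep_mod (vgroup v K) g r"
        using rk unfolding ratrank_def by blast
      have "(\<Sum>i<r. zsmul 1 (g i)) \<in> vgroup v K"
        using g(1) vg[OF F subset_refl] sg_0[OF H] by simp
      then have "\<forall>i<r. (1::int) = 0"
        by (rule g(2)[unfolded rat_indep_mod_def, rule_format, of "\<lambda>_. 1", THEN allI[OF impI]])
      then show False using \<open>r \<noteq> 0\<close> by simp
    qed
    obtain T where T: "transc_basis K F T" "finite T" "card T = s"
      and gen: "\<And>p. prime p \<Longrightarrow> (of_nat p :: 'a) = 0 \<Longrightarrow> F = gen_field (K \<union> ppow p F \<union> T)"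
      using separating_transc_basis[OF ac(1) K(1) fg sep trd] r by auto
    obtain y where y: "inj_on y {..<s}" "y ` {..<s} = T" "\<forall>i<s. y i \<notin> acl K (y ` {..<i})"
      using transc_basis_enum[OF K(1) T] by blast
    let ?KT = "gen_field (K \<union> T)"
    have TF: "T \<subseteq> F" using T(1) unfolding transc_basis_def by blast
    have KTF: "?KT \<subseteq> F" using TF K by (intro gen_field_least[OF F]) auto
    have "separable_ext ?KT F" by (rule separable_over_transc_basis[OF fg T(1) gen])
    moreover have "0 \<le> v (y i)" if "i < s" for i
    proof -
      have "y i \<noteq> 0" using y(3) that sf_0[OF acl_subfield] by metis
      moreover have "y i \<in> F" using y(2) TF that by auto
      ultimately show ?thesis using triv by simp
    qed
    moreover have "resfield v res ?KT = gen_field (?Kv \<union> res ` T)"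
    proof -
      have "?Kv = res ` K" using triv K(2) unfolding resfield_def val_ring_def by auto
      then show ?thesis using trivial_resfield_gen_field[OF triv, of "K \<union> T"] K TF by (simp add: image_Un)
    qed
    moreover have "separable_ext (resfield v res ?KT) ?Fv"
    proof (rule trivial_separable_residue[OF triv gen_field_subfield])
      show "fin_ext ?KT F" by (rule fin_ext_over_transc_basis[OF fg T(1)])
      fix p assume "prime p" "(of_nat p :: 'a) = 0"
      then have "F = gen_field (K \<union> ppow p F \<union> T)" by (rule gen)
      also have "K \<union> ppow p F \<union> T = K \<union> T \<union> ppow p F" by blast
      finally show "F = gen_field (?KT \<union> ppow p F)" by (simp only: gen_field_Un_gen_field)
    qed
    moreover have "vgroup v ?KT = {0}" "vgroup v F = {0}" "vgroup v K = {0}"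
      using vg[OF gen_field_subfield KTF] vg[OF F subset_refl] vg[OF K] by auto
    ultimately show ?thesis
      using r y(1,2) T(1) unfolding Let_def by (intro exI[of _ y]) simp
  next
    case False
    then obtain w' where w': "w' \<in> F" "w' \<noteq> 0" "v w' \<noteq> 0" by blast
    obtain w where w: "w \<in> F" "w \<noteq> 0" "0 < v w"
    proof (cases "0 < v w'")
      case True
      then show ?thesis using w' that by blast
    next
      case False
      then have "0 < v (inverse w')" using w' v_inverse[of w'] by simp
      then show ?thesis using w' sf_inverse[OF F, of w'] that[of "inverse w'"] by simp
    qed
    note fin = fin_gen_value_group_and_residue_field[OF K fg trd rk rtr]
    let ?tf = "torsion_free_mod (vgroup v K) (vgroup v F)" and ?rs = "separable_ext ?Kv ?Fv"
    \<comment> \<open>One family serves both parts: a basis of vF modulo vK in the torsion-free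
      case, and otherwise any independent family of length r.\<close>
    have "\<exists>g. (\<forall>i<r. g i \<in> vgroup v F) \<and> rat_indep_mod (vgroup v K) g r \<and>
      (?tf \<longrightarrow> generates_mod (vgroup v K) (vgroup v F) r g)"
    proof (cases ?tf)
      case True
      obtain n h where "generates_mod (vgroup v K) (vgroup v F) n h" using fin(1) by blast
      then obtain m g where g: "generates_mod (vgroup v K) (vgroup v F) m g" "rat_indep_mod (vgroup v K) g m"
        using torsion_free_basis[OF H G HG True] by blast
      have "m = r" by (rule ratrank_basis[OF H rk g])
      then show ?thesis using g unfolding generates_mod_def by blast
    next
      case False
      then show ?thesis using rk unfolding ratrank_def by blast
    qed
    then obtain g where g: "\<forall>i<r. g i \<in> vgroup v F" "rat_indep_mod (vgroup v K) g r"
      "?tf \<Longrightarrow> generates_mod (vgroup v K) (vgroup v F) r g" by blast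
    \<comment> \<open>Likewise for residues: a separating basis if Fv|Kv is separable, and otherwise
      any transcendence basis.\<close>
    have "\<exists>Tb. transc_basis ?Kv ?Fv Tb \<and> finite Tb \<and> card Tb = s \<and>
      (?rs \<longrightarrow> (\<forall>p. prime p \<and> (of_nat p :: 'b) = 0 \<longrightarrow> ?Fv = gen_field (?Kv \<union> ppow p ?Fv \<union> Tb)))"
    proof (cases ?rs)
      case True
      then show ?thesis using separating_transc_basis[OF ac(2) Kv fin(2) True rtr] by blast
    next
      case False
      then show ?thesis using rtr unfolding has_trdeg_def by blast
    qed
    then obtain Tb where Tb: "transc_basis ?Kv ?Fv Tb" "finite Tb" "card Tb = s"
      and gen_res: "\<And>p. ?rs \<Longrightarrow> prime p \<Longrightarrow> (of_nat p :: 'b) = 0 \<Longrightarrow> ?Fv = gen_field (?Kv \<union> ppow p ?Fv \<union> Tb)"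
      by blast
    obtain b where b: "b ` {..<s} = Tb" "\<forall>i<s. b i \<notin> acl ?Kv (b ` {..<i})"
      using transc_basis_enum[OF Kv Tb] by blast
    obtain x0 where x0: "\<forall>i<r. x0 i \<in> F \<and> x0 i \<noteq> 0 \<and> v (x0 i) = g i"
      using value_group_lift[OF g(1)] by blast
    have "\<forall>i<s. b i \<in> ?Fv" using b Tb(1) unfolding transc_basis_def by auto
    then obtain y0 where y0: "\<forall>i<s. y0 i \<in> U \<and> res (y0 i) = b i"
      using residue_field_lift[OF K _ b(2)] by blast
    have "\<forall>i<r. x0 i \<in> F \<and> x0 i \<noteq> 0" "\<forall>i<s. y0 i \<in> U" using x0 y0 by blast+
    from separating_lift[OF ac(1) K fg sep trd w this]
    obtain x y where x1: "\<forall>i<r. x i \<in> F \<and> x i \<noteq> 0 \<and> v (x i) = v (x0 i)"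
      and y1: "\<forall>i<s. y i \<in> U \<and> res (y i) = res (y0 i)"
      and gen: "\<And>p. prime p \<Longrightarrow> (of_nat p :: 'a) = 0 \<Longrightarrow>
        F = gen_field (K \<union> ppow p F \<union> (x ` {..<r} \<union> y ` {..<s}))"
      by blast
    have x: "\<forall>i<r. x i \<in> F \<and> x i \<noteq> 0" "\<And>i. i < r \<Longrightarrow> v (x i) = g i" using x1 x0 by auto
    have y: "\<forall>i<s. y i \<in> vring" "\<And>i. i < s \<Longrightarrow> res (y i) = b i" "\<And>i. i < s \<Longrightarrow> v (y i) = 0"
      using y1 y0 U_iff by (auto simp: U_def)
    have ind: "rat_indep_mod (vgroup v K) (\<lambda>i. v (x i)) r"
      using g(2) x(2) unfolding rat_indep_mod_def by simp
    have resy: "res ` y ` {..<i} = b ` {..<i}" if "i \<le> s" for i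
      using y(2) that by (auto simp: image_image intro!: image_cong)
    have tr: "\<forall>i<s. res (y i) \<notin> acl ?Kv (res ` y ` {..<i})"
      using b(2) y(2) resy by simp
    let ?T = "x ` {..<r} \<union> y ` {..<s}"
    let ?KT = "gen_field (K \<union> ?T)"
    have T: "transc_basis K F ?T" by (rule abhyankar_transc_basis[OF K trd x(1) y(1) ind tr])
    note ab = abhyankar_basis[OF K x(1) y(1) ind tr]
    have sepT: "separable_ext ?KT F" by (rule separable_over_transc_basis[OF fg T gen])
    \<comment> \<open>The corrected elements keep the residues b_i, so K(T)v is Kv(Tb) and the
      choice of \<open>Tb\<close> decides the separability of Fv over it.\<close>
    have resT: "resfield v res ?KT = gen_field (?Kv \<union> Tb)"
      using ab(6) resy[of s] b(1) by simp
    have "vgroup v ?KT = vgroup v F" if tf: ?tf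
    proof
      have "?KT \<subseteq> F" using K T unfolding transc_basis_def by (intro gen_field_least[OF F]) auto
      then show "vgroup v ?KT \<subseteq> vgroup v F" unfolding vgroup_def by blast
      show "vgroup v F \<subseteq> vgroup v ?KT"
      proof
        fix a assume "a \<in> vgroup v F"
        then obtain c where c: "a - (\<Sum>i<r. zsmul (c i) (g i)) \<in> vgroup v K"
          using g(3)[OF tf] unfolding generates_mod_def by blast
        have "(\<Sum>i<r. zsmul (c i) (g i)) = (\<Sum>i<r. zsmul (c i) (v (x i)))"
          using x(2) by (intro sum.cong) auto
        then have "a = (a - (\<Sum>i<r. zsmul (c i) (g i))) + (\<Sum>i<r. zsmul (c i) (v (x i)))" by simp
        then show "a \<in> vgroup v ?KT" unfolding ab(5) using c by blast
      qed
    qed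
    moreover have "separable_ext (resfield v res ?KT) ?Fv" if ?rs
      unfolding resT by (rule separable_over_transc_basis[OF fin(2) Tb(1) gen_res[OF that]])
    moreover have "\<forall>n. (\<Sum>i<r. zsmul (n i) (v (x i))) \<in> vgroup v K \<longrightarrow> (\<forall>i<r. n i = 0)"
      using ind unfolding rat_indep_mod_def .
    moreover have "\<forall>i<s. 0 \<le> v (y i)" using y(3) by simp
    ultimately show ?thesis
      unfolding Let_def using T sepT ab(2-6) by (intro exI[of _ x] exI[of _ y] conjI impI) simp_all
  qed
qed

end
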